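(* Let $H$ be a bounded self-adjoint operator on $l_2(\mathbb{Z}^2)$ of finite range, i.e. there is a finite $R>0$ such that $\langle\delta_m,H\delta_n\rangle=0$ whenever $\mathrm{dist}(n,m)>R$. Assume that $H$ has a spectral gap, let $\mu$ lie in this gap, let $P=\chi_{(-\infty,\mu)}(H)$ be the Fermi projection, and let $\Lambda_x,\Lambda_y$ be switch functions. Then $$2\pi i\,\mathrm{Tr}[P\Lambda_xP,P\Lambda_yP]\in\mathbb{Z}.$$
   Context: $(\delta_n)_{n\in\mathbb{Z}^2}$ is the canonical orthonormal basis of $l_2(\mathbb{Z}^2)$, $n=(n_x,n_y)$, and $\mathrm{dist}$ is the usual (Euclidean) distance on $\mathbb{Z}^2$. A spectral gap is a nonempty open interval disjoint from the spectrum $\sigma(H)$. Switch functions: $\Lambda_x:\mathbb{R}\to[0,1]$ is a switch function if it is nondecreasing (not necessarily continuous) and there are $L_l<0<L_r$ with $\Lambda_x(x)=0$ for $x<L_l$ and $\Lambda_x(x)=1$ for $x>L_r$. The same symbol denotes the multiplication operator $\Lambda_x\delta_{(n_x,n_y)}=\Lambda_x(n_x)\delta_{(n_x,n_y)}$. Analogously, $\Lambda_y$ is a switch function acting by $\Lambda_y\delta_{(n_x,n_y)}=\Lambda_y(n_y)\delta_{(n_x,n_y)}$. $[X,Y]=XY-YX$. The quantity $2\pi i\,\mathrm{Tr}[P\Lambda_xP,P\Lambda_yP]$ is the transverse Hall conductance. *)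

theory Defs
  imports "HOL-Analysis.Analysis"
begin

section \<open>The complex Hilbert space of square-summable families\<close>

typedef 'a ell2 = "{f :: 'a \<Rightarrow> complex. (\<lambda>n. (cmod (f n))\<^sup>2) summable_on UNIV}"
  by (rule exI[of _ "\<lambda>_. 0"]) simp

setup_lifting type_definition_ell2

lemma summable_on_sqr_add:
  fixes f g :: "'a \<Rightarrow> complex"
  assumes "(\<lambda>n. (cmod (f n))\<^sup>2) summable_on UNIV" "(\<lambda>n. (cmod (g n))\<^sup>2) summable_on UNIV"
  shows "(\<lambda>n. (cmod (f n + g n))\<^sup>2) summable_on UNIV"
proof (rule summable_on_comparison_test)
  show "(\<lambda>n. 2 * (cmod (f n))\<^sup>2 + 2 * (cmod (g n))\<^sup>2) summable_on UNIV"
    using assms by (intro summable_on_add summable_on_cmult_right)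
  fix n
  have "(cmod (f n + g n))\<^sup>2 \<le> (cmod (f n) + cmod (g n))\<^sup>2"
    by (intro power_mono norm_triangle_ineq norm_ge_zero)
  also have "\<dots> \<le> 2 * (cmod (f n))\<^sup>2 + 2 * (cmod (g n))\<^sup>2"
    using zero_le_power2[of "cmod (f n) - cmod (g n)"] by (simp add: power2_eq_square algebra_simps)
  finally show "(cmod (f n + g n))\<^sup>2 \<le> 2 * (cmod (f n))\<^sup>2 + 2 * (cmod (g n))\<^sup>2" .
qed simp

lemma summable_on_sqr_bounded_mult:
  fixes f g :: "'a \<Rightarrow> complex"
  assumes "(\<lambda>n. (cmod (f n))\<^sup>2) summable_on UNIV" "\<And>n. cmod (g n) \<le> C"
  shows "(\<lambda>n. (cmod (g n * f n))\<^sup>2) summable_on UNIV"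
proof (rule summable_on_comparison_test)
  show "(\<lambda>n. C\<^sup>2 * (cmod (f n))\<^sup>2) summable_on UNIV"
    using assms(1) by (rule summable_on_cmult_right)
  show "(cmod (g n * f n))\<^sup>2 \<le> C\<^sup>2 * (cmod (f n))\<^sup>2" for n
    using assms(2)[of n] by (simp add: norm_mult power_mult_distrib mult_right_mono power_mono)
qed simp

lemma summable_on_cnj_mult:
  fixes f g :: "'a \<Rightarrow> complex"
  assumes "(\<lambda>n. (cmod (f n))\<^sup>2) summable_on UNIV" "(\<lambda>n. (cmod (g n))\<^sup>2) summable_on UNIV"
  shows "(\<lambda>n. cnj (f n) * g n) summable_on UNIV"
proof (rule abs_summable_summable, rule summable_on_comparison_test)
  show "(\<lambda>n. (cmod (f n))\<^sup>2 + (cmod (g n))\<^sup>2) summable_on UNIV"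
    using assms by (rule summable_on_add)
  fix n
  have "2 * (cmod (f n) * cmod (g n)) \<le> (cmod (f n))\<^sup>2 + (cmod (g n))\<^sup>2"
    using zero_le_power2[of "cmod (f n) - cmod (g n)"] by (simp add: power2_eq_square algebra_simps)
  moreover have "0 \<le> cmod (f n) * cmod (g n)"
    by simp
  ultimately show "cmod (cnj (f n) * g n) \<le> (cmod (f n))\<^sup>2 + (cmod (g n))\<^sup>2"
    unfolding norm_mult complex_mod_cnj by linarith
qed simp

instantiation ell2 :: (type) real_vector
begin

lift_definition zero_ell2 :: "'a ell2" is "\<lambda>_. 0"
  by simp

lift_definition plus_ell2 :: "'a ell2 \<Rightarrow> 'a ell2 \<Rightarrow> 'a ell2" is "\<lambda>f g n. f n + g n"
  using summable_on_sqr_add by blast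

lift_definition uminus_ell2 :: "'a ell2 \<Rightarrow> 'a ell2" is "\<lambda>f n. - f n"
  by simp

lift_definition minus_ell2 :: "'a ell2 \<Rightarrow> 'a ell2 \<Rightarrow> 'a ell2" is "\<lambda>f g n. f n - g n"
  subgoal for f g
    using summable_on_sqr_add[of f "\<lambda>n. - g n"] by simp
  done

lift_definition scaleR_ell2 :: "real \<Rightarrow> 'a ell2 \<Rightarrow> 'a ell2" is "\<lambda>r f n. complex_of_real r * f n"
  by (rule summable_on_sqr_bounded_mult[OF _ order_refl])

instance
  by standard (transfer; simp add: algebra_simps)+

end

lift_definition scaleC :: "complex \<Rightarrow> 'a ell2 \<Rightarrow> 'a ell2" (infixr \<open>*\<^sub>C\<close> 75) is "\<lambda>c f n. c * f n"
  by (rule summable_on_sqr_bounded_mult[OF _ order_refl])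

text \<open>The scalar product is linear in its second argument.\<close>

lift_definition cinner :: "'a ell2 \<Rightarrow> 'a ell2 \<Rightarrow> complex"
  is "\<lambda>f g. \<Sum>\<^sub>\<infinity>n. cnj (f n) * g n" .

lift_definition delta :: "'a \<Rightarrow> 'a ell2" is "\<lambda>m n. if n = m then 1 else 0"
  subgoal for m
    by (rule finite_nonzero_values_imp_summable_on) (auto intro: finite_subset[of _ "{m}"])
  done

lemma cinner_add_left: "cinner (x + y) z = cinner x z + cinner y z"
  by transfer (simp add: distrib_right infsum_add summable_on_cnj_mult)

lemma cinner_cnj: "cnj (cinner x y) = cinner y x"
  by transfer (simp flip: infsum_cnj add: mult.commute)

lemma cinner_scaleR_left: "cinner (r *\<^sub>R x) y = complex_of_real r * cinner x y"
  by transfer (simp add: mult.assoc infsum_cmult_right')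

lemma cinner_self:
  "cinner x x = complex_of_real (\<Sum>\<^sub>\<infinity>n. (cmod (Rep_ell2 x n))\<^sup>2)"
proof -
  have "((\<lambda>n. complex_of_real ((cmod (Rep_ell2 x n))\<^sup>2)) has_sum
         complex_of_real (\<Sum>\<^sub>\<infinity>n. (cmod (Rep_ell2 x n))\<^sup>2)) UNIV"
    using Rep_ell2[of x] by (intro has_sum_of_real has_sum_infsum) simp
  then show ?thesis
    unfolding cinner.rep_eq
    by (intro infsumI) (simp add: complex_norm_square mult.commute del: of_real_power)
qed

instantiation ell2 :: (type) real_inner
begin

definition inner_ell2 :: "'a ell2 \<Rightarrow> 'a ell2 \<Rightarrow> real"
  where "inner_ell2 x y = Re (cinner x y)"

definition norm_ell2 :: "'a ell2 \<Rightarrow> real"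
  where "norm_ell2 x = sqrt (inner x x)"

definition sgn_ell2 :: "'a ell2 \<Rightarrow> 'a ell2"
  where "sgn_ell2 x = x /\<^sub>R norm x"

definition dist_ell2 :: "'a ell2 \<Rightarrow> 'a ell2 \<Rightarrow> real"
  where "dist_ell2 x y = norm (x - y)"

definition uniformity_ell2 :: "('a ell2 \<times> 'a ell2) filter"
  where "uniformity_ell2 = (INF e\<in>{0<..}. principal {(x, y). dist x y < e})"

definition open_ell2 :: "'a ell2 set \<Rightarrow> bool"
  where "open_ell2 U \<longleftrightarrow> (\<forall>x\<in>U. \<forall>\<^sub>F (x', y) in uniformity. x' = x \<longrightarrow> y \<in> U)"

instance
proof
  fix x y z :: "'a ell2" and r :: real
  show "inner x y = inner y x"
    unfolding inner_ell2_def by (subst cinner_cnj[symmetric]) simp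
  show "inner (x + y) z = inner x z + inner y z"
    by (simp add: inner_ell2_def cinner_add_left)
  show "inner (r *\<^sub>R x) y = r * inner x y"
    by (simp add: inner_ell2_def cinner_scaleR_left)
  show "0 \<le> inner x x"
    by (simp add: inner_ell2_def cinner_self infsum_nonneg)
  show "inner x x = 0 \<longleftrightarrow> x = 0"
  proof
    assume "inner x x = 0"
    then have "(\<Sum>\<^sub>\<infinity>n. (cmod (Rep_ell2 x n))\<^sup>2) = 0"
      by (simp add: inner_ell2_def cinner_self)
    then have "(cmod (Rep_ell2 x n))\<^sup>2 = 0" for n
      using nonneg_infsum_le_0D[of "\<lambda>n. (cmod (Rep_ell2 x n))\<^sup>2" UNIV n] Rep_ell2[of x] by simp
    then show "x = 0"
      by transfer auto
  next
    assume "x = 0"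
    then show "inner x x = 0"
      by (simp add: inner_ell2_def cinner_self zero_ell2.rep_eq)
  qed
qed (simp_all add: norm_ell2_def sgn_ell2_def dist_ell2_def uniformity_ell2_def open_ell2_def)

end

lemma norm_ell2_sqr: "(norm x)\<^sup>2 = (\<Sum>\<^sub>\<infinity>n. (cmod (Rep_ell2 x n))\<^sup>2)"
  by (simp add: norm_ell2_def inner_ell2_def cinner_self infsum_nonneg)


section \<open>Bounded operators\<close>

text \<open>
  The library type of bounded linear maps is real-linear; bounded operators on the
  complex Hilbert space are the elements satisfying the following predicate.
\<close>

definition clinear_op :: "('a ell2 \<Rightarrow>\<^sub>L 'a ell2) \<Rightarrow> bool"
  where "clinear_op A \<longleftrightarrow> (\<forall>c \<psi>. A (c *\<^sub>C \<psi>) = c *\<^sub>C A \<psi>)"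

definition is_adjoint :: "('a ell2 \<Rightarrow>\<^sub>L 'a ell2) \<Rightarrow> ('a ell2 \<Rightarrow>\<^sub>L 'a ell2) \<Rightarrow> bool"
  where "is_adjoint A B \<longleftrightarrow> (\<forall>\<phi> \<psi>. cinner \<phi> (A \<psi>) = cinner (B \<phi>) \<psi>)"

definition self_adjoint :: "('a ell2 \<Rightarrow>\<^sub>L 'a ell2) \<Rightarrow> bool"
  where "self_adjoint A \<longleftrightarrow> clinear_op A \<and> is_adjoint A A"

definition positive_op :: "('a ell2 \<Rightarrow>\<^sub>L 'a ell2) \<Rightarrow> bool"
  where "positive_op A \<longleftrightarrow> self_adjoint A \<and> (\<forall>\<psi>. 0 \<le> Re (cinner \<psi> (A \<psi>)))"

text \<open>The inverse is taken in the bounded operators; it is complex-linear whenever \<open>A\<close> is.\<close>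

definition op_spectrum :: "('a ell2 \<Rightarrow>\<^sub>L 'a ell2) \<Rightarrow> complex set"
  where "op_spectrum A =
    {z. \<not> (\<exists>B :: 'a ell2 \<Rightarrow>\<^sub>L 'a ell2.
            \<forall>\<psi>. B (A \<psi> - z *\<^sub>C \<psi>) = \<psi> \<and> A (B \<psi>) - z *\<^sub>C B \<psi> = \<psi>)}"

definition spectral_gap :: "('a ell2 \<Rightarrow>\<^sub>L 'a ell2) \<Rightarrow> real set \<Rightarrow> bool"
  where "spectral_gap A G \<longleftrightarrow>
    G \<noteq> {} \<and> open G \<and> is_interval G \<and> complex_of_real ` G \<inter> op_spectrum A = {}"

definition commutator :: "('a ell2 \<Rightarrow>\<^sub>L 'a ell2) \<Rightarrow> ('a ell2 \<Rightarrow>\<^sub>L 'a ell2) \<Rightarrow> ('a ell2 \<Rightarrow>\<^sub>L 'a ell2)"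
  where "commutator A B = (A o\<^sub>L B) - (B o\<^sub>L A)"

text \<open>Multiplication by \<open>g\<close>; only meaningful for bounded \<open>g\<close>.\<close>

definition mult_op :: "('a \<Rightarrow> real) \<Rightarrow> ('a ell2 \<Rightarrow>\<^sub>L 'a ell2)"
  where "mult_op g = Blinfun (\<lambda>\<psi>. Abs_ell2 (\<lambda>n. complex_of_real (g n) * Rep_ell2 \<psi> n))"

lemma Rep_mult_op:
  assumes "\<And>n. \<bar>g n\<bar> \<le> C"
  shows "Rep_ell2 (mult_op g \<psi>) n = complex_of_real (g n) * Rep_ell2 \<psi> n"
proof -
  define M where "M \<psi> = Abs_ell2 (\<lambda>n. complex_of_real (g n) * Rep_ell2 \<psi> n)" for \<psi>
  have summ: "(\<lambda>n. (cmod (complex_of_real (g n) * Rep_ell2 \<psi> n))\<^sup>2) summable_on UNIV" for \<psi>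
    by (rule summable_on_sqr_bounded_mult[where C = C]) (use Rep_ell2[of \<psi>] assms in auto)
  then have rep: "Rep_ell2 (M \<psi>) = (\<lambda>n. complex_of_real (g n) * Rep_ell2 \<psi> n)" for \<psi>
    by (simp add: M_def Abs_ell2_inverse)
  have "C \<ge> 0"
    using assms[of undefined] by linarith
  have "bounded_linear M"
  proof (rule bounded_linear_intro)
    show "M (x + y) = M x + M y" for x y
      by (simp flip: Rep_ell2_inject add: rep plus_ell2.rep_eq algebra_simps)
    show "M (r *\<^sub>R x) = r *\<^sub>R M x" for r x
      by (simp flip: Rep_ell2_inject add: rep scaleR_ell2.rep_eq algebra_simps)
    fix x
    have "(norm (M x))\<^sup>2 \<le> (\<Sum>\<^sub>\<infinity>n. C\<^sup>2 * (cmod (Rep_ell2 x n))\<^sup>2)"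
      unfolding norm_ell2_sqr rep
    proof (rule infsum_mono)
      show "(cmod (complex_of_real (g n) * Rep_ell2 x n))\<^sup>2 \<le> C\<^sup>2 * (cmod (Rep_ell2 x n))\<^sup>2" for n
        using assms[of n] \<open>C \<ge> 0\<close>
        by (auto simp: norm_mult power_mult_distrib intro!: mult_right_mono
            simp flip: abs_le_square_iff)
    qed (use summ[of x] Rep_ell2[of x] in \<open>auto intro: summable_on_cmult_right\<close>)
    also have "\<dots> = (norm x * C)\<^sup>2"
      by (simp add: infsum_cmult_right' norm_ell2_sqr power_mult_distrib)
    finally show "norm (M x) \<le> norm x * C"
      using \<open>C \<ge> 0\<close> by (auto intro: power2_le_imp_le)
  qed
  then have "mult_op g \<psi> = M \<psi>"
    by (simp add: mult_op_def bounded_linear_Blinfun_apply flip: M_def)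
  then show ?thesis
    by (simp add: rep)
qed


section \<open>Trace class\<close>

text \<open>
  Here \<open>T\<close> is the adjoint of \<open>A\<close> and \<open>B = \<bar>A\<bar>\<close> is the positive square root of \<open>T A\<close>, so the
  condition reads \<open>Tr \<bar>A\<bar> < \<infinity>\<close>.
\<close>

definition trace_class :: "('a ell2 \<Rightarrow>\<^sub>L 'a ell2) \<Rightarrow> bool"
  where "trace_class A \<longleftrightarrow> clinear_op A \<and>
    (\<exists>T B. is_adjoint A T \<and> positive_op B \<and> B o\<^sub>L B = T o\<^sub>L A \<and>
           (\<lambda>n. Re (cinner (delta n) (B (delta n)))) summable_on UNIV)"

text \<open>Only meaningful for trace class operators, where it does not depend on the basis.\<close>

definition op_trace :: "('a ell2 \<Rightarrow>\<^sub>L 'a ell2) \<Rightarrow> complex"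
  where "op_trace A = (\<Sum>\<^sub>\<infinity>n. cinner (delta n) (A (delta n)))"


section \<open>Functional calculus of bounded self-adjoint operators\<close>

text \<open>
  The spectral measure of \<open>A\<close> at \<open>\<psi>\<close> is the finite Borel measure \<open>M\<close> carried by the spectrum of \<open>A\<close>
  with \<open>\<langle>\<psi>, p(A) \<psi>\<rangle> = \<integral> p dM\<close> for all polynomials \<open>p\<close>, hence for all continuous functions
  on the (compact) spectrum.
\<close>

definition spectral_measure :: "('a ell2 \<Rightarrow>\<^sub>L 'a ell2) \<Rightarrow> 'a ell2 \<Rightarrow> real measure"
  where "spectral_measure A \<psi> = (THE M.
    sets M = sets borel \<and> finite_measure M \<and>
    (AE t in M. complex_of_real t \<in> op_spectrum A) \<and>
    (\<forall>k::nat. integrable M (\<lambda>t. t ^ k) \<and>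
       cinner \<psi> ((blinfun_apply A ^^ k) \<psi>) = complex_of_real (LINT t|M. t ^ k)))"

text \<open>
  \<open>f(A)\<close> for a bounded Borel function \<open>f\<close>: the operator whose quadratic form at every \<open>\<psi>\<close> is the
  integral of \<open>f\<close> against the spectral measure at \<open>\<psi>\<close>.
\<close>

definition borel_calculus :: "(real \<Rightarrow> real) \<Rightarrow> ('a ell2 \<Rightarrow>\<^sub>L 'a ell2) \<Rightarrow> ('a ell2 \<Rightarrow>\<^sub>L 'a ell2)"
  where "borel_calculus f A = (THE B. clinear_op B \<and>
    (\<forall>\<psi>. cinner \<psi> (B \<psi>) = complex_of_real (LINT t|spectral_measure A \<psi>. f t)))"

definition fermi_projection :: "('a ell2 \<Rightarrow>\<^sub>L 'a ell2) \<Rightarrow> real \<Rightarrow> ('a ell2 \<Rightarrow>\<^sub>L 'a ell2)"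
  where "fermi_projection H \<mu> = borel_calculus (indicator {..<\<mu>}) H"


section \<open>The lattice\<close>

definition lattice_dist :: "int \<times> int \<Rightarrow> int \<times> int \<Rightarrow> real"
  where "lattice_dist m n =
    sqrt ((real_of_int (fst m) - real_of_int (fst n))\<^sup>2 + (real_of_int (snd m) - real_of_int (snd n))\<^sup>2)"

definition finite_range :: "((int \<times> int) ell2 \<Rightarrow>\<^sub>L (int \<times> int) ell2) \<Rightarrow> bool"
  where "finite_range H \<longleftrightarrow>
    (\<exists>R>0. \<forall>m n. lattice_dist n m > R \<longrightarrow> cinner (delta m) (H (delta n)) = 0)"

definition switch_function :: "(real \<Rightarrow> real) \<Rightarrow> bool"
  where "switch_function \<Lambda> \<longleftrightarrow>
    mono \<Lambda> \<and> range \<Lambda> \<subseteq> {0..1} \<and>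
    (\<exists>Ll Lr. Ll < 0 \<and> 0 < Lr \<and> (\<forall>x<Ll. \<Lambda> x = 0) \<and> (\<forall>x>Lr. \<Lambda> x = 1))"

definition switch_op_x :: "(real \<Rightarrow> real) \<Rightarrow> ((int \<times> int) ell2 \<Rightarrow>\<^sub>L (int \<times> int) ell2)"
  where "switch_op_x \<Lambda> = mult_op (\<lambda>n. \<Lambda> (real_of_int (fst n)))"

definition switch_op_y :: "(real \<Rightarrow> real) \<Rightarrow> ((int \<times> int) ell2 \<Rightarrow>\<^sub>L (int \<times> int) ell2)"
  where "switch_op_y \<Lambda> = mult_op (\<lambda>n. \<Lambda> (real_of_int (snd n)))"

end

(*
  Let Lx, Ly be the switch functions, A = P Lx P, B = P Ly P, x = 2 pi i A, U = exp x. Expanding exp and using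
  cyclicity of the trace, Tr (U* B U - B) = Tr [B, x] = - 2 pi i Tr [A, B]. Since U acts trivially on the
  range of 1 - P and commutes with P, the left side equals Tr (U* Ly U - Ly), in which Ly may be replaced
  by the indicator E of the upper half plane. It then is the trace of a difference of two orthogonal
  projections, which is an integer: T = U* E U - E satisfies Tr T = Tr T^(2k+1) for every k, and
  T^(2k+1) converges to a difference of two finite rank projections.
  All these operators are trace class because the kernel of P decays exponentially off the diagonal, so
  that [Lx, P] and exp (2 pi i A) - 1 are localized near x = 0 and [Ly, P] near y = 0. The decay
  comes from approximating the step function at mu exponentially well, away from the gap, by its Bernstein
  polynomials: a polynomial of degree n in H has range n R.
*)
theory Submission
  imports Defs "HOL-Probability.Probability"
begin

section \<open>The Hilbert space\<close>

text \<open>The trace arguments run on \<open>col_summable\<close>, the left ideal of operators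
  whose column norms have a finite sum. It lies inside the trace class and turns traces and
  cyclicity into absolutely convergent double sums of matrix entries, but it is not closed under
  adjoints or right multiplication. This shapes the algebra: the summable factor is kept rightmost,
  cyclicity asks for summability of one factor only, and localization weights are attached to the
  column index. Localization is paid for with decay rate: a commutator with a step function costs a
  rate \<open>a\<close>, and so does a product of differently localized operators, which is why the
  kernel of \<open>P\<close> enters with rate \<open>2 * a\<close>. The spectral measure and the
  Borel calculus are definite descriptions, so existence and uniqueness have to be proved before
  anything can be said about \<open>P\<close>. Existence is a Hausdorff moment problem for the
  quadratic forms of the powers of a rescaled operator. Moment measures also yield the square root
  that trace class membership asks for.\<close>

lemmas Rep_ell2_simps [simp] =
  zero_ell2.rep_eq plus_ell2.rep_eq uminus_ell2.rep_eq minus_ell2.rep_eq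
  scaleR_ell2.rep_eq scaleC.rep_eq delta.rep_eq

lemma Rep_ell2_summable [simp]: "(\<lambda>n. (cmod (Rep_ell2 x n))\<^sup>2) summable_on UNIV"
  using Rep_ell2[of x] by simp

lemma ell2_eqI: "(\<And>n. Rep_ell2 x n = Rep_ell2 y n) \<Longrightarrow> x = y"
  by (simp flip: Rep_ell2_inject add: fun_eq_iff)

lemma cinner_add_right: "cinner x (y + z) = cinner x y + cinner x z"
  using cinner_add_left[of y z x] by (metis cinner_cnj complex_cnj_add)

lemma cinner_scaleC_right: "cinner x (c *\<^sub>C y) = c * cinner x y"
  by transfer (simp add: infsum_cmult_right' mult.left_commute)

lemma cinner_scaleC_left: "cinner (c *\<^sub>C x) y = cnj c * cinner x y"
  by (metis cinner_cnj cinner_scaleC_right complex_cnj_mult)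

lemma scaleR_scaleC: "r *\<^sub>R x = complex_of_real r *\<^sub>C x"
  by (rule ell2_eqI) simp

lemma cinner_scaleR_right: "cinner x (r *\<^sub>R y) = complex_of_real r * cinner x y"
  by (simp add: scaleR_scaleC cinner_scaleC_right)

lemma scaleC_one [simp]: "1 *\<^sub>C x = x"
  by (rule ell2_eqI) simp

lemma scaleC_minus_one: "(- 1) *\<^sub>C x = - x"
  by (rule ell2_eqI) simp

lemma cinner_minus_right [simp]: "cinner x (- y) = - cinner x y"
  using cinner_scaleC_right[of x "-1" y] by (simp add: scaleC_minus_one)

lemma cinner_minus_left [simp]: "cinner (- x) y = - cinner x y"
  using cinner_scaleC_left[of "-1" x y] by (simp add: scaleC_minus_one)

lemma cinner_diff_right: "cinner x (y - z) = cinner x y - cinner x z"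
  using cinner_add_right[of x y "- z"] by simp

lemma cinner_diff_left: "cinner (x - y) z = cinner x z - cinner y z"
  using cinner_add_left[of x "- y" z] by simp

lemma cinner_zero_right [simp]: "cinner x 0 = 0"
  using cinner_add_right[of x 0 0] by simp

lemma cinner_zero_left [simp]: "cinner 0 x = 0"
  using cinner_add_left[of 0 0 x] by simp

lemma cinner_self_norm: "cinner x x = complex_of_real ((norm x)\<^sup>2)"
  by (simp add: cinner_self norm_ell2_sqr)

lemma Re_cinner_self: "Re (cinner x x) = (norm x)\<^sup>2"
  by (simp add: cinner_self_norm)

lemma norm_scaleC [simp]: "norm (c *\<^sub>C x) = cmod c * norm x"
proof -
  have "(norm (c *\<^sub>C x))\<^sup>2 = Re (cinner (c *\<^sub>C x) (c *\<^sub>C x))" by (simp add: Re_cinner_self)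
  also have "\<dots> = Re ((cnj c * c) * cinner x x)"
    by (simp only: cinner_scaleC_left cinner_scaleC_right mult_ac)
  also have "\<dots> = (cmod c * norm x)\<^sup>2"
    by (simp add: cinner_self_norm power_mult_distrib complex_mult_cnj cmod_power2 mult.commute[of "cnj c"])
  finally show ?thesis by (simp add: power2_eq_iff_nonneg)
qed

lemma cmod_cinner_le: "cmod (cinner x y) \<le> norm x * norm y"
proof (cases "cinner x y = 0")
  case False
  \<comment> \<open>The phase \<open>c\<close> makes \<open>c * cinner x y\<close> real and
    nonnegative, so the real Cauchy-Schwarz inequality applies to \<open>x\<close> and
    \<open>c *\<^sub>C y\<close>.\<close>
  define c where "c = cnj (cinner x y) / cmod (cinner x y)"
  have c: "cmod c = 1" using False by (simp add: c_def norm_divide)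
  have "c * cinner x y = cmod (cinner x y)"
    using False by (simp add: c_def complex_norm_square[symmetric] mult.commute power2_eq_square)
  then have "cmod (cinner x y) = inner x (c *\<^sub>C y)" by (simp add: inner_ell2_def cinner_scaleC_right)
  also have "\<dots> \<le> norm x * norm (c *\<^sub>C y)" using Cauchy_Schwarz_ineq2[of x "c *\<^sub>C y"] by linarith
  finally show ?thesis using c by simp
qed simp

lemma cinner_delta_left: "cinner (delta m) x = Rep_ell2 x m"
proof -
  have "(\<Sum>\<^sub>\<infinity>n. cnj (if n = m then 1 else 0) * Rep_ell2 x n) = (\<Sum>\<^sub>\<infinity>n\<in>{m}. Rep_ell2 x n)"
    by (rule infsum_cong_neutral) auto
  then show ?thesis by (simp add: cinner.rep_eq delta.rep_eq)
qed

lemma cinner_delta_right: "cinner x (delta m) = cnj (Rep_ell2 x m)"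
  using cinner_cnj[of "delta m" x] by (simp add: cinner_delta_left)

lemma norm_delta [simp]: "norm (delta m) = 1"
proof -
  have "(norm (delta m))\<^sup>2 = 1" using Re_cinner_self[of "delta m"] by (simp add: cinner_delta_left)
  then show ?thesis using norm_ge_zero[of "delta m"] unfolding power2_eq_1_iff by linarith
qed

lemma cmod_Rep_ell2_le: "cmod (Rep_ell2 x n) \<le> norm x"
  using cmod_cinner_le[of "delta n" x] by (simp add: cinner_delta_left)

lemma cinner_has_sum: "((\<lambda>n. cnj (Rep_ell2 x n) * Rep_ell2 y n) has_sum cinner x y) UNIV"
  unfolding cinner.rep_eq by (intro has_sum_infsum summable_on_cnj_mult) simp_all

lemma cinner_abs_summable: "(\<lambda>n. cmod (Rep_ell2 x n) * cmod (Rep_ell2 y n)) summable_on UNIV"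
proof (rule summable_on_comparison_test)
  show "(\<lambda>n. (cmod (Rep_ell2 x n))\<^sup>2 + (cmod (Rep_ell2 y n))\<^sup>2) summable_on UNIV"
    by (intro summable_on_add) simp_all
  fix n
  show "cmod (Rep_ell2 x n) * cmod (Rep_ell2 y n) \<le> (cmod (Rep_ell2 x n))\<^sup>2 + (cmod (Rep_ell2 y n))\<^sup>2"
    using sum_squares_bound[of "cmod (Rep_ell2 x n)" "cmod (Rep_ell2 y n)"]
      mult_nonneg_nonneg[OF norm_ge_zero norm_ge_zero, of "Rep_ell2 x n" "Rep_ell2 y n"]
    unfolding mult.assoc by linarith
qed simp

text \<open>Stronger than Cauchy-Schwarz for \<open>cinner\<close>: the absolute values stand inside
  the sum, as rearranging double sums of kernel entries requires.\<close>

lemma infsum_cmod_mult_le: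
  "(\<Sum>\<^sub>\<infinity>n. cmod (Rep_ell2 x n) * cmod (Rep_ell2 y n)) \<le> norm x * norm y"
proof (rule infsum_le_finite_sums[OF cinner_abs_summable])
  fix F :: "'a set" assume "finite F"
  then have le: "L2_set (\<lambda>n. cmod (Rep_ell2 z n)) F \<le> norm z" for z
    unfolding L2_set_def using finite_sum_le_infsum[of "\<lambda>n. (cmod (Rep_ell2 z n))\<^sup>2" UNIV F]
    by (intro real_le_lsqrt) (simp_all add: norm_ell2_sqr sum_nonneg)
  have "(\<Sum>n\<in>F. cmod (Rep_ell2 x n) * cmod (Rep_ell2 y n))
      \<le> L2_set (\<lambda>n. cmod (Rep_ell2 x n)) F * L2_set (\<lambda>n. cmod (Rep_ell2 y n)) F"
    using L2_set_mult_ineq[of "\<lambda>n. cmod (Rep_ell2 x n)" "\<lambda>n. cmod (Rep_ell2 y n)" F] by simp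
  also have "\<dots> \<le> norm x * norm y" by (intro mult_mono le L2_set_nonneg) simp
  finally show "(\<Sum>n\<in>F. cmod (Rep_ell2 x n) * cmod (Rep_ell2 y n)) \<le> norm x * norm y" .
qed

lemma cinner_ext:
  assumes "\<And>\<phi>. cinner \<phi> x = cinner \<phi> y"
  shows "x = y"
  by (rule ell2_eqI) (use assms[of "delta _"] in \<open>simp add: cinner_delta_left\<close>)

lemma bounded_bilinear_cinner: "bounded_bilinear (cinner :: 'a ell2 \<Rightarrow> 'a ell2 \<Rightarrow> complex)"
  by standard
    (auto simp: cinner_add_left cinner_add_right cinner_scaleR_left cinner_scaleR_right scaleR_conv_of_real
      intro!: exI[of _ 1] cmod_cinner_le)

lemmas tendsto_cinner = bounded_bilinear.tendsto[OF bounded_bilinear_cinner]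

lemma bounded_linear_scaleC: "bounded_linear (\<lambda>x :: 'a ell2. c *\<^sub>C x)"
proof (rule bounded_linear_intro[where K = "cmod c"])
  show "c *\<^sub>C (x + y) = c *\<^sub>C x + c *\<^sub>C y" for x y :: "'a ell2"
    by (rule ell2_eqI) (simp add: algebra_simps)
  show "c *\<^sub>C (r *\<^sub>R x) = r *\<^sub>R (c *\<^sub>C x)" for r and x :: "'a ell2" by (rule ell2_eqI) simp
qed simp

section \<open>Completeness of the sequence space, and polarization\<close>

lemma norm_ell2_le_finite:
  assumes "\<And>F. finite F \<Longrightarrow> (\<Sum>n\<in>F. (cmod (f n))\<^sup>2) \<le> C\<^sup>2" "C \<ge> 0"
  shows "(\<lambda>n. (cmod (f n))\<^sup>2) summable_on UNIV" "norm (Abs_ell2 f) \<le> C"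
proof -
  show *: "(\<lambda>n. (cmod (f n))\<^sup>2) summable_on UNIV"
    by (rule nonneg_bdd_above_summable_on) (use assms in \<open>auto intro!: bdd_aboveI2[where M = "C\<^sup>2"]\<close>)
  then have rep: "Rep_ell2 (Abs_ell2 f) = f" by (simp add: Abs_ell2_inverse)
  have "(norm (Abs_ell2 f))\<^sup>2 \<le> C\<^sup>2"
    unfolding norm_ell2_sqr rep by (rule infsum_le_finite_sums) (use * assms in auto)
  then show "norm (Abs_ell2 f) \<le> C" using assms(2) by (rule power2_le_imp_le)
qed

instance ell2 :: (type) banach
proof
  fix X :: "nat \<Rightarrow> 'a ell2"
  assume X: "Cauchy X"
  have coord: "Cauchy (\<lambda>k. Rep_ell2 (X k) n)" for n
  proof (rule metric_CauchyI)
    fix e :: real assume "0 < e"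
    from metric_CauchyD[OF X this] obtain M where M: "\<And>k l. k \<ge> M \<Longrightarrow> l \<ge> M \<Longrightarrow> dist (X k) (X l) < e"
      by blast
    show "\<exists>M. \<forall>k\<ge>M. \<forall>l\<ge>M. dist (Rep_ell2 (X k) n) (Rep_ell2 (X l) n) < e"
    proof (intro exI allI impI)
      fix k l assume "M \<le> k" "M \<le> l"
      have "dist (Rep_ell2 (X k) n) (Rep_ell2 (X l) n) = cmod (Rep_ell2 (X k - X l) n)"
        by (simp add: dist_norm)
      also have "\<dots> \<le> dist (X k) (X l)" unfolding dist_norm by (rule cmod_Rep_ell2_le)
      also have "\<dots> < e" using M \<open>M \<le> k\<close> \<open>M \<le> l\<close> by blast
      finally show "dist (Rep_ell2 (X k) n) (Rep_ell2 (X l) n) < e" .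
    qed
  qed
  then obtain f where f: "\<And>n. (\<lambda>k. Rep_ell2 (X k) n) \<longlonglongrightarrow> f n"
    unfolding Cauchy_convergent_iff convergent_def by metis
  \<comment> \<open>Over a finite index set the limit in \<open>l\<close> may be taken termwise;
    \<open>norm_ell2_le_finite\<close> then recovers the full norm.\<close>
  have main: "(\<forall>F. finite F \<longrightarrow> (\<Sum>n\<in>F. (cmod (Rep_ell2 (X k) n - f n))\<^sup>2) \<le> e\<^sup>2)"
    if M: "\<And>l. l \<ge> M \<Longrightarrow> dist (X k) (X l) < e" for M k e
  proof (intro allI impI)
    fix F :: "'a set" assume F: "finite F"
    have "(\<Sum>n\<in>F. (cmod (Rep_ell2 (X k) n - Rep_ell2 (X l) n))\<^sup>2) \<le> e\<^sup>2" if "l \<ge> M" for l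
    proof -
      have "(\<Sum>n\<in>F. (cmod (Rep_ell2 (X k - X l) n))\<^sup>2) \<le> (norm (X k - X l))\<^sup>2"
        unfolding norm_ell2_sqr by (rule finite_sum_le_infsum) (use F in \<open>auto simp del: Rep_ell2_simps\<close>)
      also have "\<dots> \<le> e\<^sup>2" using M[OF that] by (simp add: dist_norm power_mono)
      finally show ?thesis by simp
    qed
    moreover have "(\<lambda>l. \<Sum>n\<in>F. (cmod (Rep_ell2 (X k) n - Rep_ell2 (X l) n))\<^sup>2)
        \<longlonglongrightarrow> (\<Sum>n\<in>F. (cmod (Rep_ell2 (X k) n - f n))\<^sup>2)" by (intro tendsto_intros f)
    ultimately show "(\<Sum>n\<in>F. (cmod (Rep_ell2 (X k) n - f n))\<^sup>2) \<le> e\<^sup>2" by (intro LIMSEQ_le_const2) auto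
  qed
  have conv: "\<exists>N. \<forall>k\<ge>N. (\<lambda>n. (cmod (Rep_ell2 (X k) n - f n))\<^sup>2) summable_on UNIV \<and>
      norm (Abs_ell2 (\<lambda>n. Rep_ell2 (X k) n - f n)) \<le> e" if "e > 0" for e
  proof -
    from metric_CauchyD[OF X that] obtain M where M: "\<And>k l. k \<ge> M \<Longrightarrow> l \<ge> M \<Longrightarrow> dist (X k) (X l) < e"
      by blast
    show ?thesis by (rule exI[of _ M]) (use main[of M _ e] M that in \<open>auto intro!: norm_ell2_le_finite\<close>)
  qed
  obtain N where "(\<lambda>n. (cmod (Rep_ell2 (X N) n - f n))\<^sup>2) summable_on UNIV" using conv[of 1] by auto
  \<comment> \<open>\<open>f\<close> is square summable, being \<open>X N\<close> minus the square
    summable \<open>X N - f\<close>.\<close>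
  then have "(\<lambda>n. (cmod (Rep_ell2 (X N) n + - (Rep_ell2 (X N) n - f n)))\<^sup>2) summable_on UNIV"
    by (intro summable_on_sqr_add) (simp_all del: minus_diff_eq)
  then have f_rep: "Rep_ell2 (Abs_ell2 f) = f" by (simp add: Abs_ell2_inverse)
  have "X \<longlonglongrightarrow> Abs_ell2 f"
  proof (rule metric_LIMSEQ_I)
    fix e :: real assume "e > 0"
    then obtain N where N: "\<And>k. k \<ge> N \<Longrightarrow> norm (Abs_ell2 (\<lambda>n. Rep_ell2 (X k) n - f n)) \<le> e / 2"
      using conv[of "e / 2"] by auto
    have "Abs_ell2 (\<lambda>n. Rep_ell2 (X k) n - f n) = X k - Abs_ell2 f" for k
      by (simp add: minus_ell2_def f_rep)
    then have "dist (X k) (Abs_ell2 f) < e" if "k \<ge> N" for k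
      using N[OF that] \<open>e > 0\<close> by (simp add: dist_norm)
    then show "\<exists>N. \<forall>k\<ge>N. dist (X k) (Abs_ell2 f) < e" by blast
  qed
  then show "convergent X" by (auto simp: convergent_def)
qed

text \<open>Polarization with \<open>\<psi>\<close> and \<open>\<i> *\<^sub>C \<psi>\<close>.
  Complex linearity is essential: a quarter turn of the real plane has vanishing quadratic form.
  This is what makes the operator described by \<open>borel_calculus\<close> unique.\<close>

lemma clinear_quadratic_zero:
  fixes A :: "'a ell2 \<Rightarrow>\<^sub>L 'a ell2"
  assumes "clinear_op A" "\<And>\<psi>. cinner \<psi> (A \<psi>) = 0"
  shows "A = 0"
proof -
  have "cinner \<phi> (A \<psi>) = 0" for \<phi> \<psi>
  proof -
    have 1: "cinner \<phi> (A \<psi>) + cinner \<psi> (A \<phi>) = 0" using assms(2)[of "\<phi> + \<psi>"]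
      by (simp add: blinfun.add_right cinner_add_left cinner_add_right assms(2) add.commute)
    have "cinner \<phi> (A (\<i> *\<^sub>C \<psi>)) + cinner (\<i> *\<^sub>C \<psi>) (A \<phi>) = 0" using assms(2)[of "\<phi> + \<i> *\<^sub>C \<psi>"]
      by (simp add: blinfun.add_right cinner_add_left cinner_add_right assms(2) add.commute)
    then have "\<i> * (cinner \<phi> (A \<psi>) - cinner \<psi> (A \<phi>)) = 0"
      using assms(1) by (simp add: clinear_op_def cinner_scaleC_left cinner_scaleC_right algebra_simps)
    with 1 show ?thesis by simp
  qed
  then show ?thesis by (intro blinfun_eqI cinner_ext) simp
qed

section \<open>The Banach algebra of operators with an adjoint\<close>

text \<open>
  Every bounded complex-linear operator has an adjoint; requiring one in the type makes
  complex-linearity automatic and avoids the Riesz representation theorem.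
\<close>

typedef 'a bop = "{A :: 'a ell2 \<Rightarrow>\<^sub>L 'a ell2. \<exists>B. is_adjoint A B}"
  by (rule exI[of _ 0]) (auto simp: is_adjoint_def intro!: exI[of _ 0])

lifting_forget ell2.lifting

setup_lifting type_definition_bop

lift_definition app :: "'a bop \<Rightarrow> 'a ell2 \<Rightarrow> 'a ell2" (infixr \<open>\<odot>\<close> 76) is blinfun_apply .

lemma is_adjoint_sym: "is_adjoint A B \<Longrightarrow> is_adjoint B A"
  unfolding is_adjoint_def by (metis cinner_cnj)

lemma is_adjoint_unique:
  assumes "is_adjoint A B" "is_adjoint A B'"
  shows "B = B'"
proof (rule blinfun_eqI, rule cinner_ext)
  fix \<psi> \<phi>
  show "cinner \<phi> (B \<psi>) = cinner \<phi> (B' \<psi>)"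
    using assms[THEN is_adjoint_sym] assms unfolding is_adjoint_def by (metis cinner_cnj)
qed

lemma is_adjoint_norm_le:
  assumes "is_adjoint A B"
  shows "norm B \<le> norm A"
proof (rule norm_blinfun_bound)
  fix \<phi>
  have "(norm (B \<phi>))\<^sup>2 = cmod (cinner (B \<phi>) (B \<phi>))"
    by (simp add: cinner_self_norm norm_of_real del: of_real_power)
  also have "\<dots> = cmod (cinner \<phi> (A (B \<phi>)))" using assms by (simp add: is_adjoint_def)
  also have "\<dots> \<le> norm \<phi> * norm (A (B \<phi>))" by (rule cmod_cinner_le)
  also have "\<dots> \<le> norm \<phi> * (norm A * norm (B \<phi>))" by (intro mult_left_mono norm_blinfun) simp
  finally have "norm (B \<phi>) * norm (B \<phi>) \<le> (norm A * norm \<phi>) * norm (B \<phi>)"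
    by (simp add: power2_eq_square mult_ac)
  then show "norm (B \<phi>) \<le> norm A * norm \<phi>"
    by (metis mult_right_le_imp_le mult_nonneg_nonneg norm_ge_zero order_le_less)
qed simp

lemma is_adjoint_norm: "is_adjoint A B \<Longrightarrow> norm B = norm A"
  by (meson antisym is_adjoint_norm_le is_adjoint_sym)

lemma is_adjoint_clinear: "is_adjoint A B \<Longrightarrow> clinear_op A"
  unfolding clinear_op_def is_adjoint_def by (intro allI cinner_ext) (simp add: cinner_scaleC_right)

lemma is_adjoint_intros:
  assumes "is_adjoint A B" "is_adjoint C D"
  shows "is_adjoint (A + C) (B + D)" "is_adjoint (A - C) (B - D)" "is_adjoint (- A) (- B)"
    "is_adjoint (r *\<^sub>R A) (r *\<^sub>R B)" "is_adjoint (A o\<^sub>L C) (D o\<^sub>L B)" using assms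
  by (simp_all add: is_adjoint_def blinfun.add_left blinfun.diff_left blinfun.minus_left blinfun.scaleR_left
      cinner_add_left cinner_add_right cinner_diff_left cinner_diff_right cinner_scaleR_left cinner_scaleR_right)

instantiation bop :: (type) real_vector
begin

lift_definition zero_bop :: "'a bop" is 0
  by (auto simp: is_adjoint_def intro!: exI[of _ 0])

lift_definition plus_bop :: "'a bop \<Rightarrow> 'a bop \<Rightarrow> 'a bop" is "(+)"
  using is_adjoint_intros(1) by blast

lift_definition minus_bop :: "'a bop \<Rightarrow> 'a bop \<Rightarrow> 'a bop" is "(-)"
  using is_adjoint_intros(2) by blast

lift_definition uminus_bop :: "'a bop \<Rightarrow> 'a bop" is uminus
  using is_adjoint_intros(3) by blast

lift_definition scaleR_bop :: "real \<Rightarrow> 'a bop \<Rightarrow> 'a bop" is "(*\<^sub>R)"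
  using is_adjoint_intros(4) by blast

instance
  by standard (transfer; simp add: algebra_simps)+

end

instantiation bop :: (type) real_normed_algebra_1
begin

lift_definition one_bop :: "'a bop" is id_blinfun
  by (auto simp: is_adjoint_def intro!: exI[of _ id_blinfun])

lift_definition times_bop :: "'a bop \<Rightarrow> 'a bop \<Rightarrow> 'a bop" is "(o\<^sub>L)"
  using is_adjoint_intros(5) by blast

lift_definition norm_bop :: "'a bop \<Rightarrow> real" is norm .

definition sgn_bop :: "'a bop \<Rightarrow> 'a bop"
  where "sgn_bop x = x /\<^sub>R norm x"

definition dist_bop :: "'a bop \<Rightarrow> 'a bop \<Rightarrow> real"
  where "dist_bop x y = norm (x - y)"

definition uniformity_bop :: "('a bop \<times> 'a bop) filter"
  where "uniformity_bop = (INF e\<in>{0<..}. principal {(x, y). dist x y < e})"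

definition open_bop :: "'a bop set \<Rightarrow> bool"
  where "open_bop U \<longleftrightarrow> (\<forall>x\<in>U. \<forall>\<^sub>F (x', y) in uniformity. x' = x \<longrightarrow> y \<in> U)"

instance
proof
  fix x y z :: "'a bop" and a b :: real
  show "x * y * z = x * (y * z)" by transfer (rule blinfun_eqI, simp)
  show "(x + y) * z = x * z + y * z" "x * (y + z) = x * y + x * z"
    by (transfer; rule blinfun_eqI; simp add: blinfun.add_left blinfun.add_right)+
  show "a *\<^sub>R x * y = a *\<^sub>R (x * y)" "x * a *\<^sub>R y = a *\<^sub>R (x * y)"
    by (transfer; rule blinfun_eqI; simp add: blinfun.scaleR_left blinfun.scaleR_right)+
  show "1 * x = x" "x * 1 = x" by (transfer; rule blinfun_eqI; simp)+
  have "norm (id_blinfun :: 'a ell2 \<Rightarrow>\<^sub>L 'a ell2) \<ge> 1"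
    using norm_blinfun[of "id_blinfun :: 'a ell2 \<Rightarrow>\<^sub>L 'a ell2" "delta undefined"] by simp
  then have *: "norm (id_blinfun :: 'a ell2 \<Rightarrow>\<^sub>L 'a ell2) = 1"
    using norm_blinfun_id_le[where 'a = "'a ell2"] by simp
  then show "norm (1 :: 'a bop) = 1" by transfer
  then show "(0 :: 'a bop) \<noteq> 1" by transfer (metis norm_zero zero_neq_one)
  show "norm (x * y) \<le> norm x * norm y" by transfer (rule norm_blinfun_compose)
  show "norm (x + y) \<le> norm x + norm y" by transfer (rule norm_triangle_ineq)
qed (simp_all add: dist_bop_def sgn_bop_def uniformity_bop_def open_bop_def, (transfer; simp add: algebra_simps)+)

end

lift_definition adj :: "'a bop \<Rightarrow> 'a bop" is "\<lambda>A. SOME B. is_adjoint A B"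
  by (metis is_adjoint_sym someI_ex)

lemma is_adjoint_Rep_bop: "is_adjoint (Rep_bop x) (Rep_bop (adj x))"
  by transfer (rule someI_ex)

lemma clinear_Rep_bop: "clinear_op (Rep_bop x)"
  using is_adjoint_Rep_bop is_adjoint_clinear by blast

lemma cinner_app: "cinner \<phi> (x \<odot> \<psi>) = cinner (adj x \<odot> \<phi>) \<psi>"
  using is_adjoint_Rep_bop[of x] by (simp add: is_adjoint_def app.rep_eq)

lemma bop_eqI: "(\<And>\<psi>. x \<odot> \<psi> = y \<odot> \<psi>) \<Longrightarrow> x = y"
  by transfer (rule blinfun_eqI)

lemma adj_eqI:
  assumes "\<And>\<phi> \<psi>. cinner \<phi> (x \<odot> \<psi>) = cinner (y \<odot> \<phi>) \<psi>"
  shows "adj x = y"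
proof (rule bop_eqI, rule cinner_ext)
  fix \<phi> \<psi>
  have "cinner (adj x \<odot> \<phi>) \<psi> = cinner (y \<odot> \<phi>) \<psi>" using assms cinner_app by metis
  then show "cinner \<psi> (adj x \<odot> \<phi>) = cinner \<psi> (y \<odot> \<phi>)" by (metis cinner_cnj)
qed

lemma cinner_app_left: "cinner (x \<odot> \<phi>) \<psi> = cinner \<phi> (adj x \<odot> \<psi>)"
  by (metis cinner_app cinner_cnj)

lemma app_simps [simp]:
  "0 \<odot> \<psi> = 0" "1 \<odot> \<psi> = \<psi>" "(x + y) \<odot> \<psi> = x \<odot> \<psi> + y \<odot> \<psi>"
  "(x - y) \<odot> \<psi> = x \<odot> \<psi> - y \<odot> \<psi>" "(- x) \<odot> \<psi> = - (x \<odot> \<psi>)"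
  "(r *\<^sub>R x) \<odot> \<psi> = r *\<^sub>R (x \<odot> \<psi>)" "(x * y) \<odot> \<psi> = x \<odot> y \<odot> \<psi>"
  by (transfer; simp add: blinfun.add_left blinfun.diff_left blinfun.minus_left blinfun.scaleR_left)+

lemma app_right_simps [simp]:
  "x \<odot> 0 = 0" "x \<odot> (\<psi> + \<phi>) = x \<odot> \<psi> + x \<odot> \<phi>" "x \<odot> (\<psi> - \<phi>) = x \<odot> \<psi> - x \<odot> \<phi>"
  "x \<odot> (- \<psi>) = - (x \<odot> \<psi>)" "x \<odot> (r *\<^sub>R \<psi>) = r *\<^sub>R (x \<odot> \<psi>)"
  by (simp_all add: app.rep_eq blinfun.add_right blinfun.diff_right blinfun.minus_right blinfun.scaleR_right)

lemma app_scaleC [simp]: "x \<odot> (c *\<^sub>C \<psi>) = c *\<^sub>C (x \<odot> \<psi>)"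
  using clinear_Rep_bop[of x] by (simp add: clinear_op_def app.rep_eq)

lemma norm_app: "norm (x \<odot> \<psi>) \<le> norm x * norm \<psi>"
  by transfer (rule norm_blinfun)

lemma norm_bop_bound: "0 \<le> b \<Longrightarrow> (\<And>\<psi>. norm (x \<odot> \<psi>) \<le> b * norm \<psi>) \<Longrightarrow> norm x \<le> b"
  by transfer (rule norm_blinfun_bound)

lemma bounded_bilinear_app: "bounded_bilinear (\<odot>)"
  by standard (auto intro!: exI[of _ 1] norm_app)

lemmas tendsto_app = bounded_bilinear.tendsto[OF bounded_bilinear_app]

lemma adj_simps [simp]:
  "adj 0 = 0" "adj 1 = 1" "adj (x + y) = adj x + adj y" "adj (x - y) = adj x - adj y"
  "adj (- x) = - adj x" "adj (r *\<^sub>R x) = r *\<^sub>R adj x" "adj (x * y) = adj y * adj x"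
  by (rule adj_eqI; simp add: cinner_app cinner_add_left cinner_add_right cinner_diff_left cinner_diff_right
      cinner_scaleR_left cinner_scaleR_right)+

lemma adj_adj [simp]: "adj (adj x) = x"
  by (rule adj_eqI) (simp add: cinner_app_left)

lemma adj_power [simp]: "adj (x ^ n) = adj x ^ n"
  by (induction n) (simp_all add: power_commutes)

lemma norm_adj [simp]: "norm (adj x) = norm x"
  using is_adjoint_norm[OF is_adjoint_Rep_bop] by (simp add: norm_bop.rep_eq)

lemma bounded_linear_adj: "bounded_linear adj"
  by (rule bounded_linear_intro[where K = 1]) simp_all

instance bop :: (type) banach
proof
  fix X :: "nat \<Rightarrow> 'a bop"
  assume X: "Cauchy X"
  have *: "Cauchy (\<lambda>n. Rep_bop (Y n))" if "Cauchy Y" for Y :: "nat \<Rightarrow> 'a bop"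
    using that by (simp add: Cauchy_def dist_norm norm_bop.rep_eq minus_bop.rep_eq)
  obtain L where L: "(\<lambda>n. Rep_bop (X n)) \<longlonglongrightarrow> L" using *[OF X] Cauchy_convergent convergent_def by blast
  \<comment> \<open>The limit belongs to the type only if it has an adjoint; the adjoints converge
    as well, since \<open>adj\<close> is isometric.\<close>
  obtain L' where L': "(\<lambda>n. Rep_bop (adj (X n))) \<longlonglongrightarrow> L'"
    using *[OF bounded_linear.Cauchy[OF bounded_linear_adj X]] Cauchy_convergent convergent_def by blast
  have "cinner \<phi> (L \<psi>) = cinner (L' \<phi>) \<psi>" for \<phi> \<psi>
  proof (rule LIMSEQ_unique)
    show "(\<lambda>n. cinner \<phi> (Rep_bop (X n) \<psi>)) \<longlonglongrightarrow> cinner \<phi> (L \<psi>)"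
      by (intro tendsto_cinner blinfun.tendsto L tendsto_const)
    have "(\<lambda>n. cinner (Rep_bop (adj (X n)) \<phi>) \<psi>) \<longlonglongrightarrow> cinner (L' \<phi>) \<psi>"
      by (intro tendsto_cinner blinfun.tendsto L' tendsto_const)
    then show "(\<lambda>n. cinner \<phi> (Rep_bop (X n) \<psi>)) \<longlonglongrightarrow> cinner (L' \<phi>) \<psi>"
      by (simp only: is_adjoint_Rep_bop[unfolded is_adjoint_def, rule_format])
  qed
  then have "Rep_bop (Abs_bop L) = L" by (intro Abs_bop_inverse) (auto simp: is_adjoint_def)
  with L have "X \<longlonglongrightarrow> Abs_bop L" by (simp add: tendsto_iff dist_norm norm_bop.rep_eq minus_bop.rep_eq)
  then show "convergent X" by (auto simp: convergent_def)
qed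

lemma adj_exp: "adj (exp x) = exp (adj x)"
proof -
  have "(\<lambda>n. adj (x ^ n /\<^sub>R fact n)) sums adj (exp x)"
    by (intro bounded_linear.sums[OF bounded_linear_adj] exp_converges)
  moreover have "(\<lambda>n. adj (x ^ n /\<^sub>R fact n)) sums exp (adj x)" using exp_converges[of "adj x"] by simp
  ultimately show ?thesis by (rule sums_unique2)
qed

text \<open>Two maps that are formally adjoint to each other are automatically linear, because
  \<open>cinner\<close> separates points; only the norm bounds have to be supplied.\<close>

lemma bop_exists:
  assumes adj: "\<And>\<phi> \<psi>. cinner \<phi> (f \<psi>) = cinner (g \<phi>) \<psi>"
    and bound: "\<And>\<psi>. norm (f \<psi>) \<le> K * norm \<psi>" "\<And>\<psi>. norm (g \<psi>) \<le> K * norm \<psi>"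
  obtains x where "\<And>\<psi>. x \<odot> \<psi> = f \<psi>" "\<And>\<psi>. adj x \<odot> \<psi> = g \<psi>"
proof -
  have adj': "cinner \<phi> (g \<psi>) = cinner (f \<phi>) \<psi>" for \<phi> \<psi> by (metis adj cinner_cnj)
  have lin: "bounded_linear F"
    if F: "\<And>\<phi> \<psi>. cinner \<phi> (F \<psi>) = cinner (G \<phi>) \<psi>" "\<And>\<psi>. norm (F \<psi>) \<le> K * norm \<psi>" for F G :: "'a ell2 \<Rightarrow> 'a ell2"
  proof (rule bounded_linear_intro[where K = K])
    show "F (x + y) = F x + F y" for x y by (rule cinner_ext) (simp add: F(1) cinner_add_right)
    show "F (r *\<^sub>R x) = r *\<^sub>R F x" for r x by (rule cinner_ext) (simp add: F(1) cinner_scaleR_right)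
  qed (simp add: F(2) mult.commute)
  note blin = lin[OF adj bound(1)] lin[OF adj' bound(2)]
  then have "is_adjoint (Blinfun f) (Blinfun g)"
    by (simp add: is_adjoint_def bounded_linear_Blinfun_apply adj)
  then have *: "Rep_bop (Abs_bop (Blinfun f)) = Blinfun f" by (intro Abs_bop_inverse) auto
  have 1: "Abs_bop (Blinfun f) \<odot> \<psi> = f \<psi>" for \<psi>
    by (simp add: app.rep_eq * bounded_linear_Blinfun_apply blin)
  have 2: "adj (Abs_bop (Blinfun f)) \<odot> \<psi> = g \<psi>" for \<psi> by (rule cinner_ext) (simp add: cinner_app 1 adj')
  show ?thesis using that[OF 1 2] .
qed

subsection \<open>Scalars, diagonal operators and matrix entries\<close>

text \<open>\<open>bop\<close> is an algebra over the reals; complex scalars enter as central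
  elements of it.\<close>

definition cop :: "complex \<Rightarrow> 'a bop"
  where "cop c = (THE x. \<forall>\<psi>. x \<odot> \<psi> = c *\<^sub>C \<psi>)"

lemma app_cop [simp]: "cop c \<odot> \<psi> = c *\<^sub>C \<psi>"
proof -
  obtain x where x: "\<And>\<psi> :: 'a ell2. x \<odot> \<psi> = c *\<^sub>C \<psi>"
    by (rule bop_exists[of "\<lambda>\<psi>. c *\<^sub>C \<psi>" "\<lambda>\<psi>. cnj c *\<^sub>C \<psi>" "cmod c"])
      (auto simp: cinner_scaleC_left cinner_scaleC_right)
  then have "cop c = x" unfolding cop_def by (intro the_equality) (auto intro: bop_eqI)
  then show ?thesis by (simp add: x)
qed

lemma cop_simps:
  "cop 0 = 0" "cop 1 = 1" "cop (a + b) = cop a + cop b" "cop (a * b) = cop a * cop b" "cop (- a) = - cop a"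
  by (rule bop_eqI, rule ell2_eqI, simp add: algebra_simps)+

lemma cop_of_real: "cop (complex_of_real r) = of_real r"
  by (rule bop_eqI) (simp add: scaleR_scaleC of_real_def)

lemma cop_commute: "cop c * x = x * cop c"
  by (rule bop_eqI) simp

lemma adj_cop [simp]: "adj (cop c) = cop (cnj c)"
  by (rule adj_eqI) (simp add: cinner_scaleC_left cinner_scaleC_right)

lemma norm_cop [simp]: "norm (cop c :: 'a bop) = cmod c"
proof (rule antisym)
  show "norm (cop c :: 'a bop) \<le> cmod c" by (rule norm_bop_bound) simp_all
  show "cmod c \<le> norm (cop c :: 'a bop)" using norm_app[of "cop c :: 'a bop" "delta undefined"] by simp
qed

lemma bounded_linear_cop: "bounded_linear cop"
proof (rule bounded_linear_intro[where K = 1])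
  show "cop (r *\<^sub>R x) = r *\<^sub>R cop x" for r x by (simp add: scaleR_conv_of_real cop_simps cop_of_real)
qed (simp_all add: cop_simps)

definition diag :: "('a \<Rightarrow> real) \<Rightarrow> 'a bop"
  where "diag g = Abs_bop (mult_op g)"

lemma
  assumes "\<And>n. \<bar>g n\<bar> \<le> C"
  shows Rep_bop_diag: "Rep_bop (diag g) = mult_op g"
    and Rep_ell2_diag: "Rep_ell2 (diag g \<odot> \<psi>) n = complex_of_real (g n) * Rep_ell2 \<psi> n"
    and adj_diag: "adj (diag g) = diag g"
proof -
  have "is_adjoint (mult_op g) (mult_op g)"
    unfolding is_adjoint_def cinner.rep_eq Rep_mult_op[OF assms] by (simp add: mult_ac)
  then show 1: "Rep_bop (diag g) = mult_op g" unfolding diag_def by (intro Abs_bop_inverse) auto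
  show 2: "Rep_ell2 (diag g \<odot> \<psi>) n = complex_of_real (g n) * Rep_ell2 \<psi> n" for \<psi> n
    using Rep_mult_op[OF assms] by (simp add: app.rep_eq 1)
  show "adj (diag g) = diag g" by (rule adj_eqI) (simp add: cinner.rep_eq 2 mult_ac)
qed

definition ent :: "'a bop \<Rightarrow> 'a \<Rightarrow> 'a \<Rightarrow> complex"
  where "ent x m n = cinner (delta m) (x \<odot> delta n)"

lemma ent_eq_Rep: "ent x m n = Rep_ell2 (x \<odot> delta n) m"
  by (simp add: ent_def cinner_delta_left)

lemma ent_simps [simp]:
  "ent 0 m n = 0" "ent (x + y) m n = ent x m n + ent y m n" "ent (x - y) m n = ent x m n - ent y m n"
  "ent (- x) m n = - ent x m n" "ent (r *\<^sub>R x) m n = r *\<^sub>R ent x m n"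
  by (simp_all add: ent_eq_Rep scaleR_conv_of_real[where 'a = complex])

lemma ent_one: "ent 1 m n = (if m = n then 1 else 0)"
  by (simp add: ent_eq_Rep)

lemma ent_cop_mult [simp]: "ent (cop c * x) m n = c * ent x m n"
  by (simp add: ent_eq_Rep)

lemma ent_adj: "ent (adj x) m n = cnj (ent x n m)"
  by (simp add: ent_def cinner_app_left[symmetric] cinner_cnj)

lemma ent_diag:
  assumes "\<And>n. \<bar>g n\<bar> \<le> C"
  shows "ent (diag g * x) m n = complex_of_real (g m) * ent x m n"
    and "ent (x * diag g) m n = complex_of_real (g n) * ent x m n"
proof -
  show "ent (diag g * x) m n = complex_of_real (g m) * ent x m n" for x
    by (simp add: ent_eq_Rep Rep_ell2_diag[OF assms])
  have "diag g \<odot> delta n = g n *\<^sub>R delta n" by (rule ell2_eqI) (simp add: Rep_ell2_diag[OF assms])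
  then show "ent (x * diag g) m n = complex_of_real (g n) * ent x m n" by (simp add: ent_eq_Rep)
qed

text \<open>Row \<open>m\<close> of \<open>x\<close> is the conjugate of column \<open>m\<close> of
  \<open>adj x\<close>, hence square summable, so the matrix product is a scalar product of two
  vectors.\<close>

lemma ent_mult_has_sum: "((\<lambda>k. ent x m k * ent y k n) has_sum ent (x * y) m n) UNIV"
proof -
  have "cnj (Rep_ell2 (adj x \<odot> delta m) k) = ent x m k" for k by (simp flip: ent_eq_Rep add: ent_adj)
  moreover have "cinner (adj x \<odot> delta m) (y \<odot> delta n) = ent (x * y) m n"
    by (simp add: ent_def cinner_app_left)
  ultimately show ?thesis
    using cinner_has_sum[of "adj x \<odot> delta m" "y \<odot> delta n"] by (simp add: ent_eq_Rep)
qed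

lemma ent_mult_abs:
  shows ent_mult_abs_summable: "(\<lambda>k. cmod (ent x m k) * cmod (ent y k n)) summable_on UNIV"
    and infsum_ent_mult_le: "(\<Sum>\<^sub>\<infinity>k. cmod (ent x m k) * cmod (ent y k n)) \<le> norm (adj x \<odot> delta m) * norm (y \<odot> delta n)"
proof -
  have "cmod (Rep_ell2 (adj x \<odot> delta m) k) = cmod (ent x m k)" for k
    by (simp flip: ent_eq_Rep add: ent_adj)
  then show "(\<lambda>k. cmod (ent x m k) * cmod (ent y k n)) summable_on UNIV"
    "(\<Sum>\<^sub>\<infinity>k. cmod (ent x m k) * cmod (ent y k n)) \<le> norm (adj x \<odot> delta m) * norm (y \<odot> delta n)"
    using cinner_abs_summable[of "adj x \<odot> delta m" "y \<odot> delta n"] infsum_cmod_mult_le[of "adj x \<odot> delta m" "y \<odot> delta n"]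
    by (simp_all add: ent_eq_Rep)
qed

lemma cmod_ent_le: "cmod (ent x m n) \<le> norm x"
  using cmod_cinner_le[of "delta m" "x \<odot> delta n"] norm_app[of x "delta n"] by (simp add: ent_def)

lemma bounded_linear_ent: "bounded_linear (\<lambda>x. ent x m n)"
  by (rule bounded_linear_intro[where K = 1]) (simp_all add: cmod_ent_le)

section \<open>Traces\<close>

text \<open>Tonelli and Fubini in one package: dominated rows give everything needed about the
  columns. It serves cyclicity of the trace and the termwise trace of the exponential
  series.\<close>

lemma abs_double_sum:
  fixes f :: "'b \<Rightarrow> 'c \<Rightarrow> complex"
  assumes rows: "\<And>x. (\<lambda>y. cmod (f x y)) summable_on UNIV"
    and bound: "\<And>x. (\<Sum>\<^sub>\<infinity>y. cmod (f x y)) \<le> g x" and g: "g summable_on UNIV"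
  shows abs_double_sum_swap: "(\<Sum>\<^sub>\<infinity>x. \<Sum>\<^sub>\<infinity>y. f x y) = (\<Sum>\<^sub>\<infinity>y. \<Sum>\<^sub>\<infinity>x. f x y)"
    and abs_double_sum_column: "(\<lambda>x. cmod (f x y)) summable_on UNIV"
    and abs_double_sum_columns: "(\<lambda>y. \<Sum>\<^sub>\<infinity>x. cmod (f x y)) summable_on UNIV"
    and abs_double_sum_le: "(\<Sum>\<^sub>\<infinity>y. \<Sum>\<^sub>\<infinity>x. cmod (f x y)) \<le> infsum g UNIV"
proof -
  have rows_sum: "(\<lambda>x. \<Sum>\<^sub>\<infinity>y. cmod (f x y)) summable_on UNIV"
    by (rule summable_on_comparison_test[OF g]) (auto intro: bound infsum_nonneg)
  then have abs: "(\<lambda>p. cmod (case p of (x, y) \<Rightarrow> f x y)) summable_on UNIV \<times> UNIV"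
    using rows Infinite_Sum.abs_summable_on_Sigma_iff[of "\<lambda>(x, y). f x y" UNIV "\<lambda>_. UNIV"]
    by (simp add: infsum_nonneg)
  then show "(\<Sum>\<^sub>\<infinity>x. \<Sum>\<^sub>\<infinity>y. f x y) = (\<Sum>\<^sub>\<infinity>y. \<Sum>\<^sub>\<infinity>x. f x y)"
    by (rule infsum_swap_banach[OF abs_summable_summable])
  from abs have "(\<lambda>(x, y). cmod (f x y)) summable_on UNIV \<times> UNIV" by (simp add: case_prod_unfold)
  then have swap: "(\<lambda>(y, x). cmod (f x y)) summable_on UNIV \<times> UNIV"
    using summable_on_swap[of "\<lambda>(x, y). cmod (f x y)" UNIV UNIV] by (simp add: case_prod_unfold)
  then have "(\<lambda>p. cmod (case p of (y, x) \<Rightarrow> f x y)) summable_on UNIV \<times> UNIV"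
    by (simp add: case_prod_unfold)
  then show "(\<lambda>x. cmod (f x y)) summable_on UNIV" "(\<lambda>y. \<Sum>\<^sub>\<infinity>x. cmod (f x y)) summable_on UNIV"
    using Infinite_Sum.abs_summable_on_Sigma_iff[of "\<lambda>(y, x). f x y" UNIV "\<lambda>_. UNIV"]
    by (simp_all add: infsum_nonneg)
  have "(\<Sum>\<^sub>\<infinity>y. \<Sum>\<^sub>\<infinity>x. cmod (f x y)) = (\<Sum>\<^sub>\<infinity>x. \<Sum>\<^sub>\<infinity>y. cmod (f x y))" using swap by (intro infsum_swap_banach)
  also have "\<dots> \<le> infsum g UNIV" by (intro infsum_mono rows_sum g bound)
  finally show "(\<Sum>\<^sub>\<infinity>y. \<Sum>\<^sub>\<infinity>x. cmod (f x y)) \<le> infsum g UNIV" .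
qed

lemma has_sum_sum_finite:
  fixes f :: "'b \<Rightarrow> 'c \<Rightarrow> 'd :: {topological_comm_monoid_add}"
  assumes "finite J" "\<And>j. j \<in> J \<Longrightarrow> (f j has_sum s j) A"
  shows "((\<lambda>x. \<Sum>j\<in>J. f j x) has_sum (\<Sum>j\<in>J. s j)) A"
  using assms by (induction J rule: finite_induct) (simp_all add: has_sum_add)

text \<open>Writing \<open>x\<close> as the sum of the rank one operators that send
  \<open>delta n\<close> to \<open>x \<odot> delta n\<close> shows that the sum of the column norms
  dominates the trace norm. Unlike the latter it depends on the basis.\<close>

definition col_summable :: "'a bop \<Rightarrow> bool"
  where "col_summable x \<longleftrightarrow> (\<lambda>n. norm (x \<odot> delta n)) summable_on UNIV"

definition col_norm :: "'a bop \<Rightarrow> real"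
  where "col_norm x = (\<Sum>\<^sub>\<infinity>n. norm (x \<odot> delta n))"

definition tr :: "'a bop \<Rightarrow> complex"
  where "tr x = (\<Sum>\<^sub>\<infinity>n. ent x n n)"

lemma op_trace_Rep_bop: "op_trace (Rep_bop x) = tr x"
  by (simp add: op_trace_def tr_def ent_def app.rep_eq)

lemma col_norm_nonneg: "0 \<le> col_norm x"
  by (simp add: col_norm_def infsum_nonneg)

lemma col_summable_comparison:
  "col_summable x \<Longrightarrow> (\<And>n. norm (y \<odot> delta n) \<le> K * norm (x \<odot> delta n)) \<Longrightarrow> col_summable y"
  unfolding col_summable_def
  by (rule summable_on_comparison_test[OF summable_on_cmult_right[of _ _ K]]) auto

lemma col_summable_mult_left: "col_summable x \<Longrightarrow> col_summable (y * x)"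
  by (erule col_summable_comparison[where K = "norm y"]) (simp add: norm_app)

lemma col_norm_mult_left: "col_summable x \<Longrightarrow> col_norm (y * x) \<le> norm y * col_norm x"
  unfolding col_norm_def infsum_cmult_right'[symmetric] using col_summable_mult_left[of x y]
  by (intro infsum_mono summable_on_cmult_right) (simp_all add: col_summable_def norm_app)

lemma col_summable_add: "col_summable x \<Longrightarrow> col_summable y \<Longrightarrow> col_summable (x + y)"
  unfolding col_summable_def
  by (rule summable_on_comparison_test[OF summable_on_add, of "\<lambda>n. norm (x \<odot> delta n)" _ "\<lambda>n. norm (y \<odot> delta n)"])
    (simp_all add: norm_triangle_ineq)

lemma col_summable_uminus: "col_summable x \<Longrightarrow> col_summable (- x)"
  by (erule col_summable_comparison[where K = 1]) simp

lemma col_summable_diff: "col_summable x \<Longrightarrow> col_summable y \<Longrightarrow> col_summable (x - y)"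
  using col_summable_add[of x "- y"] by (simp add: col_summable_uminus)

lemma cmod_ent_le_col: "cmod (ent x m n) \<le> norm (x \<odot> delta n)"
  unfolding ent_eq_Rep by (rule cmod_Rep_ell2_le)

lemma col_summable_diagonal: "col_summable x \<Longrightarrow> (\<lambda>n. cmod (ent x n n)) summable_on UNIV"
  unfolding col_summable_def by (erule summable_on_comparison_test) (auto intro: cmod_ent_le_col)

lemma tr_has_sum: "col_summable x \<Longrightarrow> ((\<lambda>n. ent x n n) has_sum tr x) UNIV"
  unfolding tr_def by (rule has_sum_infsum[OF abs_summable_summable[OF col_summable_diagonal]])

lemma cmod_tr_le: "col_summable x \<Longrightarrow> cmod (tr x) \<le> col_norm x"
  unfolding tr_def col_norm_def
  by (rule order_trans[OF norm_infsum_bound[OF col_summable_diagonal] infsum_mono[OF col_summable_diagonal]])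
    (simp_all add: cmod_ent_le_col col_summable_def)

lemma tr_add: "col_summable x \<Longrightarrow> col_summable y \<Longrightarrow> tr (x + y) = tr x + tr y"
  using has_sum_unique[of "\<lambda>n. ent (x + y) n n" UNIV "tr (x + y)" "tr x + tr y"]
    tr_has_sum[OF col_summable_add, of x y] has_sum_add[OF tr_has_sum tr_has_sum, of x y] by simp

lemma tr_uminus: "tr (- x) = - tr x"
  by (simp add: tr_def infsum_uminus)

lemma tr_diff: "col_summable x \<Longrightarrow> col_summable y \<Longrightarrow> tr (x - y) = tr x - tr y"
  using tr_add[of x "- y"] by (simp add: col_summable_uminus tr_uminus)

lemma tr_scaleR: "tr (r *\<^sub>R x) = r *\<^sub>R tr x"
  by (simp only: tr_def ent_simps infsum_scaleR_right)

lemma tr_cop_mult: "tr (cop c * x) = c * tr x"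
  by (simp add: tr_def infsum_cmult_right')

text \<open>Both traces are iterated sums of \<open>ent x n k * ent y k n\<close>. Summed over
  \<open>n\<close> first, Cauchy-Schwarz bounds the absolute values by
  \<open>norm y * norm (x \<odot> delta k)\<close>. The product \<open>x * y\<close> itself need not
  be column summable, only its diagonal is absolutely summable.\<close>

lemma
  assumes "col_summable x"
  shows diagonal_mult_summable: "(\<lambda>n. cmod (ent (x * y) n n)) summable_on UNIV"
    and infsum_diagonal_mult_le: "(\<Sum>\<^sub>\<infinity>n. cmod (ent (x * y) n n)) \<le> norm y * col_norm x"
    and tr_commute: "tr (x * y) = tr (y * x)"
proof -
  define f where "f k n = ent x n k * ent y k n" for k n
  have f: "cmod (f k n) = cmod (ent y k n) * cmod (ent x n k)" for k n by (simp add: f_def norm_mult)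
  have rows: "(\<lambda>n. cmod (f k n)) summable_on UNIV" for k unfolding f by (rule ent_mult_abs_summable)
  have bound: "(\<Sum>\<^sub>\<infinity>n. cmod (f k n)) \<le> norm y * norm (x \<odot> delta k)" for k
    unfolding f using norm_app[of "adj y" "delta k"]
    by (intro order_trans[OF infsum_ent_mult_le] mult_right_mono) auto
  have g: "(\<lambda>k. norm y * norm (x \<odot> delta k)) summable_on UNIV"
    using assms by (simp add: col_summable_def summable_on_cmult_right)
  note sums = abs_double_sum[of f, OF rows bound g]
  have 1: "(\<Sum>\<^sub>\<infinity>k. f k n) = ent (x * y) n n" for n
    using ent_mult_has_sum[of x n y n] by (simp add: f_def infsumI)
  have 2: "(\<Sum>\<^sub>\<infinity>n. f k n) = ent (y * x) k k" for k
    using ent_mult_has_sum[of y k x k] by (simp add: f_def infsumI mult.commute)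
  show "tr (x * y) = tr (y * x)" using sums(1) by (simp add: tr_def 1 2)
  have le: "cmod (ent (x * y) n n) \<le> (\<Sum>\<^sub>\<infinity>k. cmod (f k n))" for n
    unfolding 1[symmetric] by (rule norm_infsum_bound) (rule sums(2))
  then show *: "(\<lambda>n. cmod (ent (x * y) n n)) summable_on UNIV"
    by (intro summable_on_comparison_test[OF sums(3)]) auto
  show "(\<Sum>\<^sub>\<infinity>n. cmod (ent (x * y) n n)) \<le> norm y * col_norm x"
    using order_trans[OF infsum_mono[OF * sums(3) le] sums(4)]
    by (simp add: infsum_cmult_right' col_norm_def)
qed

lemma bop_ent_eqI:
  assumes "\<And>m n. ent x m n = ent y m n"
  shows "x = y"
proof (rule bop_eqI, rule ell2_eqI)
  fix \<psi> m
  have "adj x \<odot> delta m = adj y \<odot> delta m" by (rule ell2_eqI) (simp flip: ent_eq_Rep add: ent_adj assms)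
  then show "Rep_ell2 (x \<odot> \<psi>) m = Rep_ell2 (y \<odot> \<psi>) m" by (simp flip: cinner_delta_left add: cinner_app)
qed

subsection \<open>The trace of a commutator with an exponential\<close>

lemma commutator_power_Suc:
  fixes b x :: "'b :: ring_1"
  shows "b * x ^ Suc k - x ^ Suc k * b = (\<Sum>j\<le>k. x ^ j * (b * x - x * b) * x ^ (k - j))"
proof (induction k)
  case (Suc k)
  have "b * x ^ Suc (Suc k) - x ^ Suc (Suc k) * b
      = (b * x ^ Suc k - x ^ Suc k * b) * x + x ^ Suc k * (b * x - x * b)"
    by (simp add: algebra_simps power_commutes)
      (simp add: power_commutes[symmetric] mult.assoc[symmetric])
  also have "(b * x ^ Suc k - x ^ Suc k * b) * x
      = (\<Sum>j\<le>k. x ^ j * (b * x - x * b) * x ^ (Suc k - j))" unfolding Suc.IH sum_distrib_right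
    by (rule sum.cong) (auto simp: Suc_diff_le power_commutes mult.assoc)
  finally show ?case by simp
qed simp

text \<open>The commutator of \<open>b\<close> with a power of \<open>x\<close> is a sum of terms
  with \<open>D = b * x - x * b\<close> in the middle. These end in powers of \<open>x\<close> and
  need not be column summable, so the proof sums diagonal entries only and exchanges the sum over
  the series with the sum over the diagonal.\<close>

lemma tr_exp_commutator:
  fixes b x :: "'a bop"
  assumes D: "col_summable (b * x - x * b)"
  shows "tr (exp (- x) * (b * exp x - exp x * b)) = tr (b * x - x * b)"
proof -
  define D where "D = b * x - x * b"
  have cD: "col_summable D" using assms by (simp add: D_def)
  define v where "v = exp (- x)"
  have vx: "v * x ^ j = x ^ j * v" for j
    by (metis v_def exp_times_arg_commute[of "- x"] minus_mult_commute mult_minus_left neg_equal_iff_equal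
        power_commuting_commutes)
  \<comment> \<open>The constant term of the series commutes with \<open>b\<close>, so indices are
    shifted: \<open>e k\<close> belongs to \<open>x ^ Suc k\<close>.\<close>
  define e where "e k = b * x ^ Suc k - x ^ Suc k * b" for k
  define f where "f k n = ent (v * e k /\<^sub>R fact (Suc k)) n n" for k n
  define K where "K = norm v * col_norm D"
  have "K \<ge> 0" by (simp add: K_def col_norm_nonneg)
  have e: "v * e k = (\<Sum>j\<le>k. (v * x ^ j * D) * x ^ (k - j))" for k
    unfolding e_def commutator_power_Suc D_def sum_distrib_left by (simp only: mult.assoc)
  have ent_sum: "ent (\<Sum>j\<in>J. z j) n n = (\<Sum>j\<in>J. ent (z j) n n)" for J :: "nat set" and z n
    by (rule linear_sum[OF bounded_linear.linear[OF bounded_linear_ent]])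
  have cs: "col_summable (v * x ^ j * D)" for j by (rule col_summable_mult_left[OF cD])
  have term_le: "(\<Sum>\<^sub>\<infinity>n. cmod (ent ((v * x ^ j * D) * x ^ (k - j)) n n)) \<le> K * norm x ^ k" if "j \<le> k" for j k
  proof -
    have "(\<Sum>\<^sub>\<infinity>n. cmod (ent ((v * x ^ j * D) * x ^ (k - j)) n n)) \<le> norm (x ^ (k - j)) * col_norm (v * x ^ j * D)"
      by (rule infsum_diagonal_mult_le[OF cs])
    also have "\<dots> \<le> norm x ^ (k - j) * (norm v * norm x ^ j * col_norm D)"
    proof (intro mult_mono norm_power_ineq)
      have "norm (v * x ^ j) \<le> norm v * norm x ^ j"
        by (rule order_trans[OF norm_mult_ineq mult_left_mono[OF norm_power_ineq]]) simp
      then show "col_norm (v * x ^ j * D) \<le> norm v * norm x ^ j * col_norm D"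
        by (intro order_trans[OF col_norm_mult_left[OF cD]] mult_right_mono) (auto simp: col_norm_nonneg)
    qed (auto simp: col_norm_nonneg)
    also have "\<dots> = K * norm x ^ k" using that by (simp add: K_def power_add[symmetric] mult_ac)
    finally show ?thesis .
  qed
  have f_eq: "f k n = (\<Sum>j\<le>k. ent ((v * x ^ j * D) * x ^ (k - j)) n n) /\<^sub>R fact (Suc k)" for k n
    by (simp only: f_def e ent_simps ent_sum)
  have f_le: "cmod (f k n) \<le> (\<Sum>j\<le>k. cmod (ent ((v * x ^ j * D) * x ^ (k - j)) n n)) / fact (Suc k)" for k n
    unfolding f_eq norm_scaleR by (simp add: divide_inverse mult.commute mult_left_mono norm_sum)
  have dom: "(\<lambda>n. (\<Sum>j\<le>k. cmod (ent ((v * x ^ j * D) * x ^ (k - j)) n n)) / fact (Suc k)) summable_on UNIV" for k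
    unfolding divide_inverse
    by (intro summable_on_cmult_left, rule has_sum_imp_summable[OF has_sum_sum_finite[OF _ has_sum_infsum]])
      (simp_all add: diagonal_mult_summable[OF cs])
  have rows: "(\<lambda>n. cmod (f k n)) summable_on UNIV" for k
    by (rule summable_on_comparison_test[OF dom[of k]]) (simp_all only: f_le norm_ge_zero)
  have bound: "(\<Sum>\<^sub>\<infinity>n. cmod (f k n)) \<le> K * (norm x ^ k /\<^sub>R fact k)" for k
  proof -
    have "(\<Sum>\<^sub>\<infinity>n. cmod (f k n)) \<le> (\<Sum>\<^sub>\<infinity>n. (\<Sum>j\<le>k. cmod (ent ((v * x ^ j * D) * x ^ (k - j)) n n)) / fact (Suc k))"
      by (intro infsum_mono rows dom f_le)
    also have "\<dots> = (\<Sum>j\<le>k. \<Sum>\<^sub>\<infinity>n. cmod (ent ((v * x ^ j * D) * x ^ (k - j)) n n)) / fact (Suc k)"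
      unfolding divide_inverse by (subst infsum_cmult_left')
        (simp add: infsumI[OF has_sum_sum_finite[OF _ has_sum_infsum]] diagonal_mult_summable[OF cs])
    also have "\<dots> \<le> (\<Sum>j\<le>k. K * norm x ^ k) / fact (Suc k)"
      by (intro divide_right_mono sum_mono term_le) auto
    also have "\<dots> = K * (norm x ^ k /\<^sub>R fact k)" by (simp add: divide_simps) 
    finally show ?thesis .
  qed
  have "summable (\<lambda>k. K * (norm x ^ k /\<^sub>R fact k))" by (intro summable_mult summable_exp_generic)
  then have g: "(\<lambda>k. K * (norm x ^ k /\<^sub>R fact k)) summable_on UNIV"
    using \<open>K \<ge> 0\<close> by (intro summable_nonneg_imp_summable_on) auto
  note sums = abs_double_sum[of f, OF rows bound g]
  have 1: "(\<Sum>\<^sub>\<infinity>k. f k n) = ent (v * (b * exp x - exp x * b)) n n" for n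
  proof (intro infsumI norm_summable_imp_has_sum)
    show "summable (\<lambda>k. cmod (f k n))" using sums(2)[of n] by (rule summable_on_imp_summable)
    have "(\<lambda>k. b * (x ^ k /\<^sub>R fact k) - (x ^ k /\<^sub>R fact k) * b) sums (b * exp x - exp x * b)"
      by (intro sums_diff sums_mult sums_mult2 exp_converges)
    then have "(\<lambda>k. b * (x ^ Suc k /\<^sub>R fact (Suc k)) - (x ^ Suc k /\<^sub>R fact (Suc k)) * b) sums (b * exp x - exp x * b)"
      by (subst sums_Suc_iff) simp
    then have "(\<lambda>k. e k /\<^sub>R fact (Suc k)) sums (b * exp x - exp x * b)"
      by (simp add: e_def scaleR_right_diff_distrib)
    then have "(\<lambda>k. v * (e k /\<^sub>R fact (Suc k))) sums (v * (b * exp x - exp x * b))" by (rule sums_mult)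
    then show "(\<lambda>k. f k n) sums ent (v * (b * exp x - exp x * b)) n n"
      unfolding f_def by (intro bounded_linear.sums[OF bounded_linear_ent]) simp
  qed
  have 2: "(\<Sum>\<^sub>\<infinity>n. f k n) = tr ((v * x ^ k * D) /\<^sub>R fact k)" for k
  proof -
    have "(\<Sum>\<^sub>\<infinity>n. f k n) = (\<Sum>j\<le>k. tr ((v * x ^ j * D) * x ^ (k - j))) /\<^sub>R fact (Suc k)"
      unfolding f_eq infsum_scaleR_right tr_def
      by (subst infsumI[OF has_sum_sum_finite[OF _ has_sum_infsum]])
        (simp_all add: abs_summable_summable[OF diagonal_mult_summable[OF cs]])
    \<comment> \<open>Cyclicity makes all \<open>k + 1\<close> summands equal; their number turns
      \<open>fact (Suc k)\<close> into \<open>fact k\<close>.\<close>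
    also have "(\<Sum>j\<le>k. tr ((v * x ^ j * D) * x ^ (k - j))) = (\<Sum>j\<le>k. tr (v * x ^ k * D))"
    proof (rule sum.cong)
      fix j assume "j \<in> {..k}"
      then have "x ^ (k - j) * (v * x ^ j * D) = v * x ^ k * D"
        by (simp add: mult.assoc[symmetric] vx[symmetric]) (simp add: mult.assoc power_add[symmetric])
      then show "tr ((v * x ^ j * D) * x ^ (k - j)) = tr (v * x ^ k * D)"
        by (simp add: tr_commute[OF cs])
    qed simp
    also have "\<dots> /\<^sub>R fact (Suc k) = tr ((v * x ^ k * D) /\<^sub>R fact k)"
    proof -
      have "inverse (fact (Suc k)) * real (Suc k) = inverse (fact k)"
        by (simp add: divide_simps del: of_nat_Suc)
      then show ?thesis by (simp only: sum_constant_scaleR card_atMost scaleR_scaleR tr_scaleR)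
    qed
    finally show ?thesis .
  qed
  \<comment> \<open>Continuity of this functional allows resumming the series, where the powers
    recombine to \<open>v * exp x = 1\<close>.\<close>
  have "bounded_linear (\<lambda>z. tr (z * D))"
  proof (rule bounded_linear_intro[where K = "col_norm D"])
    show "tr ((z + w) * D) = tr (z * D) + tr (w * D)" for z w
      by (simp add: distrib_right tr_add col_summable_mult_left[OF cD])
    show "tr ((r *\<^sub>R z) * D) = r *\<^sub>R tr (z * D)" for r z by (simp add: tr_scaleR)
    show "cmod (tr (z * D)) \<le> norm z * col_norm D" for z
      by (rule order_trans[OF cmod_tr_le col_norm_mult_left]) (auto intro: col_summable_mult_left cD)
  qed
  moreover have "(\<lambda>k. v * (x ^ k /\<^sub>R fact k)) sums (v * exp x)" by (intro sums_mult exp_converges)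
  ultimately have "(\<lambda>k. tr (v * (x ^ k /\<^sub>R fact k) * D)) sums tr (v * exp x * D)"
    by (rule bounded_linear.sums)
  moreover have "v * exp x = 1" using exp_minus_inverse[of "- x"] by (simp add: v_def)
  ultimately have "(\<lambda>k. \<Sum>\<^sub>\<infinity>n. f k n) sums tr D" by (simp add: 2)
  moreover have "summable (\<lambda>k. cmod (\<Sum>\<^sub>\<infinity>n. f k n))"
    by (rule summable_comparison_test'[OF \<open>summable (\<lambda>k. K * (norm x ^ k /\<^sub>R fact k))\<close>])
      (simp only: real_norm_def abs_norm_cancel order_trans[OF norm_infsum_bound[OF rows] bound])
  ultimately have "(\<Sum>\<^sub>\<infinity>k. \<Sum>\<^sub>\<infinity>n. f k n) = tr D" by (intro infsumI norm_summable_imp_has_sum)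
  then show ?thesis using sums(1) by (simp add: 1 tr_def[symmetric] v_def D_def)
qed

section \<open>The trace of a difference of projections\<close>

lemma norm_projection_app:
  assumes "adj r = r" "r * r = r"
  shows "cinner \<psi> (r \<odot> \<psi>) = complex_of_real ((norm (r \<odot> \<psi>))\<^sup>2)"
proof -
  have "cinner \<psi> (r \<odot> \<psi>) = cinner \<psi> (r \<odot> r \<odot> \<psi>)" by (metis assms(2) app_simps(7))
  also have "\<dots> = cinner (r \<odot> \<psi>) (r \<odot> \<psi>)" by (simp add: cinner_app assms(1))
  finally show ?thesis by (simp add: cinner_self_norm)
qed

lemma ent_projection:
  assumes "adj r = r" "r * r = r"
  shows "ent r n n = complex_of_real ((norm (r \<odot> delta n))\<^sup>2)"
  using norm_projection_app[OF assms] by (simp add: ent_def)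

text \<open>Induction on a bound for the trace. A nonzero projection \<open>r\<close> has a unit
  vector \<open>e\<close> in its range; removing the rank one projection \<open>q\<close> onto
  \<open>e\<close> leaves a projection whose trace is smaller by one. The trace appears as the sum
  of squared column norms, which keeps the argument in the reals.\<close>

lemma has_sum_projection_Nats:
  assumes "adj r = r" "r * r = r" "((\<lambda>n. (norm (r \<odot> delta n))\<^sup>2) has_sum t) UNIV" "t < real m"
  shows "t \<in> \<nat>"
  using assms
proof (induction m arbitrary: r t)
  case 0
  then show ?case using has_sum_nonneg[of "\<lambda>n. (norm (r \<odot> delta n))\<^sup>2" UNIV t] by simp
next
  case (Suc m)
  show ?case
  proof (cases "r = 0")
    case True
    then have "t = 0" using Suc.prems(3) has_sum_unique[OF _ has_sum_0_simp] by fastforce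
    then show ?thesis by simp
  next
    case False
    obtain k where k: "r \<odot> delta k \<noteq> 0"
      using False bop_ent_eqI[of r 0] by (metis ent_def cinner_zero_right app_simps(1))
    define e where "e = inverse (norm (r \<odot> delta k)) *\<^sub>R (r \<odot> delta k)"
    have norm_e: "norm e = 1" using k by (simp add: e_def)
    have re: "r \<odot> e = e" using Suc.prems(2) by (simp add: e_def flip: app_simps(7))
    obtain q where q: "\<And>\<psi>. q \<odot> \<psi> = cinner e \<psi> *\<^sub>C e" "\<And>\<psi>. adj q \<odot> \<psi> = cinner e \<psi> *\<^sub>C e"
    proof (rule bop_exists[of "\<lambda>\<psi>. cinner e \<psi> *\<^sub>C e" "\<lambda>\<psi>. cinner e \<psi> *\<^sub>C e" 1])
      show "cinner \<phi> (cinner e \<psi> *\<^sub>C e) = cinner (cinner e \<phi> *\<^sub>C e) \<psi>" for \<phi> \<psi>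
        by (simp add: cinner_scaleC_left cinner_scaleC_right cinner_cnj)
      show "norm (cinner e \<psi> *\<^sub>C e) \<le> 1 * norm \<psi>" "norm (cinner e \<psi> *\<^sub>C e) \<le> 1 * norm \<psi>" for \<psi>
        using cmod_cinner_le[of e \<psi>] by (simp_all add: norm_e)
    qed blast
    have adj_q: "adj q = q" by (rule bop_eqI) (simp add: q)
    have qq: "q * q = q" by (rule bop_eqI) (simp add: q cinner_self_norm norm_e cinner_scaleC_right)
    have rq: "r * q = q" by (rule bop_eqI) (simp add: q re)
    then have qr: "q * r = q" by (metis adj_q Suc.prems(1) adj_simps(7))
    have ent_q: "ent q n n = complex_of_real ((cmod (Rep_ell2 e n))\<^sup>2)" for n
      by (simp add: ent_eq_Rep q cinner_delta_right complex_norm_square mult.commute del: of_real_power)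
    have "((\<lambda>n. (cmod (Rep_ell2 e n))\<^sup>2) has_sum 1) UNIV"
      using norm_ell2_sqr[of e] norm_e by (simp add: has_sum_iff)
    then have "((\<lambda>n. (norm (r \<odot> delta n))\<^sup>2 + - ((cmod (Rep_ell2 e n))\<^sup>2)) has_sum t + - 1) UNIV"
      by (intro has_sum_add Suc.prems(3) has_sum_uminusI)
    moreover have "(norm (r \<odot> delta n))\<^sup>2 + - ((cmod (Rep_ell2 e n))\<^sup>2) = (norm ((r - q) \<odot> delta n))\<^sup>2" for n
    proof -
      have "complex_of_real ((norm ((r - q) \<odot> delta n))\<^sup>2) = ent (r - q) n n"
        by (rule ent_projection[symmetric])
          (simp_all add: Suc.prems(1,2) adj_q algebra_simps qq rq qr)
      also have "\<dots> = complex_of_real ((norm (r \<odot> delta n))\<^sup>2 - (cmod (Rep_ell2 e n))\<^sup>2)"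
        by (simp add: ent_q ent_projection[OF Suc.prems(1,2)])
      finally show ?thesis unfolding of_real_eq_iff by simp
    qed
    ultimately have "((\<lambda>n. (norm ((r - q) \<odot> delta n))\<^sup>2) has_sum t - 1) UNIV" by simp
    then have "t - 1 \<in> \<nat>"
      by (rule Suc.IH[rotated 2]) (use Suc.prems in \<open>simp_all add: adj_q algebra_simps qq rq qr\<close>)
    then have "t - 1 + 1 \<in> \<nat>" by (intro Nats_add) simp_all
    then show ?thesis by simp
  qed
qed

lemma tr_projection_Nats:
  assumes r: "adj r = r" "r * r = r" and "col_summable r"
  shows "tr r \<in> \<nat>"
proof -
  have "((\<lambda>n. complex_of_real ((norm (r \<odot> delta n))\<^sup>2)) has_sum tr r) UNIV"
    using tr_has_sum[OF assms(3)] by (simp only: ent_projection[OF r])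
  then have "((\<lambda>n. (norm (r \<odot> delta n))\<^sup>2) has_sum Re (tr r)) UNIV" "Im (tr r) = 0"
    using has_sum_Re[of "\<lambda>n. complex_of_real ((norm (r \<odot> delta n))\<^sup>2)" UNIV "tr r"]
      has_sum_Im[of "\<lambda>n. complex_of_real ((norm (r \<odot> delta n))\<^sup>2)" UNIV "tr r"]
      has_sum_unique[of "\<lambda>_ :: 'a. 0 :: real" UNIV "Im (tr r)" 0] by (simp_all del: of_real_power)
  moreover obtain m where "Re (tr r) < real m" using reals_Archimedean2 by blast
  ultimately have "Re (tr r) \<in> \<nat>" using has_sum_projection_Nats[OF r] by blast
  with \<open>Im (tr r) = 0\<close> show ?thesis by (auto simp: Nats_def complex_eq_iff)
qed

text \<open>Unordered sums are integrals for the counting measure, to which Lebesgue's theorem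
  applies.\<close>

lemma infsum_dominated_convergence:
  fixes f :: "nat \<Rightarrow> 'b \<Rightarrow> complex"
  assumes lim: "\<And>n. (\<lambda>k. f k n) \<longlonglongrightarrow> h n"
    and bound: "\<And>k n. cmod (f k n) \<le> g n" and g: "g summable_on UNIV"
  shows "(\<lambda>k. \<Sum>\<^sub>\<infinity>n. f k n) \<longlonglongrightarrow> (\<Sum>\<^sub>\<infinity>n. h n)"
proof -
  have bound_h: "cmod (h n) \<le> g n" for n
    by (rule LIMSEQ_le_const2[OF tendsto_norm[OF lim]]) (auto intro: bound)
  have eq: "infsum z UNIV = (LINT n|count_space UNIV. z n)" if "\<And>n. cmod (z n) \<le> g n" for z
  proof -
    have "Infinite_Sum.abs_summable_on z UNIV"
      by (rule Infinite_Sum.abs_summable_on_comparison_test'[OF g that])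
    then show ?thesis by (simp add: abs_summable_equivalent infsetsum_infsum[symmetric] infsetsum_def)
  qed
  have "Infinite_Sum.abs_summable_on g UNIV"
    by (rule summable_on_iff_abs_summable_on_real[THEN iffD1, OF g])
  then have "integrable (count_space UNIV) g"
    unfolding abs_summable_equivalent Infinite_Set_Sum.abs_summable_on_def .
  then have "(\<lambda>k. LINT n|count_space UNIV. f k n) \<longlonglongrightarrow> (LINT n|count_space UNIV. h n)"
    by (rule integral_dominated_convergence[rotated 2]) (simp_all add: lim bound)
  then show ?thesis by (simp only: eq[OF bound] eq[OF bound_h])
qed

text \<open>Even powers converge strongly to the projection onto the eigenvalues 1 and -1, so
  \<open>w\<close> is the projection for 1 minus the one for -1. No spectral theorem is involved:
  the norms of \<open>t ^ k \<odot> \<psi>\<close> decrease, and they control all distances between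
  even powers.\<close>

lemma contraction_odd_powers_limit:
  fixes t :: "'a bop"
  assumes adj_t: "adj t = t" and contr: "\<And>\<psi>. norm (t \<odot> \<psi>) \<le> norm \<psi>"
  obtains w where "adj w = w" "\<And>\<psi>. (\<lambda>k. t ^ (2 * k + 1) \<odot> \<psi>) \<longlonglongrightarrow> w \<odot> \<psi>"
proof -
  have pow_contr: "norm (t ^ k \<odot> \<psi>) \<le> norm \<psi>" for k \<psi>
    by (induction k) (auto intro: order_trans[OF contr])
  have cauchy: "Cauchy (\<lambda>k. t ^ (2 * k) \<odot> \<psi>)" for \<psi>
  proof -
    define a where "a k = (norm (t ^ k \<odot> \<psi>))\<^sup>2" for k
    have a_Suc: "a (Suc k) \<le> a k" for k by (simp add: a_def contr)
    then have "decseq a" by (rule decseq_SucI)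
    moreover have "0 \<le> a k" for k by (simp add: a_def)
    ultimately obtain L where L: "a \<longlonglongrightarrow> L" using decseq_convergent by metis
    \<comment> \<open>The scalar product depends on \<open>k + l\<close> only, so squared distances
      are combinations of values of the convergent sequence \<open>a\<close>.\<close>
    have inner_a: "Re (cinner (t ^ k \<odot> \<psi>) (t ^ l \<odot> \<psi>)) = a s" if "k + l = 2 * s" for k l s
    proof -
      have "cinner (t ^ k \<odot> \<psi>) (t ^ l \<odot> \<psi>) = cinner \<psi> (t ^ (k + l) \<odot> \<psi>)"
        by (simp add: cinner_app_left adj_t power_add)
      also have "\<dots> = cinner (t ^ s \<odot> \<psi>) (t ^ s \<odot> \<psi>)"
        unfolding that by (simp add: cinner_app_left adj_t power_add mult_2)
      finally show ?thesis by (simp add: a_def Re_cinner_self)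
    qed
    have dist_a: "(norm (t ^ (2 * k) \<odot> \<psi> - t ^ (2 * l) \<odot> \<psi>))\<^sup>2 = a (2 * k) - 2 * a (k + l) + a (2 * l)" for k l
    proof -
      have "(norm (t ^ (2 * k) \<odot> \<psi> - t ^ (2 * l) \<odot> \<psi>))\<^sup>2 =
          Re (cinner (t ^ (2 * k) \<odot> \<psi> - t ^ (2 * l) \<odot> \<psi>) (t ^ (2 * k) \<odot> \<psi> - t ^ (2 * l) \<odot> \<psi>))"
        by (simp add: Re_cinner_self)
      also have "\<dots> = a (2 * k) - 2 * a (k + l) + a (2 * l)"
        using inner_a[of "2 * k" "2 * k" "2 * k"] inner_a[of "2 * l" "2 * l" "2 * l"]
          inner_a[of "2 * k" "2 * l" "k + l"] inner_a[of "2 * l" "2 * k" "k + l"]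
        by (simp add: cinner_diff_left cinner_diff_right)
      finally show ?thesis .
    qed
    show ?thesis
    proof (rule metric_CauchyI)
      fix e :: real assume "e > 0"
      then obtain N where N: "\<And>k. k \<ge> N \<Longrightarrow> \<bar>a k - L\<bar> < e\<^sup>2 / 4" using LIMSEQ_D[OF L, of "e\<^sup>2 / 4"] by auto
      have "dist (t ^ (2 * k) \<odot> \<psi>) (t ^ (2 * l) \<odot> \<psi>) < e" if "k \<ge> N" "l \<ge> N" for k l
      proof (rule power2_less_imp_less)
        show "(dist (t ^ (2 * k) \<odot> \<psi>) (t ^ (2 * l) \<odot> \<psi>))\<^sup>2 < e\<^sup>2"
          using N[of "2 * k"] N[of "2 * l"] N[of "k + l"] that unfolding dist_norm dist_a by linarith
      qed (use \<open>e > 0\<close> in simp)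
      then show "\<exists>N. \<forall>k\<ge>N. \<forall>l\<ge>N. dist (t ^ (2 * k) \<odot> \<psi>) (t ^ (2 * l) \<odot> \<psi>) < e" by blast
    qed
  qed
  define f where "f \<psi> = lim (\<lambda>k. t ^ (2 * k + 1) \<odot> \<psi>)" for \<psi>
  have f: "(\<lambda>k. t ^ (2 * k + 1) \<odot> \<psi>) \<longlonglongrightarrow> f \<psi>" for \<psi> using cauchy[of "t \<odot> \<psi>"] unfolding f_def
    by (simp add: convergent_LIMSEQ_iff[symmetric] Cauchy_convergent_iff power_commutes flip: app_simps(7))
  have f_le: "norm (f \<psi>) \<le> 1 * norm \<psi>" for \<psi>
    by (rule LIMSEQ_le_const2[OF tendsto_norm[OF f]]) (simp only: pow_contr mult_1, blast)
  obtain w where w: "\<And>\<psi>. w \<odot> \<psi> = f \<psi>" "\<And>\<psi>. adj w \<odot> \<psi> = f \<psi>"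
  proof (rule bop_exists[OF _ f_le f_le])
    show "cinner \<phi> (f \<psi>) = cinner (f \<phi>) \<psi>" for \<phi> \<psi>
    proof (rule LIMSEQ_unique)
      show "(\<lambda>k. cinner \<phi> (t ^ (2 * k + 1) \<odot> \<psi>)) \<longlonglongrightarrow> cinner \<phi> (f \<psi>)"
        by (intro tendsto_cinner f tendsto_const)
      show "(\<lambda>k. cinner \<phi> (t ^ (2 * k + 1) \<odot> \<psi>)) \<longlonglongrightarrow> cinner (f \<phi>) \<psi>"
        unfolding cinner_app adj_power adj_t by (intro tendsto_cinner f tendsto_const)
    qed
  qed blast
  show ?thesis by (rule that[of w]) (use w f in \<open>auto intro: bop_eqI\<close>)
qed

text \<open>The mechanism behind the constant odd traces: \<open>1 - e - f\<close> anticommutes with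
  \<open>e - f\<close>, so the spectrum strictly between -1 and 1 is symmetric and cancels in every
  odd trace. The proof expresses this cancellation algebraically.\<close>

proposition tr_projection_difference_Ints:
  fixes e f :: "'a bop"
  assumes e: "adj e = e" "e * e = e" and f: "adj f = f" "f * f = f" and cs: "col_summable (e - f)"
  shows "tr (e - f) \<in> \<int>"
proof -
  define t where "t = e - f"
  have ct: "col_summable t" using cs by (simp add: t_def)
  have adj_t: "adj t = t" by (simp add: t_def e f)
  have ee: "e * (e * z) = e * z" and ff: "f * (f * z) = f * z" for z
    using e(2) f(2) by (metis mult.assoc)+
  have et: "e * t = t * (1 - f)" and ft: "f * t = t * (1 - e)" by (simp_all add: t_def algebra_simps e f)
  \<comment> \<open>Both corrections stay traceless after multiplication by an even power
    \<open>s\<close> of \<open>t\<close>: as \<open>f * t = t * (1 - e)\<close>, cyclicity brings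
    \<open>1 - e\<close> next to \<open>e\<close>.\<close>
  have ttt: "t * t * t = t - (e * f * t + t * e * f)" by (simp add: t_def algebra_simps e f ee ff)
  have contr: "norm (t \<odot> \<psi>) \<le> norm \<psi>" for \<psi>
  proof -
    \<comment> \<open>The squares of \<open>t\<close> and \<open>k\<close> add up to 1, so the norms
      of \<open>t \<odot> \<psi>\<close> and \<open>k \<odot> \<psi>\<close> obey Pythagoras and
      \<open>t\<close> is a contraction.\<close>
    define k where "k = 1 - e - f"
    have "adj k = k" by (simp add: k_def e f)
    have "t * t + k * k = 1" by (simp add: t_def k_def algebra_simps e f)
    then have "(norm \<psi>)\<^sup>2 = Re (cinner \<psi> ((t * t + k * k) \<odot> \<psi>))"
      by (simp add: Re_cinner_self del: app_simps(3,7))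
    also have "\<dots> = (norm (t \<odot> \<psi>))\<^sup>2 + (norm (k \<odot> \<psi>))\<^sup>2"
      by (simp add: cinner_add_right cinner_app[of \<psi>] adj_t \<open>adj k = k\<close> Re_cinner_self)
    finally have "(norm (t \<odot> \<psi>))\<^sup>2 \<le> (norm \<psi>)\<^sup>2" by simp
    then show ?thesis by (rule power2_le_imp_le) simp
  qed
  have te: "t * t * e = e * (t * t)"  by (simp add: t_def algebra_simps e f ee ff)
  have tek: "(t * t) ^ k * e = e * (t * t) ^ k" for k by (metis power_commuting_commutes te)
  have odd: "t ^ (2 * k + 1) = (t * t) ^ k * t" "t ^ (2 * k + 1) = t * (t * t) ^ k" for k
    by (simp_all add: power_mult power2_eq_square power_commutes)
      (metis power_commuting_commutes mult.assoc)
  have cts: "col_summable (z * t)" for z by (rule col_summable_mult_left[OF ct])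
  have tr_odd: "tr (t ^ (2 * k + 1)) = tr t" for k
  proof (induction k)
    case (Suc k)
    define s where "s = (t * t) ^ k"
    have st: "s * t = t * s" using odd[of k] by (simp add: s_def)
    have se: "s * e = e * s" using tek by (simp add: s_def)
    have cyc: "tr ((y * t) * z) = tr (z * (y * t))" for y z by (rule tr_commute[OF cts])
    have "t ^ (2 * Suc k + 1) = s * (t * t * t)" by (simp only: odd(1) power_Suc2 s_def mult.assoc)
    also have "\<dots> = s * t - (s * e * f * t + s * t * (e * f))" unfolding ttt by (simp add: algebra_simps)
    also have "tr \<dots> = tr (s * t) - (tr (s * e * f * t) + tr (s * t * (e * f)))"
    proof -

      \<comment> \<open>Products ending in \<open>t\<close> are the ones known to be column
        summable, so \<open>t\<close> is moved to the right past \<open>e * f\<close>.\<close>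
      have "t * e = (1 - f) * t" by (simp add: t_def algebra_simps e f)
      moreover have "t * f = (1 - e) * t" by (simp add: t_def algebra_simps e f)
      ultimately have "s * t * (e * f) = s * (1 - f) * (1 - e) * t"
        by (simp add: mult.assoc) (metis mult.assoc)
      then have "col_summable (s * t * (e * f))" by (simp add: cts)
      then show ?thesis by (simp add: tr_diff tr_add col_summable_add cts)
    qed
    also have "tr (s * e * f * t) = 0"
    proof -
      have "s * e * f * t = e * s * t * (1 - e)" by (metis ft mult.assoc se)
      then have "tr (s * e * f * t) = tr ((1 - e) * (e * s * t))" by (simp only: cyc[of "e * s"])
      also have "(1 - e) * (e * s * t) = 0" by (simp add: algebra_simps ee)
      finally show ?thesis by (simp add: tr_def)
    qed
    also have "tr (s * t * (e * f)) = 0"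
    proof -
      have "tr (s * t * (e * f)) = tr (e * f * (s * t))" by (rule cyc)
      also have "e * f * (s * t) = e * t * (1 - e) * s" by (metis ft mult.assoc st)
      also have "\<dots> = (e * t) * (s * (1 - e))" by (simp add: algebra_simps se)
      also have "tr \<dots> = tr (s * (1 - e) * (e * t))" by (rule cyc)
      also have "s * (1 - e) * (e * t) = 0" by (simp add: algebra_simps ee)
      finally show ?thesis by (simp add: tr_def)
    qed
    also have "s * t = t ^ (2 * k + 1)" by (simp only: odd(1) s_def)
    finally show ?case using Suc.IH by simp
  qed simp
  obtain w where adj_w: "adj w = w" and w: "\<And>\<psi>. (\<lambda>k. t ^ (2 * k + 1) \<odot> \<psi>) \<longlonglongrightarrow> w \<odot> \<psi>"
    using contraction_odd_powers_limit[OF adj_t contr] by metis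
  have pow_contr: "norm (t ^ k \<odot> \<psi>) \<le> norm \<psi>" for k \<psi>
    by (induction k) (auto intro: order_trans[OF contr])
  \<comment> \<open>Domination by the columns of \<open>t\<close> makes the limit \<open>w\<close>
    column summable and the traces converge.\<close>
  have odd_le: "norm (t ^ (2 * k + 1) \<odot> \<psi>) \<le> norm (t \<odot> \<psi>)" for k \<psi>
    using pow_contr[of "2 * k" "t \<odot> \<psi>"] by (simp add: power_commutes flip: app_simps(7))
  have w_le: "norm (w \<odot> \<psi>) \<le> norm (t \<odot> \<psi>)" for \<psi>
    by (rule LIMSEQ_le_const2[OF tendsto_norm[OF w]]) (simp only: odd_le, blast)
  have cw: "col_summable w" by (rule col_summable_comparison[OF ct, where K = 1]) (simp add: w_le)
  have "(\<lambda>k. tr (t ^ (2 * k + 1))) \<longlonglongrightarrow> tr w" unfolding tr_def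
  proof (rule infsum_dominated_convergence)
    show "(\<lambda>k. ent (t ^ (2 * k + 1)) n n) \<longlonglongrightarrow> ent w n n" for n
      unfolding ent_def by (intro tendsto_cinner w tendsto_const)
    show "cmod (ent (t ^ (2 * k + 1)) n n) \<le> norm (t \<odot> delta n)" for k n
      by (rule order_trans[OF cmod_ent_le_col odd_le])
  qed (use ct in \<open>simp add: col_summable_def\<close>)
  then have tr_w: "tr t = tr w" unfolding tr_odd using LIMSEQ_unique tendsto_const by blast
  \<comment> \<open>Applying \<open>t * t\<close> first only shifts the sequence of odd powers. With
    \<open>w * w = w * t\<close> below this gives that \<open>w\<close> equals its cube.\<close>
  have wtt: "w * (t * t) = w"
  proof (rule bop_eqI)
    fix \<psi>
    have "(\<lambda>k. t ^ (2 * k + 1) \<odot> (t * t) \<odot> \<psi>) \<longlonglongrightarrow> w \<odot> (t * t) \<odot> \<psi>" by (rule w)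
    moreover have "t ^ (2 * k + 1) * (t * t) = t ^ (2 * Suc k + 1)" for k
      by (simp only: odd(1) power_Suc2 mult.assoc)
    then have "(\<lambda>k. t ^ (2 * k + 1) \<odot> (t * t) \<odot> \<psi>) = (\<lambda>k. t ^ (2 * Suc k + 1) \<odot> \<psi>)"
      by (simp only: app_simps(7)[symmetric])
    moreover have "(\<lambda>k. t ^ (2 * Suc k + 1) \<odot> \<psi>) \<longlonglongrightarrow> w \<odot> \<psi>" using w[of \<psi>] by (rule LIMSEQ_Suc)
    ultimately show "(w * (t * t)) \<odot> \<psi> = w \<odot> \<psi>" by (metis LIMSEQ_unique app_simps(7))
  qed
  have wtk: "w * (t * t) ^ k = w" for k using wtt by (induction k) (simp_all flip: mult.assoc)
  have ww: "w * w = w * t"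
  proof (rule bop_eqI)
    fix \<psi>
    have "(\<lambda>k. w \<odot> t ^ (2 * k + 1) \<odot> \<psi>) \<longlonglongrightarrow> w \<odot> w \<odot> \<psi>" by (intro tendsto_app w tendsto_const)
    moreover have "w \<odot> t ^ (2 * k + 1) \<odot> \<psi> = (w * t) \<odot> \<psi>" for k
      using wtk[of k] by (simp only: odd(1) app_simps(7)[symmetric] mult.assoc[symmetric])
    ultimately show "(w * w) \<odot> \<psi> = (w * t) \<odot> \<psi>"
      by (simp add: LIMSEQ_const_iff del: app_simps(7)) (simp add: LIMSEQ_const_iff)
  qed
  have www: "w * (w * w) = w" by (metis mult.assoc ww wtt)
  then have wwww: "w * (w * (w * w)) = w * w" by simp
  \<comment> \<open>As \<open>w\<close> equals its cube, these are the projections onto its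
    eigenvalues 1 and -1.\<close>
  define rp where "rp = (1 / 2) *\<^sub>R (w * w + w)"
  define rm where "rm = (1 / 2) *\<^sub>R (w * w - w)"
  have "tr rp \<in> \<nat>"
  proof (rule tr_projection_Nats)
    show "rp * rp = rp" by (simp add: rp_def algebra_simps www wwww scaleR_add_left[symmetric])
    show "col_summable rp"
      using col_summable_mult_left[OF cw, of "(1 / 2) *\<^sub>R (w + 1)"] by (simp add: rp_def algebra_simps)
  qed (simp add: rp_def adj_w)
  moreover have "tr rm \<in> \<nat>"
  proof (rule tr_projection_Nats)
    show "rm * rm = rm" by (simp add: rm_def algebra_simps www wwww scaleR_add_left[symmetric])
    show "col_summable rm"
      using col_summable_mult_left[OF cw, of "(1 / 2) *\<^sub>R (w - 1)"] by (simp add: rm_def algebra_simps)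
  qed (simp add: rm_def adj_w)
  moreover have "tr w = tr rp - tr rm"
  proof -
    have "w = rp - rm" by (simp add: rp_def rm_def algebra_simps scaleR_add_left[symmetric])
    moreover have "col_summable rp" "col_summable rm"
      using col_summable_mult_left[OF cw, of "(1 / 2) *\<^sub>R (w + 1)"]
        col_summable_mult_left[OF cw, of "(1 / 2) *\<^sub>R (w - 1)"] by (simp_all add: rp_def rm_def algebra_simps)
    ultimately show ?thesis using tr_diff by metis
  qed
  ultimately show ?thesis using tr_w by (auto simp: t_def Nats_altdef1 intro: Ints_diff)
qed

section \<open>Off-diagonal decay of kernels\<close>

text \<open>The l1 distance splits into the two coordinates: localization near both axes, at the
  same rate, multiplies to decay in the distance from the origin.\<close>

definition dist1 :: "int \<times> int \<Rightarrow> int \<times> int \<Rightarrow> real"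
  where "dist1 m n = \<bar>real_of_int (fst m) - real_of_int (fst n)\<bar> + \<bar>real_of_int (snd m) - real_of_int (snd n)\<bar>"

abbreviation col_weight :: "real \<Rightarrow> real \<Rightarrow> (int \<times> int) bop \<Rightarrow> int \<times> int \<Rightarrow> ennreal"
  where "col_weight \<alpha> b x n \<equiv> \<integral>\<^sup>+m. ennreal (cmod (ent x m n) * exp (\<alpha> * dist1 m n + b)) \<partial>count_space UNIV"

text \<open>A weighted l1 norm of the columns, uniform in the column: \<open>\<alpha>\<close> is the
  rate of off-diagonal decay, while growth of \<open>v\<close> forces localization in the column
  index. In contrast to pointwise exponential bounds it is submultiplicative at a fixed rate, and
  with values in \<open>ennreal\<close> it asks for no summability in advance.\<close>

definition col_bound :: "real \<Rightarrow> (int \<times> int \<Rightarrow> real) \<Rightarrow> real \<Rightarrow> (int \<times> int) bop \<Rightarrow> bool"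
  where "col_bound \<alpha> v K x \<longleftrightarrow> 0 \<le> K \<and> (\<forall>n. col_weight \<alpha> (v n) x n \<le> ennreal K)"

lemma col_boundD:
  "col_bound \<alpha> v K x \<Longrightarrow> col_weight \<alpha> (v n) x n \<le> ennreal K"
  "col_bound \<alpha> v K x \<Longrightarrow> 0 \<le> K" unfolding col_bound_def by blast+

lemma dist1_nonneg [simp]: "0 \<le> dist1 m n"
  by (simp add: dist1_def)

lemma dist1_self [simp]: "dist1 n n = 0"
  by (simp add: dist1_def)

lemma dist1_triangle: "dist1 m n \<le> dist1 m k + dist1 k n"
  unfolding dist1_def by linarith

lemma nn_integral_count_space_summable:
  fixes f :: "'b \<Rightarrow> real"
  assumes "f summable_on UNIV" "\<And>x. 0 \<le> f x"
  shows "(\<integral>\<^sup>+x. ennreal (f x) \<partial>count_space UNIV) = ennreal (infsum f UNIV)"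
proof -
  have "Infinite_Sum.abs_summable_on f UNIV" using assms by simp
  then have "Infinite_Set_Sum.abs_summable_on f UNIV" by (simp only: abs_summable_equivalent)
  then show ?thesis using assms(2) by (simp add: nn_integral_conv_infsetsum infsetsum_infsum)
qed

lemma nn_integral_swap:
  "(\<integral>\<^sup>+x. \<integral>\<^sup>+y. f x y \<partial>count_space UNIV \<partial>count_space UNIV) = (\<integral>\<^sup>+y. \<integral>\<^sup>+x. f x y \<partial>count_space UNIV \<partial>count_space UNIV)"
  using nn_integral_fst_count_space[of "\<lambda>(x, y). f x y"] nn_integral_snd_count_space[of "\<lambda>(x, y). f x y"]
  by simp

lemma ennreal_cmod_ent_mult_le:
  "ennreal (cmod (ent (x * y) m n)) \<le> (\<integral>\<^sup>+k. ennreal (cmod (ent x m k) * cmod (ent y k n)) \<partial>count_space UNIV)"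
proof -
  have "cmod (ent (x * y) m n) = cmod (\<Sum>\<^sub>\<infinity>k. ent x m k * ent y k n)"
    using ent_mult_has_sum[of x m y n] by (simp add: infsumI)
  also have "\<dots> \<le> (\<Sum>\<^sub>\<infinity>k. cmod (ent x m k) * cmod (ent y k n))"
    using norm_infsum_bound[of "\<lambda>k. ent x m k * ent y k n" UNIV] ent_mult_abs_summable[of x m y n]
    by (simp add: norm_mult)
  finally show ?thesis
    by (subst nn_integral_count_space_summable) (auto intro: ent_mult_abs_summable ennreal_leI)
qed

text \<open>The weight of the left factor sits at the intermediate index \<open>k\<close>. Carrying
  it over to \<open>n\<close> costs at most \<open>a * dist1 k n\<close>, which the extra rate
  \<open>a\<close> of the right factor pays for.\<close>

lemma col_bound_mult:
  assumes x: "col_bound \<alpha> v K x" and y: "col_bound (\<alpha> + a) u L y" and \<alpha>: "0 \<le> \<alpha>"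
    and v: "\<And>k n. v n \<le> v k + a * dist1 k n"
  shows "col_bound \<alpha> (\<lambda>n. v n + u n) (K * L) (x * y)"
  unfolding col_bound_def
proof (intro conjI allI)
  show "0 \<le> K * L" using x y by (simp add: col_bound_def)
  fix n
  let ?X = "\<lambda>m k. ennreal (cmod (ent x m k) * exp (\<alpha> * dist1 m k + v k))"
  let ?Y = "\<lambda>k. ennreal (cmod (ent y k n) * exp ((\<alpha> + a) * dist1 k n + u n))"
  have "col_weight \<alpha> (v n + u n) (x * y) n
      \<le> (\<integral>\<^sup>+m. \<integral>\<^sup>+k. ?X m k * ?Y k \<partial>count_space UNIV \<partial>count_space UNIV)"
  proof (rule nn_integral_mono)
    fix m
    let ?w = "exp (\<alpha> * dist1 m n + (v n + u n))"
    have "ennreal (cmod (ent (x * y) m n) * ?w) = ennreal (cmod (ent (x * y) m n)) * ennreal ?w"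
      by (simp add: ennreal_mult)
    also have "\<dots> \<le> (\<integral>\<^sup>+k. ennreal (cmod (ent x m k) * cmod (ent y k n)) \<partial>count_space UNIV) * ennreal ?w"
      by (intro mult_right_mono ennreal_cmod_ent_mult_le) simp
    also have "\<dots> = (\<integral>\<^sup>+k. ennreal (cmod (ent x m k) * cmod (ent y k n)) * ennreal ?w \<partial>count_space UNIV)"
      by (simp add: nn_integral_multc)
    also have "\<dots> \<le> (\<integral>\<^sup>+k. ?X m k * ?Y k \<partial>count_space UNIV)"
    proof (rule nn_integral_mono)
      fix k
      have "\<alpha> * dist1 m n \<le> \<alpha> * (dist1 m k + dist1 k n)" by (intro mult_left_mono dist1_triangle \<alpha>)
      then have "\<alpha> * dist1 m n + (v n + u n) \<le> (\<alpha> * dist1 m k + v k) + ((\<alpha> + a) * dist1 k n + u n)"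
        using v[of n k] by (simp add: algebra_simps)
      then have "?w \<le> exp (\<alpha> * dist1 m k + v k) * exp ((\<alpha> + a) * dist1 k n + u n)"
        unfolding exp_add[symmetric] by simp
      then have "cmod (ent x m k) * cmod (ent y k n) * ?w \<le> cmod (ent x m k) * cmod (ent y k n) *
          (exp (\<alpha> * dist1 m k + v k) * exp ((\<alpha> + a) * dist1 k n + u n))"
        by (intro mult_left_mono) auto
      then show "ennreal (cmod (ent x m k) * cmod (ent y k n)) * ennreal ?w \<le> ?X m k * ?Y k"
        by (simp add: ennreal_mult[symmetric] mult_ac ennreal_leI)
    qed
    finally show "ennreal (cmod (ent (x * y) m n) * ?w) \<le> (\<integral>\<^sup>+k. ?X m k * ?Y k \<partial>count_space UNIV)" .
  qed
  also have "\<dots> = (\<integral>\<^sup>+k. \<integral>\<^sup>+m. ?X m k * ?Y k \<partial>count_space UNIV \<partial>count_space UNIV)"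
    by (rule nn_integral_swap)
  also have "\<dots> = (\<integral>\<^sup>+k. (\<integral>\<^sup>+m. ?X m k \<partial>count_space UNIV) * ?Y k \<partial>count_space UNIV)"
    by (simp add: nn_integral_multc)
  also have "\<dots> \<le> (\<integral>\<^sup>+k. ennreal K * ?Y k \<partial>count_space UNIV)"
    using x by (intro nn_integral_mono mult_right_mono) (auto intro: col_boundD)
  also have "\<dots> = ennreal K * (\<integral>\<^sup>+k. ?Y k \<partial>count_space UNIV)" by (simp add: nn_integral_cmult)
  also have "\<dots> \<le> ennreal K * ennreal L" using y by (intro mult_left_mono) (auto intro: col_boundD)
  also have "\<dots> = ennreal (K * L)" using x y by (simp add: ennreal_mult col_bound_def)
  finally show "col_weight \<alpha> (v n + u n) (x * y) n
      \<le> ennreal (K * L)" .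
qed

lemma col_bound_mult_zero:
  assumes "col_bound \<alpha> (\<lambda>_. 0) K x" "col_bound \<alpha> v L y" "0 \<le> \<alpha>"
  shows "col_bound \<alpha> v (K * L) (x * y)"
  using col_bound_mult[of \<alpha> "\<lambda>_. 0" K x 0 v L y] assms by simp

text \<open>The exchange of decay for localization: giving up the rate \<open>\<beta>\<close> buys
  the weight \<open>w\<close>.\<close>

lemma col_bound_entrywise:
  assumes x: "col_bound (\<alpha> + \<beta>) v K x" and "0 \<le> C"
    and le: "\<And>m n. cmod (ent y m n) \<le> C * exp (\<beta> * dist1 m n - w n) * cmod (ent x m n)"
  shows "col_bound \<alpha> (\<lambda>n. v n + w n) (C * K) y"
  unfolding col_bound_def
proof (intro conjI allI)
  show "0 \<le> C * K" using x \<open>0 \<le> C\<close> by (simp add: col_bound_def)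
  fix n
  have "col_weight \<alpha> (v n + w n) y n
      \<le> (\<integral>\<^sup>+m. ennreal C * ennreal (cmod (ent x m n) * exp ((\<alpha> + \<beta>) * dist1 m n + v n)) \<partial>count_space UNIV)"
  proof (rule nn_integral_mono)
    fix m
    have "cmod (ent y m n) * exp (\<alpha> * dist1 m n + (v n + w n))
        \<le> (C * exp (\<beta> * dist1 m n - w n) * cmod (ent x m n)) * exp (\<alpha> * dist1 m n + (v n + w n))"
      by (intro mult_right_mono le) simp
    also have "\<dots> = C * (cmod (ent x m n) * (exp (\<beta> * dist1 m n - w n) * exp (\<alpha> * dist1 m n + (v n + w n))))"
      by (simp add: mult_ac)
    also have "exp (\<beta> * dist1 m n - w n) * exp (\<alpha> * dist1 m n + (v n + w n)) = exp ((\<alpha> + \<beta>) * dist1 m n + v n)"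
      unfolding exp_add[symmetric] by (simp add: algebra_simps)
    finally show "ennreal (cmod (ent y m n) * exp (\<alpha> * dist1 m n + (v n + w n)))
        \<le> ennreal C * ennreal (cmod (ent x m n) * exp ((\<alpha> + \<beta>) * dist1 m n + v n))"
      using \<open>0 \<le> C\<close> by (simp add: ennreal_mult[symmetric] ennreal_leI)
  qed
  also have "\<dots> = ennreal C * col_weight (\<alpha> + \<beta>) (v n) x n" by (simp add: nn_integral_cmult)
  also have "\<dots> \<le> ennreal C * ennreal K" using x by (intro mult_left_mono) (auto intro: col_boundD)
  also have "\<dots> = ennreal (C * K)" using x \<open>0 \<le> C\<close> by (simp add: ennreal_mult col_bound_def)
  finally show "col_weight \<alpha> (v n + w n) y n
      \<le> ennreal (C * K)" .
qed

lemma col_bound_add: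
  assumes x: "col_bound \<alpha> v K x" and y: "col_bound \<alpha> v L y"
  shows "col_bound \<alpha> v (K + L) (x + y)"
  unfolding col_bound_def
proof (intro conjI allI)
  show "0 \<le> K + L" using x y by (simp add: col_bound_def)
  fix n
  have "col_weight \<alpha> (v n) (x + y) n
     \<le> (\<integral>\<^sup>+m. ennreal (cmod (ent x m n) * exp (\<alpha> * dist1 m n + v n)) +
            ennreal (cmod (ent y m n) * exp (\<alpha> * dist1 m n + v n)) \<partial>count_space UNIV)"
    by (rule nn_integral_mono)
      (auto simp: ennreal_plus[symmetric] distrib_right[symmetric] simp del: ennreal_plus
        intro!: ennreal_leI mult_right_mono norm_triangle_ineq)
  also have "\<dots> = col_weight \<alpha> (v n) x n +
      col_weight \<alpha> (v n) y n" by (simp add: nn_integral_add)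
  also have "\<dots> \<le> ennreal K + ennreal L" using x y by (intro add_mono) (auto intro: col_boundD)
  also have "\<dots> = ennreal (K + L)" using x y by (simp add: col_bound_def)
  finally show "col_weight \<alpha> (v n) (x + y) n
     \<le> ennreal (K + L)" .
qed

lemma col_bound_cmult:
  assumes "col_bound \<alpha> v K x" "0 \<le> C" "\<And>m n. cmod (ent y m n) \<le> C * cmod (ent x m n)"
  shows "col_bound \<alpha> v (C * K) y"
  using col_bound_entrywise[of \<alpha> 0 v K x C y "\<lambda>_. 0"] assms by simp

lemma col_bound_mono:
  assumes x: "col_bound \<alpha> v K x" and "\<beta> \<le> \<alpha>" "\<And>n. u n \<le> v n"
  shows "col_bound \<beta> u K x"
  unfolding col_bound_def
proof (intro conjI allI)
  fix n
  have "col_weight \<beta> (u n) x n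
     \<le> col_weight \<alpha> (v n) x n" using assms(2,3) by (intro nn_integral_mono ennreal_leI mult_left_mono)
      (simp_all add: add_mono mult_right_mono del: split_paired_All)
  also have "\<dots> \<le> ennreal K" by (rule col_boundD(1)[OF x])
  finally show "col_weight \<beta> (u n) x n \<le> ennreal K" .
qed (use x in \<open>simp add: col_bound_def\<close>)

text \<open>Norm convergence gives convergence of each entry; after that only sums of nonnegative
  terms are exchanged.\<close>

lemma col_bound_sums:
  assumes f: "f sums x" and bound: "\<And>k. col_bound \<alpha> v (K k) (f k)" and K: "summable K"
  shows "col_bound \<alpha> v (suminf K) x"
  unfolding col_bound_def
proof (intro conjI allI)
  have K0: "0 \<le> K k" for k using bound by (simp add: col_bound_def)
  then show "0 \<le> suminf K" by (intro suminf_nonneg K)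
  fix n
  have ent_le: "ennreal (cmod (ent x m n)) \<le> (\<Sum>k. ennreal (cmod (ent (f k) m n)))" for m
  proof (rule LIMSEQ_le_const2)
    have "(\<lambda>N. \<Sum>k<N. ent (f k) m n) \<longlonglongrightarrow> ent x m n"
      using bounded_linear.sums[OF bounded_linear_ent f, of m n] by (simp add: sums_def)
    then show "(\<lambda>N. ennreal (cmod (\<Sum>k<N. ent (f k) m n))) \<longlonglongrightarrow> ennreal (cmod (ent x m n))"
      by (intro tendsto_ennrealI tendsto_norm)
    have "ennreal (cmod (\<Sum>k<N. ent (f k) m n)) \<le> (\<Sum>k. ennreal (cmod (ent (f k) m n)))" for N
    proof -
      have "ennreal (cmod (\<Sum>k<N. ent (f k) m n)) \<le> (\<Sum>k<N. ennreal (cmod (ent (f k) m n)))"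
        by (subst sum_ennreal) (simp_all add: ennreal_leI norm_sum)
      also have "\<dots> \<le> (\<Sum>k. ennreal (cmod (ent (f k) m n)))" by (intro sum_le_suminf) auto
      finally show ?thesis .
    qed
    then show "\<exists>N. \<forall>k\<ge>N. ennreal (cmod (\<Sum>j<k. ent (f j) m n)) \<le> (\<Sum>k. ennreal (cmod (ent (f k) m n)))"
      by blast
  qed
  have "col_weight \<alpha> (v n) x n
     \<le> (\<integral>\<^sup>+m. (\<Sum>k. ennreal (cmod (ent (f k) m n) * exp (\<alpha> * dist1 m n + v n))) \<partial>count_space UNIV)"
  proof (rule nn_integral_mono)
    fix m
    have "ennreal (cmod (ent x m n) * exp (\<alpha> * dist1 m n + v n)) \<le>
        (\<Sum>k. ennreal (cmod (ent (f k) m n))) * ennreal (exp (\<alpha> * dist1 m n + v n))"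
      using ent_le[of m] by (simp add: ennreal_mult mult_right_mono)
    also have "\<dots> = (\<Sum>k. ennreal (cmod (ent (f k) m n) * exp (\<alpha> * dist1 m n + v n)))"
      unfolding ennreal_suminf_multc[symmetric] by (simp add: ennreal_mult)
    finally show "ennreal (cmod (ent x m n) * exp (\<alpha> * dist1 m n + v n)) \<le> \<dots>" .
  qed
  also have "\<dots> = (\<Sum>k. \<integral>\<^sup>+m. ennreal (cmod (ent (f k) m n) * exp (\<alpha> * dist1 m n + v n)) \<partial>count_space UNIV)"
    by (rule nn_integral_suminf) simp
  also have "\<dots> \<le> (\<Sum>k. ennreal (K k))" using bound by (intro suminf_le) (auto intro: col_boundD)
  also have "\<dots> = ennreal (suminf K)" by (rule suminf_ennreal2) (auto intro: K0 K)
  finally show "col_weight \<alpha> (v n) x n \<le> ennreal (suminf K)" .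
qed

lemma col_bound_diagonal:
  assumes "\<And>m n. m \<noteq> n \<Longrightarrow> ent x m n = 0" "\<And>n. cmod (ent x n n) * exp (v n) \<le> C"
  shows "col_bound \<alpha> v C x"
  unfolding col_bound_def
proof (intro conjI allI)
  show "0 \<le> C" using order_trans[OF _ assms(2)] by simp
  fix n
  have "col_weight \<alpha> (v n) x n =
      (\<integral>\<^sup>+m. ennreal (cmod (ent x n n) * exp (v n)) * indicator {n} m \<partial>count_space UNIV)"
    by (rule nn_integral_cong) (auto simp: indicator_def assms(1))
  also have "\<dots> = ennreal (cmod (ent x n n) * exp (v n))" by (simp add: nn_integral_cmult_indicator)
  finally show "col_weight \<alpha> (v n) x n \<le> ennreal C" using assms(2)[of n] by (simp add: ennreal_leI)
qed

lemma col_bound_one: "col_bound \<alpha> (\<lambda>_. 0) 1 1"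
  by (rule col_bound_diagonal) (auto simp: ent_one)

lemma ent_diag_eq:
  assumes "\<And>n. \<bar>g n\<bar> \<le> C"
  shows "ent (diag g) m n = (if m = n then complex_of_real (g n) else 0)"
  using ent_diag(1)[where x = 1 and m = m and n = n, OF assms] by (simp add: ent_one)

lemma col_bound_diag:
  assumes "\<And>n. \<bar>g n\<bar> \<le> B" "\<And>n. \<bar>g n\<bar> * exp (v n) \<le> C"
  shows "col_bound \<alpha> v C (diag g)"
  by (rule col_bound_diagonal) (simp_all add: ent_diag_eq[OF assms(1)] assms(2))

section \<open>Exponential sums over the lattice, and from weights to column summability\<close>

lemma summable_on_exp_abs_int:
  assumes "c > 0"
  shows "(\<lambda>i :: int. exp (- c * \<bar>real_of_int i\<bar>)) summable_on UNIV"
proof -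
  have "norm (exp (- c)) < 1" using assms by simp
  then have "(\<lambda>k. exp (- c) ^ k) summable_on UNIV"
    by (intro summable_nonneg_imp_summable_on summable_geometric) auto
  then have geo: "(\<lambda>k :: nat. exp (- c * \<bar>real k\<bar>)) summable_on UNIV"
    by (simp add: exp_of_nat_mult[symmetric] mult.commute)
  have UN: "(UNIV :: int set) = range int \<union> range (\<lambda>k. - int k)"
  proof (intro set_eqI iffI UNIV_I)
    fix i :: int
    show "i \<in> range int \<union> range (\<lambda>k. - int k)" by (cases i rule: int_cases2) auto
  qed
  show ?thesis unfolding UN
    using geo by (intro summable_on_union; subst summable_on_reindex) (auto simp: inj_on_def o_def)
qed

lemma summable_on_exp_dist1:
  assumes "c > 0"
  shows "(\<lambda>m. exp (- c * dist1 m n)) summable_on UNIV"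
proof -
  have 1: "(\<lambda>j. cmod (case (i, j) of (i, j) \<Rightarrow> complex_of_real (exp (- c * \<bar>real_of_int i\<bar>) * exp (- c * \<bar>real_of_int j\<bar>)))) summable_on UNIV" for i :: int
    using summable_on_cmult_right[OF summable_on_exp_abs_int[OF assms], of "exp (- c * \<bar>real_of_int i\<bar>)"]
    by (simp add: norm_mult)
  have "(\<lambda>p. cmod (case p of (i, j) \<Rightarrow> complex_of_real (exp (- c * \<bar>real_of_int i\<bar>) * exp (- c * \<bar>real_of_int j\<bar>)))) summable_on UNIV \<times> UNIV"
    using summable_on_cmult_left[OF summable_on_exp_abs_int[OF assms], of "\<Sum>\<^sub>\<infinity>j::int. exp (- c * \<bar>real_of_int j\<bar>)"] 1
    by (subst Infinite_Sum.abs_summable_on_Sigma_iff) (simp add: norm_mult infsum_cmult_right' infsum_nonneg)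
  then have *: "(\<lambda>p :: int \<times> int. exp (- c * (\<bar>real_of_int (fst p)\<bar> + \<bar>real_of_int (snd p)\<bar>))) summable_on UNIV"
    by (simp add: case_prod_unfold norm_mult exp_add[symmetric] algebra_simps)
  have "bij_betw (\<lambda>m. (fst m - fst n, snd m - snd n)) UNIV (UNIV :: (int \<times> int) set)"
    by (rule bij_betwI[where g = "\<lambda>m. (fst m + fst n, snd m + snd n)"]) auto
  from summable_on_reindex_bij_betw[OF this, of "\<lambda>p. exp (- c * (\<bar>real_of_int (fst p)\<bar> + \<bar>real_of_int (snd p)\<bar>))"] *
  show ?thesis by (simp add: dist1_def)
qed

lemma infsum_exp_dist1:
  "(\<Sum>\<^sub>\<infinity>m. exp (- c * dist1 m n)) = (\<Sum>\<^sub>\<infinity>m. exp (- c * dist1 m (0, 0)))"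
proof -
  have "bij_betw (\<lambda>m. (fst m - fst n, snd m - snd n)) UNIV (UNIV :: (int \<times> int) set)"
    by (rule bij_betwI[where g = "\<lambda>m. (fst m + fst n, snd m + snd n)"]) auto
  from infsum_reindex_bij_betw[OF this, of "\<lambda>p. exp (- c * dist1 p (0, 0))"] show ?thesis
    by (simp add: dist1_def)
qed

text \<open>The difference \<open>c - \<alpha>\<close> of the rates makes the lattice sum converge,
  and translation invariance makes it the same for every column.\<close>

lemma col_bound_exp_decay:
  assumes "\<alpha> < c" "0 \<le> C" and le: "\<And>m n. cmod (ent x m n) \<le> C * exp (- c * dist1 m n)"
  shows "\<exists>K. col_bound \<alpha> (\<lambda>_. 0) K x"
proof -
  define S where "S = (\<Sum>\<^sub>\<infinity>m. exp (- (c - \<alpha>) * dist1 m (0, 0)))"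
  have "0 \<le> S" by (simp add: S_def infsum_nonneg)
  have "col_weight \<alpha> 0 x n \<le> ennreal (C * S)" for n
  proof -
    have "col_weight \<alpha> 0 x n
        \<le> (\<integral>\<^sup>+m. ennreal C * ennreal (exp (- (c - \<alpha>) * dist1 m n)) \<partial>count_space UNIV)"
    proof (rule nn_integral_mono)
      fix m
      have "cmod (ent x m n) * exp (\<alpha> * dist1 m n + 0) \<le> C * exp (- c * dist1 m n) * exp (\<alpha> * dist1 m n + 0)"
        by (intro mult_right_mono le) simp
      also have "\<dots> = C * exp (- (c - \<alpha>) * dist1 m n)"
        by (simp add: mult.assoc exp_add[symmetric] algebra_simps)
      finally show "ennreal (cmod (ent x m n) * exp (\<alpha> * dist1 m n + 0)) \<le> ennreal C * ennreal (exp (- (c - \<alpha>) * dist1 m n))"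
        using \<open>0 \<le> C\<close> by (simp add: ennreal_mult[symmetric] ennreal_leI)
    qed
    also have "\<dots> = ennreal C * ennreal S"
      using summable_on_exp_dist1[of "c - \<alpha>" n] \<open>\<alpha> < c\<close> infsum_exp_dist1[of "c - \<alpha>" n]
      by (simp add: nn_integral_cmult nn_integral_count_space_summable S_def)
    finally show ?thesis using \<open>0 \<le> C\<close> \<open>0 \<le> S\<close> by (simp add: ennreal_mult)
  qed
  then show ?thesis using \<open>0 \<le> C\<close> \<open>0 \<le> S\<close> unfolding col_bound_def by (intro exI[of _ "C * S"]) auto
qed

lemma norm_ell2_le_nn_integral:
  assumes "(\<integral>\<^sup>+m. ennreal (cmod (Rep_ell2 \<psi> m)) \<partial>count_space UNIV) \<le> ennreal K" "0 \<le> K"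
  shows "norm \<psi> \<le> K"
proof -
  have "ennreal ((norm \<psi>)\<^sup>2) = (\<integral>\<^sup>+m. ennreal ((cmod (Rep_ell2 \<psi> m))\<^sup>2) \<partial>count_space UNIV)"
    unfolding norm_ell2_sqr by (rule nn_integral_count_space_summable[symmetric]) simp_all
  \<comment> \<open>One factor of each square is estimated by the norm of \<open>\<psi>\<close>,
    which cancels at the end.\<close>
  also have "\<dots> \<le> (\<integral>\<^sup>+m. ennreal (norm \<psi>) * ennreal (cmod (Rep_ell2 \<psi> m)) \<partial>count_space UNIV)"
    by (intro nn_integral_mono)
      (auto simp: ennreal_mult[symmetric] power2_eq_square intro!: ennreal_leI mult_right_mono cmod_Rep_ell2_le)
  also have "\<dots> \<le> ennreal (norm \<psi>) * ennreal K"
    using assms(1) by (simp add: nn_integral_cmult mult_left_mono)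
  finally have "norm \<psi> * norm \<psi> \<le> K * norm \<psi>"
    using assms(2) by (simp add: ennreal_mult[symmetric] power2_eq_square mult.commute)
  then show ?thesis using assms(2) by (metis mult_right_le_imp_le norm_ge_zero order_le_less)
qed

text \<open>The l1 norm of a column dominates its l2 norm, and the weight turns the uniform bound
  into one that decays from the origin and is summable over the plane.\<close>

lemma col_bound_imp_col_summable:
  assumes x: "col_bound 0 (\<lambda>n. a * dist1 n (0, 0)) K x" and "a > 0"
  shows "col_summable x"
  unfolding col_summable_def
proof (rule summable_on_comparison_test)
  show "(\<lambda>n. K * exp (- a * dist1 n (0, 0))) summable_on UNIV"
    by (intro summable_on_cmult_right summable_on_exp_dist1 \<open>a > 0\<close>)
  fix n
  have "0 \<le> K" using x by (simp add: col_bound_def)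
  let ?e = "exp (- a * dist1 n (0, 0))"
  have "(\<integral>\<^sup>+m. ennreal (cmod (ent x m n)) \<partial>count_space UNIV)
      = (\<integral>\<^sup>+m. ennreal (cmod (ent x m n) * exp (0 * dist1 m n + a * dist1 n (0, 0))) * ennreal ?e \<partial>count_space UNIV)"
    by (rule nn_integral_cong) (simp add: ennreal_mult[symmetric] mult.assoc exp_add[symmetric])
  also have "\<dots> \<le> ennreal K * ennreal ?e"
    using col_boundD(1)[OF x, of n] by (subst nn_integral_multc) (auto intro: mult_right_mono)
  also have "\<dots> = ennreal (K * ?e)" using \<open>0 \<le> K\<close> by (simp add: ennreal_mult)
  finally show "norm (x \<odot> delta n) \<le> K * ?e"
    using \<open>0 \<le> K\<close> by (intro norm_ell2_le_nn_integral) (simp_all add: ent_eq_Rep)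
qed simp

section \<open>Quantization for projections with exponentially decaying kernel\<close>

text \<open>Abstracts from which coordinate \<open>q\<close> is used and from the shape of the step
  inside a strip of half-width \<open>L\<close>. It covers both switch functions and the sharp half
  plane alike.\<close>

definition step_like :: "(int \<times> int \<Rightarrow> real) \<Rightarrow> real \<Rightarrow> (int \<times> int \<Rightarrow> real) \<Rightarrow> bool"
  where "step_like q L g \<longleftrightarrow> (\<forall>m n. \<bar>q m - q n\<bar> \<le> dist1 m n) \<and> (\<forall>n. 0 \<le> g n \<and> g n \<le> 1) \<and>
    (\<forall>n. q n < - L \<longrightarrow> g n = 0) \<and> (\<forall>n. L < q n \<longrightarrow> g n = 1)"

lemma step_likeD:
  assumes "step_like q L g"
  shows "\<bar>q m - q n\<bar> \<le> dist1 m n" "0 \<le> g n" "g n \<le> 1" "\<bar>g n\<bar> \<le> 1"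
    "q n < - L \<Longrightarrow> g n = 0" "L < q n \<Longrightarrow> g n = 1"
  using assms unfolding step_like_def by (blast, blast, blast, metis abs_of_nonneg, blast, blast)

text \<open>If \<open>g m\<close> and \<open>g n\<close> differ, then \<open>m\<close> and
  \<open>n\<close> are not both on the same side beyond the strip, so
  \<open>\<bar>q n\<bar> \<le> L + dist1 m n\<close>; in that range the right-hand side is at least
  1.\<close>

lemma step_like_variation:
  assumes g: "step_like q L g" and "0 \<le> a"
  shows "\<bar>g m - g n\<bar> \<le> exp (a * L) * exp (a * dist1 m n - a * \<bar>q n\<bar>)"
proof (cases "\<bar>q n\<bar> \<le> L + dist1 m n")
  case True
  then have "a * \<bar>q n\<bar> \<le> a * (L + dist1 m n)" using \<open>0 \<le> a\<close> by (rule mult_left_mono)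
  then have "1 \<le> exp (a * L) * exp (a * dist1 m n - a * \<bar>q n\<bar>)"
    unfolding exp_add[symmetric] by (simp add: algebra_simps)
  moreover have "\<bar>g m - g n\<bar> \<le> 1"
    using step_likeD(2,3)[OF g, of m] step_likeD(2,3)[OF g, of n] by linarith
  ultimately show ?thesis by linarith
next
  case False
  have "\<bar>q m - q n\<bar> \<le> dist1 m n" "0 \<le> dist1 m n" using step_likeD(1)[OF g] by auto
  with False have "(q m < - L \<and> q n < - L) \<or> (L < q m \<and> L < q n)" by linarith
  then have "g m = g n" using step_likeD(5,6)[OF g] by metis
  then show ?thesis by simp
qed

lemma step_like_difference:
  assumes g: "step_like q L g" and h: "step_like q L h" and "0 \<le> a"
  shows "\<bar>g n - h n\<bar> \<le> exp (a * L) * exp (- (a * \<bar>q n\<bar>))"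
proof (cases "\<bar>q n\<bar> \<le> L")
  case True
  then have "a * \<bar>q n\<bar> \<le> a * L" using \<open>0 \<le> a\<close> by (rule mult_left_mono)
  then have "1 \<le> exp (a * L) * exp (- (a * \<bar>q n\<bar>))" unfolding exp_add[symmetric] by simp
  moreover have "\<bar>g n - h n\<bar> \<le> 1"
    using step_likeD(2,3)[OF g, of n] step_likeD(2,3)[OF h, of n] by linarith
  ultimately show ?thesis by linarith
next
  case False
  then have "g n = h n" using step_likeD(5,6)[OF g, of n] step_likeD(5,6)[OF h, of n] by fastforce
  then show ?thesis by simp
qed

text \<open>The square of a step is a step of the same half-width, so two steps are being
  compared.\<close>

lemma step_like_sqr:
  assumes g: "step_like q L g" and "0 \<le> a"
  shows "\<bar>g n * g n - g n\<bar> \<le> exp (a * L) * exp (- (a * \<bar>q n\<bar>))"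
proof -
  have "step_like q L (\<lambda>n. g n * g n)" using g unfolding step_like_def by (auto intro: mult_le_one)
  from step_like_difference[OF this g \<open>0 \<le> a\<close>] show ?thesis by simp
qed

lemma col_bound_multiplier:
  assumes "col_bound (\<alpha> + a) u K x" "0 \<le> C"
    and "\<And>m n. ent y m n = complex_of_real (k m n) * ent x m n"
    and "\<And>m n. \<bar>k m n\<bar> \<le> C * exp (a * dist1 m n - w n)"
  shows "col_bound \<alpha> (\<lambda>n. u n + w n) (C * K) y"
  by (rule col_bound_entrywise[OF assms(1,2)]) (simp add: assms(3,4) norm_mult mult_right_mono)

text \<open>The commutator multiplies each entry by \<open>g m - g n\<close>. Away from the strip
  this is nonzero only for distant \<open>m\<close> and \<open>n\<close>, where the kernel is
  small.\<close>

lemma col_bound_commutator_step: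
  assumes g: "step_like q L g" and x: "col_bound (\<alpha> + a) u K x" and "0 \<le> a"
  shows "col_bound \<alpha> (\<lambda>n. u n + a * \<bar>q n\<bar>) (exp (a * L) * K) (diag g * x - x * diag g)"
proof (rule col_bound_multiplier[OF x])
  show "ent (diag g * x - x * diag g) m n = complex_of_real (g m - g n) * ent x m n" for m n
    using ent_diag[of g 1 x m n] step_likeD(4)[OF g] by (simp add: algebra_simps)
qed (use step_like_variation[OF g \<open>0 \<le> a\<close>] in auto)

lemma
  assumes g: "step_like q L g" and h: "step_like q L h"
    and x: "col_bound (\<alpha> + a) u K x" and "0 \<le> a"
  shows col_bound_step_difference_left:
      "col_bound \<alpha> (\<lambda>n. u n + a * \<bar>q n\<bar>) (exp (a * L) * K) ((diag g - diag h) * x)"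
    and col_bound_step_difference_right:
      "col_bound \<alpha> (\<lambda>n. u n + a * \<bar>q n\<bar>) (exp (a * L) * K) (x * (diag g - diag h))"
proof -
  have gh: "\<bar>g n\<bar> \<le> 1" "\<bar>h n\<bar> \<le> 1" for n using step_likeD(4)[OF g] step_likeD(4)[OF h] by auto
  have le: "\<bar>g k - h k\<bar> \<le> exp (a * L) * exp (a * d - a * \<bar>q n\<bar>)" if "\<bar>q n\<bar> \<le> \<bar>q k\<bar> + d" for k n d
  proof -
    have "a * \<bar>q n\<bar> \<le> a * (\<bar>q k\<bar> + d)" using that \<open>0 \<le> a\<close> by (rule mult_left_mono)
    then have "exp (a * L) * exp (- (a * \<bar>q k\<bar>)) \<le> exp (a * L) * exp (a * d - a * \<bar>q n\<bar>)"
      by (intro mult_left_mono) (simp_all add: algebra_simps)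
    with step_like_difference[OF g h \<open>0 \<le> a\<close>, of k] show ?thesis by linarith
  qed
  show "col_bound \<alpha> (\<lambda>n. u n + a * \<bar>q n\<bar>) (exp (a * L) * K) ((diag g - diag h) * x)"
  proof (rule col_bound_multiplier[OF x])
    show "ent ((diag g - diag h) * x) m n = complex_of_real (g m - h m) * ent x m n" for m n
      using ent_diag(1)[of g 1 x m n, OF gh(1)] ent_diag(1)[of h 1 x m n, OF gh(2)] by (simp add: algebra_simps)
    show "\<bar>g m - h m\<bar> \<le> exp (a * L) * exp (a * dist1 m n - a * \<bar>q n\<bar>)" for m n
      using step_likeD(1)[OF g, of m n] by (intro le) linarith
  qed simp
  show "col_bound \<alpha> (\<lambda>n. u n + a * \<bar>q n\<bar>) (exp (a * L) * K) (x * (diag g - diag h))"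
  proof (rule col_bound_multiplier[OF x])
    show "ent (x * (diag g - diag h)) m n = complex_of_real (g n - h n) * ent x m n" for m n
      using ent_diag(2)[of g 1 x m n, OF gh(1)] ent_diag(2)[of h 1 x m n, OF gh(2)] by (simp add: algebra_simps)
    show "\<bar>g n - h n\<bar> \<le> exp (a * L) * exp (a * dist1 m n - a * \<bar>q n\<bar>)" for m n by (intro le) simp
  qed simp
qed

lemma col_bound_le: "col_bound \<alpha> v K x \<Longrightarrow> K \<le> L \<Longrightarrow> col_bound \<alpha> v L x"
  unfolding col_bound_def by (meson ennreal_leI order_trans)

text \<open>The crude constant is harmless against the factorials of the exponential series.\<close>

lemma col_bound_geometric_sum:
  assumes "col_bound \<alpha> (\<lambda>_. 0) K x" "0 \<le> \<alpha>"
  shows "col_bound \<alpha> (\<lambda>_. 0) ((1 + K) ^ k) (\<Sum>j<k. x ^ j)"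
proof (induction k)
  case 0
  then show ?case by (simp add: col_bound_def)
next
  case (Suc k)
  have K: "0 \<le> K" by (rule col_boundD(2)[OF assms(1)])
  have "(\<Sum>j<Suc k. x ^ j) = 1 + x * (\<Sum>j<k. x ^ j)"
    by (subst sum.lessThan_Suc_shift) (simp add: sum_distrib_left)
  moreover have "col_bound \<alpha> (\<lambda>_. 0) (1 + K * (1 + K) ^ k) (1 + x * (\<Sum>j<k. x ^ j))"
    by (intro col_bound_add col_bound_one col_bound_mult_zero assms Suc.IH)
  moreover have "1 + K * (1 + K) ^ k \<le> (1 + K) ^ Suc k"
    using K one_le_power[of "1 + K" k] by (simp add: algebra_simps)
  ultimately show ?case using col_bound_le by metis
qed

text \<open>
  As \<open>e\<^bsup>2\<pi>i\<^esup> = 1\<close>, the exponential series of \<open>2\<pi>i A\<close> may be summed with \<open>A\<^sup>k - A\<close> in place of \<open>A\<^sup>k\<close>, and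
  these are left multiples of \<open>A\<^sup>2 - A\<close>; so \<open>e\<^bsup>2\<pi>iA\<^esup> - 1\<close> is localized where \<open>A\<close> fails to be a projection.
\<close>

lemma col_bound_exp_minus_one:
  assumes A: "col_bound \<alpha> (\<lambda>_. 0) K A" and AA: "col_bound \<alpha> v M (A * A - A)" and "0 \<le> \<alpha>"
  shows "\<exists>K'. col_bound \<alpha> v K' (exp (cop (2 * pi * \<i>) * A) - 1)"
proof -
  define c where "c = 2 * complex_of_real pi * \<i>"
  define b where "b k = c ^ Suc k /\<^sub>R fact (Suc k)" for k
  define f where "f k = cop (b k) * (A ^ Suc k - A)" for k
  have K: "0 \<le> K" "0 \<le> M" using col_boundD(2) A AA by blast+
  have "(\<lambda>k. (cop c * A) ^ k /\<^sub>R fact k) sums exp (cop c * A)" by (rule exp_converges)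
  then have "(\<lambda>k. (cop c * A) ^ Suc k /\<^sub>R fact (Suc k)) sums (exp (cop c * A) - 1)"
    by (subst sums_Suc_iff) simp
  moreover have "(cop c * A) ^ k = cop (c ^ k) * A ^ k" for k
  proof (induction k)
    case (Suc k)
    have "(cop c * A) ^ Suc k = cop c * (A * cop (c ^ k)) * A ^ k"
      by (simp only: power_Suc Suc.IH mult.assoc)
    also have "\<dots> = cop (c ^ Suc k) * A ^ Suc k"
      unfolding cop_commute[symmetric] by (simp only: power_Suc cop_simps(4) mult.assoc)
    finally show ?case .
  qed (simp add: cop_simps)
  ultimately have 1: "(\<lambda>k. cop (b k) * A ^ Suc k) sums (exp (cop c * A) - 1)"
    by (simp add: b_def linear_scale[OF bounded_linear.linear[OF bounded_linear_cop]] del: power_Suc fact_Suc)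
  have "(\<lambda>k. c ^ k /\<^sub>R fact k) sums exp c" by (rule exp_converges)
  then have "b sums (exp c - 1)" unfolding b_def by (subst sums_Suc_iff) simp
  then have "b sums 0" by (simp add: c_def)
  then have "(\<lambda>k. cop (b k) * A) sums (cop 0 * A)"
    by (intro sums_mult2 bounded_linear.sums[OF bounded_linear_cop])
  from sums_diff[OF 1 this] have f: "f sums (exp (cop c * A) - 1)"
    by (simp add: f_def[abs_def] right_diff_distrib cop_simps)
  define N where "N k = cmod c * M * ((cmod c * (1 + K)) ^ k /\<^sub>R fact k)" for k
  have bound: "col_bound \<alpha> v (N k) (f k)" for k
  proof -
    have "A ^ Suc k - A = (\<Sum>j<k. A ^ j) * (A * A - A)"
    proof (induction k)
      case (Suc k)
      have "A ^ Suc (Suc k) - A = A ^ k * (A * A - A) + (A ^ Suc k - A)"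
        by (simp add: power_Suc2 right_diff_distrib mult.assoc del: power_Suc)
      then show ?case by (simp only: Suc.IH sum.lessThan_Suc distrib_right add.commute)
    qed simp
    then have "col_bound \<alpha> v ((1 + K) ^ k * M) (A ^ Suc k - A)"
      using col_bound_mult_zero[OF col_bound_geometric_sum[OF A \<open>0 \<le> \<alpha>\<close>] AA \<open>0 \<le> \<alpha>\<close>] by simp
    then have "col_bound \<alpha> v (cmod (b k) * ((1 + K) ^ k * M)) (f k)"
      by (rule col_bound_cmult) (simp_all add: f_def norm_mult del: ent_simps)
    moreover have "cmod (b k) \<le> cmod c ^ Suc k / fact k"
    proof -
      have "cmod (b k) = cmod c ^ Suc k / fact (Suc k)"
        by (simp add: b_def norm_power norm_mult divide_inverse mult.commute del: fact_Suc)
      also have "\<dots> \<le> cmod c ^ Suc k / fact k" by (intro divide_left_mono fact_mono) simp_all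
      finally show ?thesis .
    qed
    then have "cmod (b k) * ((1 + K) ^ k * M) \<le> (cmod c ^ Suc k / fact k) * ((1 + K) ^ k * M)"
      using K by (intro mult_right_mono) auto
    then have "cmod (b k) * ((1 + K) ^ k * M) \<le> N k"
      by (simp add: N_def power_mult_distrib divide_inverse mult_ac)
    ultimately show ?thesis by (rule col_bound_le)
  qed
  have "summable N" unfolding N_def by (intro summable_mult summable_exp_generic)
  from col_bound_sums[OF f bound this] show ?thesis by (auto simp: c_def)
qed

section \<open>Exponentials in the algebra, and the integrality theorem for decaying
  projections\<close>

lemma exp_commutes:
  fixes x y :: "'b :: {real_normed_algebra_1, banach}"
  assumes "x * y = y * x"
  shows "exp x * y = y * exp x"
proof -
  have "(\<lambda>k. (x ^ k /\<^sub>R fact k) * y) sums (exp x * y)" by (intro sums_mult2 exp_converges)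
  moreover have "(\<lambda>k. (x ^ k /\<^sub>R fact k) * y) = (\<lambda>k. y * (x ^ k /\<^sub>R fact k))"
    using power_commuting_commutes[OF assms] by simp
  moreover have "(\<lambda>k. y * (x ^ k /\<^sub>R fact k)) sums (y * exp x)" by (intro sums_mult exp_converges)
  ultimately show ?thesis by (metis sums_unique2)
qed

text \<open>Only the constant term of the series survives; with \<open>y = 1 - p\<close> this says
  that \<open>U\<close> is trivial off the range of \<open>p\<close>.\<close>

lemma exp_mult_annihilated:
  fixes x y :: "'b :: {real_normed_algebra_1, banach}"
  assumes "x * y = 0"
  shows "exp x * y = y"
proof -
  have "(\<lambda>k. (x ^ k /\<^sub>R fact k) * y) sums (exp x * y)" by (intro sums_mult2 exp_converges)
  moreover have "(\<lambda>k. (x ^ k /\<^sub>R fact k) * y) = (\<lambda>k. if k = 0 then y else 0)"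
  proof
    fix k
    show "(x ^ k /\<^sub>R fact k) * y = (if k = 0 then y else 0)"
      by (cases k) (simp_all add: power_commutes[symmetric] mult.assoc assms)
  qed
  moreover have "(\<lambda>k. if k = 0 then y else 0) sums y" by (rule sums_single[of 0 "\<lambda>_. y"])
  ultimately show ?thesis by (metis sums_unique2)
qed

text \<open>One \<open>a\<close> of the rate of \<open>p\<close> converts decay into localization
  near a coordinate axis. The other carries the weight of a left factor across a product, or buys
  localization near the second axis. Once both weights are present they add up to
  \<open>a * dist1 n (0, 0)\<close>.\<close>

lemma
  fixes p :: "(int \<times> int) bop"
  assumes p: "adj p = p" "p * p = p" and "a > 0" and bound_p: "col_bound (2 * a) (\<lambda>_. 0) K p"
    and g1: "step_like (\<lambda>n. real_of_int (fst n)) L g1" and g2: "step_like (\<lambda>n. real_of_int (snd n)) L g2"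
  defines "A \<equiv> p * diag g1 * p" and "B \<equiv> p * diag g2 * p"
  shows col_summable_hall: "col_summable (A * B - B * A)"
    and tr_hall_Ints: "2 * pi * \<i> * tr (A * B - B * A) \<in> \<int>"
proof -
  define lx ly where "lx = diag g1" and "ly = diag g2"
  define v1 v2 where "v1 n = a * \<bar>real_of_int (fst n)\<bar>" and "v2 n = a * \<bar>real_of_int (snd n)\<bar>" for n :: "int \<times> int"
  have [simp]: "0 \<le> a" using \<open>a > 0\<close> by simp
  have v12: "(\<lambda>n. v1 n + v2 n) = (\<lambda>n. a * dist1 n (0, 0))" "(\<lambda>n. v2 n + v1 n) = (\<lambda>n. a * dist1 n (0, 0))"
    by (simp_all add: v1_def v2_def dist1_def fun_eq_iff algebra_simps)
  have lip1: "v1 n \<le> v1 k + a * dist1 k n" for k n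
    using mult_left_mono[of "\<bar>real_of_int (fst n)\<bar>" "\<bar>real_of_int (fst k)\<bar> + dist1 k n" a] step_likeD(1)[OF g1, of k n]
    by (simp add: v1_def distrib_left)
  have lip2: "v2 n \<le> v2 k + a * dist1 k n" for k n
    using mult_left_mono[of "\<bar>real_of_int (snd n)\<bar>" "\<bar>real_of_int (snd k)\<bar> + dist1 k n" a] step_likeD(1)[OF g2, of k n]
    by (simp add: v2_def distrib_left)
  have pp: "p * (p * z) = p * z" for z using p(2) by (metis mult.assoc)
  have adj_l: "adj lx = lx" "adj ly = ly"
    unfolding lx_def ly_def using adj_diag step_likeD(4)[OF g1] step_likeD(4)[OF g2] by blast+
  have lxly: "lx * ly = ly * lx" unfolding lx_def ly_def
    by (rule bop_ent_eqI) (simp add: ent_diag[OF step_likeD(4)[OF g1]] ent_diag[OF step_likeD(4)[OF g2]]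
        ent_diag_eq[OF step_likeD(4)[OF g1]] ent_diag_eq[OF step_likeD(4)[OF g2]])
  define X Y where "X = lx * p - p * lx" and "Y = ly * p - p * ly"
  have p2: "col_bound (a + a) (\<lambda>_. 0) K p" using bound_p by (simp only: mult_2)
  have X: "col_bound a v1 (exp (a * L) * K) X"
    using col_bound_commutator_step[OF g1 p2] by (simp add: X_def lx_def v1_def[abs_def])
  have Y: "col_bound a v2 (exp (a * L) * K) Y"
    using col_bound_commutator_step[OF g2 p2] by (simp add: Y_def ly_def v2_def[abs_def])
  have X0: "col_bound 0 v1 (exp (a * L) * K) X" and Y0: "col_bound 0 v2 (exp (a * L) * K) Y"
    by (rule col_bound_mono[OF X] col_bound_mono[OF Y]; simp)+
  \<comment> \<open>Rate 0 is enough for the left factor, while the right one keeps rate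
    \<open>a\<close> to transport the weight \<open>v1\<close>.\<close>
  have "col_summable (X * Y)"
    using col_bound_mult[OF X0, of a v2, OF _ _ lip1] Y v12 col_bound_imp_col_summable[OF _ \<open>a > 0\<close>] by fastforce
  moreover have "col_summable (Y * X)"
    using col_bound_mult[OF Y0, of a v1, OF _ _ lip2] X v12 col_bound_imp_col_summable[OF _ \<open>a > 0\<close>] by fastforce
  ultimately have "col_summable (p * (X * Y - Y * X))"
    by (intro col_summable_mult_left[of _ p] col_summable_diff)
  \<comment> \<open>The two sides differ by \<open>p * (ly * lx - lx * ly) * p\<close>, which
    vanishes because multiplication operators commute.\<close>
  moreover have comm: "A * B - B * A = p * (X * Y - Y * X)"
  proof -
    have "A * B - B * A = p * lx * p * ly * p - p * ly * p * lx * p"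
      by (simp add: A_def B_def lx_def ly_def mult.assoc pp)
    moreover have "p * (X * Y - Y * X) = (p * lx * p * ly * p - p * ly * p * lx * p) + p * (ly * lx - lx * ly) * p"
      by (simp add: X_def Y_def algebra_simps pp)
    ultimately show ?thesis by (simp add: lxly)
  qed
  ultimately show cs_hall: "col_summable (A * B - B * A)" by simp

  have bound_pa: "col_bound a (\<lambda>_. 0) K p" by (rule col_bound_mono[OF bound_p]) simp_all
  have l1: "col_bound \<alpha> (\<lambda>_. 0) 1 lx" for \<alpha>
    unfolding lx_def by (rule col_bound_diag) (use step_likeD(4)[OF g1] in \<open>simp_all del: split_paired_All\<close>)
  have bound_A: "col_bound a (\<lambda>_. 0) (K * 1 * K) A"
    unfolding A_def lx_def[symmetric] by (intro col_bound_mult_zero bound_pa l1) simp_all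
  \<comment> \<open>Two sources of defect: \<open>lx * lx - lx\<close>, nonzero only inside the
    strip where the step is not sharp, and the commutator \<open>X\<close>. Both are localized near
    the axis where the first coordinate vanishes.\<close>
  have "\<exists>M. col_bound a v1 M (A * A - A)"
  proof -
    have 1: "diag (\<lambda>n. g1 n * g1 n - g1 n) = lx * lx - lx"
    proof (rule bop_ent_eqI)
      have *: "\<bar>g1 n * g1 n - g1 n\<bar> \<le> 1" for n
        using step_likeD(2,3)[OF g1, of n] mult_left_le[OF step_likeD(3,2)[OF g1], of n n] zero_le_square[of "g1 n"]
        by linarith
      show "ent (diag (\<lambda>n. g1 n * g1 n - g1 n)) m n = ent (lx * lx - lx) m n" for m n unfolding lx_def
        by (simp add: ent_diag_eq[OF *] ent_diag(1)[OF step_likeD(4)[OF g1]] ent_diag_eq[OF step_likeD(4)[OF g1]])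
    qed
    have 2: "col_bound a v1 (exp (a * L)) (lx * lx - lx)" unfolding 1[symmetric]
    proof (rule col_bound_diag)
      fix n
      show "\<bar>g1 n * g1 n - g1 n\<bar> \<le> exp (0 * L) * exp 0" using step_like_sqr[OF g1, of 0 n] by simp
      have "\<bar>g1 n * g1 n - g1 n\<bar> * exp (v1 n) \<le> (exp (a * L) * exp (- v1 n)) * exp (v1 n)"
        using step_like_sqr[OF g1, of a n] by (intro mult_right_mono) (simp_all add: v1_def)
      also have "\<dots> = exp (a * L)" by (simp add: mult.assoc exp_add[symmetric])
      finally show "\<bar>g1 n * g1 n - g1 n\<bar> * exp (v1 n) \<le> exp (a * L)" .
    qed
    have lp: "col_bound (a + a) (\<lambda>_. 0) (1 * K) (lx * p)" by (intro col_bound_mult_zero l1 p2) simp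
    have "col_bound a (\<lambda>n. v1 n + 0) ((K * exp (a * L)) * K) ((p * (lx * lx - lx)) * p)"
      by (rule col_bound_mult[OF col_bound_mult_zero[OF bound_pa 2] p2]) (simp_all add: lip1)
    moreover have "col_bound a (\<lambda>n. v1 n + 0) ((K * (exp (a * L) * K)) * (1 * K)) ((p * X) * (lx * p))"
      by (rule col_bound_mult[OF col_bound_mult_zero[OF bound_pa X] lp]) (simp_all add: lip1)
    moreover have "A * A - A = (p * (lx * lx - lx)) * p + (p * X) * (lx * p)"
      by (simp add: A_def lx_def[symmetric] X_def algebra_simps pp)
    ultimately show ?thesis using col_bound_add by fastforce
  qed
  then obtain M where "col_bound a v1 M (A * A - A)" by blast
  define x where "x = cop (2 * pi * \<i>) * A"
  define U V u where "U = exp x" and "V = exp (- x)" and "u = U - 1"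
  obtain K' where u: "col_bound a v1 K' u"
    using col_bound_exp_minus_one[OF bound_A \<open>col_bound a v1 M (A * A - A)\<close>] by (auto simp: u_def U_def x_def)
  have UV: "U * V = 1" "V * U = 1"
    using exp_minus_inverse[of x] exp_minus_inverse[of "- x"] by (simp_all add: U_def V_def)
  have adj_A: "adj A = A" by (simp add: A_def lx_def[symmetric] adj_l p mult.assoc)
  have "cop (- c) * z = - (cop c * z)" for c and z :: "(int \<times> int) bop" by (simp add: cop_simps)
  \<comment> \<open>Skew-adjointness of \<open>x\<close> makes \<open>U\<close> unitary with adjoint
    \<open>V\<close>, so conjugation by \<open>U\<close> preserves projections.\<close>
  then have "adj x = - x"
    using cop_commute[of "- (2 * complex_of_real pi * \<i>)" A] by (simp add: x_def adj_A)
  then have adj_U: "adj U = V" and adj_V: "adj V = U" by (simp_all add: U_def V_def adj_exp)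
  have Ap: "A * p = A" "p * A = A" by (simp_all add: A_def mult.assoc p pp)
  have xp: "x * p = x" "p * x = x"
    by (simp add: x_def mult.assoc Ap) (metis Ap(2) cop_commute mult.assoc x_def)
  have Up: "U * p = p * U" and Vp: "V * p = p * V"
    unfolding U_def V_def by (rule exp_commutes; simp add: xp)+
  define q where "q = 1 - p"
  have Uq: "U * q = q" and Vq: "V * q = q"
    unfolding U_def V_def q_def by (rule exp_mult_annihilated; simp add: algebra_simps xp)+
  have qV: "q * V = q" using Vp Vq by (simp add: q_def algebra_simps)
  have qq: "q * q = q" by (simp add: q_def algebra_simps p)

  \<comment> \<open>Subtracting 1 does not change commutators, and \<open>u\<close> is already
    localized in the first coordinate; the commutator with a step in the second one then localizes
    in both.\<close>
  have comm_u: "z * U - U * z = z * u - u * z" for z by (simp add: u_def algebra_simps)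
  have cs_step: "col_summable (diag g * U - U * diag g)" if "step_like (\<lambda>n. real_of_int (snd n)) L' g" for g L'
    unfolding comm_u
  proof (rule col_bound_imp_col_summable[OF _ \<open>a > 0\<close>])
    show "col_bound 0 (\<lambda>n. a * dist1 n (0, 0)) (exp (a * L') * K') (diag g * u - u * diag g)"
      using col_bound_commutator_step[OF that, of 0 a v1 K' u] u by (simp add: v12(1)[symmetric] v2_def)
  qed

  \<comment> \<open>A sharp step is needed because the multiplication by \<open>g2\<close> is in
    general no projection.\<close>
  define h where "h n = (if snd n \<ge> 0 then 1 else 0 :: real)" for n :: "int \<times> int"
  define e where "e = diag h"
  \<comment> \<open>The maximum makes the half-width visibly nonnegative, as the jump of
    \<open>h\<close> at 0 demands; enlarging \<open>L\<close> keeps \<open>g2\<close> a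
    step.\<close>
  define L' where "L' = max L 0"
  have g2': "step_like (\<lambda>n. real_of_int (snd n)) L' g2" and h: "step_like (\<lambda>n. real_of_int (snd n)) L' h"
    using g2 unfolding step_like_def L'_def by (auto simp: h_def)
  have adj_e: "adj e = e" unfolding e_def using adj_diag step_likeD(4)[OF h] by blast
  have ee: "e * e = e" unfolding e_def
    by (rule bop_ent_eqI) (simp add: ent_diag(1)[OF step_likeD(4)[OF h]] ent_diag_eq[OF step_likeD(4)[OF h]] h_def)
  define f where "f = V * e * U"
  have fe: "f - e = V * (e * U - U * e)"
    by (simp add: f_def algebra_simps) (metis UV(2) mult.assoc mult_1)
  have "tr (f - e) \<in> \<int>"
  proof (rule tr_projection_difference_Ints)
    show "f * f = f" by (simp add: f_def mult.assoc) (metis UV(1) ee mult.assoc mult_1)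
    show "col_summable (f - e)"
      unfolding fe unfolding e_def by (intro col_summable_mult_left cs_step[OF h])
  qed (simp_all add: f_def adj_U adj_V adj_e ee mult.assoc)
  moreover have "tr (V * (ly * U - U * ly)) = tr (f - e)"
  proof -
    define D where "D = ly - e"
    \<comment> \<open>\<open>D\<close> lives near the axis where the second coordinate vanishes and
      \<open>u\<close> near the other one, so both products are summable separately, without a
      commutator.\<close>
    have Du: "col_summable (D * u)" and uD: "col_summable (u * D)"
      using col_bound_step_difference_left[OF g2' h, of 0 a v1 K' u] col_bound_step_difference_right[OF g2' h, of 0 a v1 K' u] u
        col_bound_imp_col_summable[OF _ \<open>a > 0\<close>] v12(1)
      by (simp_all add: D_def ly_def e_def v2_def[abs_def])
    have "V * (ly * U - U * ly) = (f - e) + (V * (D * u) - V * (u * D))"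
      unfolding fe D_def by (simp add: u_def algebra_simps)
    moreover have "col_summable (f - e)"
      unfolding fe unfolding e_def by (intro col_summable_mult_left cs_step[OF h])
    ultimately have "tr (V * (ly * U - U * ly)) = tr (f - e) + (tr (V * (D * u)) - tr (V * (u * D)))"
      using Du uD by (simp add: tr_add tr_diff col_summable_diff col_summable_mult_left)
    also have "tr (V * (D * u)) = tr (D * (V * u))"
    proof -
      have "tr (V * (D * u)) = tr (D * u * V)" by (rule tr_commute[OF Du, symmetric])
      also have "u * V = V * u" by (simp add: u_def algebra_simps UV)
      then have "D * u * V = D * (V * u)" by (simp add: mult.assoc)
      finally show ?thesis .
    qed
    also have "tr (D * (V * u)) = tr (V * (u * D))"
    proof -
      \<comment> \<open>\<open>tr_commute\<close> does not apply, since neither \<open>D\<close> nor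
        \<open>V * u\<close> is known to be column summable; but \<open>D\<close> is diagonal, so
        the diagonals agree entry by entry.\<close>
      have "ent (D * z) n n = ent (z * D) n n" for z n
        by (simp add: D_def ly_def e_def algebra_simps ent_diag[OF step_likeD(4)[OF h]] ent_diag[OF step_likeD(4)[OF g2]])
      then show ?thesis by (simp add: tr_def mult.assoc)
    qed
    finally show ?thesis by simp
  qed
  moreover have "tr (V * (B * U - U * B)) = tr (V * (ly * U - U * ly))"
  proof -
    define Z where "Z = V * (ly * U - U * ly)"
    have cs_Z: "col_summable Z" unfolding Z_def ly_def by (intro col_summable_mult_left cs_step[OF g2])
    have Z: "Z = V * ly * U - ly" by (simp add: Z_def algebra_simps) (metis UV(2) mult.assoc mult_1)
    have "V * (B * U - U * B) = V * B * U - B"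
      by (simp add: algebra_simps) (metis UV(2) mult.assoc mult_1)
    also have "V * B * U = p * (V * ly * U) * p"
      unfolding B_def ly_def[symmetric] by (metis Up Vp mult.assoc)
    finally have "V * (B * U - U * B) = p * Z * p" by (simp add: Z B_def ly_def algebra_simps)
    then have "tr (V * (B * U - U * B)) = tr (p * Z * p)" by simp
    also have "\<dots> = tr (p * Z)"
      using tr_commute[OF col_summable_mult_left[OF cs_Z, of p], of p] by (simp add: pp)
    \<comment> \<open>The block \<open>q * Z * q\<close> vanishes because conjugation by
      \<open>U\<close> fixes the part of \<open>ly\<close> compressed to the range of
      \<open>q\<close>.\<close>
    also have "\<dots> = tr (p * Z) + tr (q * Z)"
    proof -
      have "tr (q * Z) = tr (q * Z * q)"
        using tr_commute[OF col_summable_mult_left[OF cs_Z, of q], of q] by (simp add: mult.assoc[symmetric] qq)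
      also have "q * Z * q = (q * V) * ly * (U * q) - q * ly * q" by (simp add: Z algebra_simps)
      also have "\<dots> = 0" by (simp add: qV Uq)
      finally show ?thesis by (simp add: tr_def)
    qed
    also have "\<dots> = tr (p * Z + q * Z)" by (intro tr_add[symmetric] col_summable_mult_left cs_Z)
    also have "p * Z + q * Z = Z" by (simp add: q_def algebra_simps)
    finally show ?thesis by (simp add: Z_def)
  qed
  moreover have "tr (V * (B * U - U * B)) = - (2 * pi * \<i> * tr (A * B - B * A))"
  proof -
    \<comment> \<open>Reversing the order of \<open>A\<close> and \<open>B\<close> is the origin of
      the minus sign.\<close>
    have Bx: "B * x - x * B = cop (2 * pi * \<i>) * - (A * B - B * A)"
      by (simp add: x_def algebra_simps) (metis cop_commute mult.assoc)
    have "tr (V * (B * U - U * B)) = tr (B * x - x * B)" unfolding U_def V_def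
      by (rule tr_exp_commutator) (unfold Bx, intro col_summable_mult_left col_summable_uminus cs_hall)
    then show ?thesis unfolding Bx tr_cop_mult tr_uminus by simp
  qed
  ultimately show "2 * pi * \<i> * tr (A * B - B * A) \<in> \<int>" by (metis Ints_minus minus_minus)
qed

section \<open>Spectral measures\<close>

subsection \<open>Polynomials of an operator\<close>

definition pev :: "real poly \<Rightarrow> 'a bop \<Rightarrow> 'a bop"
  where "pev p h = fold_coeffs (\<lambda>a r. of_real a + h * r) p 0"

lemma pev_0 [simp]: "pev 0 h = 0"
  by (simp add: pev_def)

lemma pev_pCons [simp]: "pev (pCons a p) h = of_real a + h * pev p h"
  by (cases "p = 0 \<and> a = 0") (auto simp: pev_def)

lemma pev_add [simp]: "pev (p + q) h = pev p h + pev q h"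
  by (induction p q rule: poly_induct2) (simp_all add: algebra_simps)

lemma pev_smult [simp]: "pev (smult a p) h = a *\<^sub>R pev p h"
  by (induction p) (simp_all add: algebra_simps of_real_def)

lemma pev_minus [simp]: "pev (- p) h = - pev p h"
  using pev_smult[of "- 1" p h] by simp

lemma pev_diff [simp]: "pev (p - q) h = pev p h - pev q h"
  using pev_add[of p "- q" h] by simp

lemma pev_mult [simp]: "pev (p * q) h = pev p h * pev q h"
proof (induction p)
  case (pCons a p)
  then show ?case by (simp add: mult_pCons_left distrib_right mult.assoc scaleR_conv_of_real)
qed simp

lemma pev_1 [simp]: "pev 1 h = 1"
  by (simp add: one_pCons)

lemma pev_power [simp]: "pev (p ^ n) h = pev p h ^ n"
  by (induction n) simp_all

lemma pev_sum: "pev (\<Sum>i\<in>I. p i) h = (\<Sum>i\<in>I. pev (p i) h)"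
  by (induction I rule: infinite_finite_induct) simp_all

lemma pev_commute: "pev p h * pev q h = pev q h * pev p h"
  by (metis mult.commute pev_mult)

lemma pev_commute_arg: "h * pev p h = pev p h * h"
  using pev_commute[of "[:0, 1:]" h p] by simp

lemma adj_of_real [simp]: "adj (of_real r) = of_real r"
  by (simp add: of_real_def)

lemma adj_pev [simp]: "adj h = h \<Longrightarrow> adj (pev p h) = pev p h"
  by (induction p) (simp_all add: pev_commute_arg)

text \<open>For self-adjoint \<open>x\<close> the form is real and \<open>Re\<close> loses nothing
  (\<open>cinner_self_adjoint\<close>); moments and positivity can then be handled in the
  reals.\<close>

definition qf :: "'a bop \<Rightarrow> 'a ell2 \<Rightarrow> real"
  where "qf x \<psi> = Re (cinner \<psi> (x \<odot> \<psi>))"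

lemma qf_simps [simp]:
  "qf 0 \<psi> = 0" "qf (x + y) \<psi> = qf x \<psi> + qf y \<psi>" "qf (x - y) \<psi> = qf x \<psi> - qf y \<psi>"
  "qf (r *\<^sub>R x) \<psi> = r * qf x \<psi>" "qf 1 \<psi> = (norm \<psi>)\<^sup>2"
  by (simp_all add: qf_def cinner_add_right cinner_diff_right cinner_scaleR_right Re_cinner_self)

lemma qf_of_real_mult [simp]: "qf (of_real a) \<psi> = a * (norm \<psi>)\<^sup>2" "qf (of_real a * x) \<psi> = a * qf x \<psi>"
  by (simp_all add: of_real_def)

lemma qf_scale: "qf x (r *\<^sub>R \<psi>) = r\<^sup>2 * qf x \<psi>"
  by (simp add: qf_def cinner_scaleR_left cinner_scaleR_right power2_eq_square mult.assoc)

lemma qf_sandwich: "adj x = x \<Longrightarrow> qf (x * y * x) \<psi> = qf y (x \<odot> \<psi>)"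
  using cinner_app[of \<psi> x] by (simp add: qf_def)

lemma qf_square: "adj x = x \<Longrightarrow> qf (x * x) \<psi> = (norm (x \<odot> \<psi>))\<^sup>2"
  using qf_sandwich[of x 1 \<psi>] by simp

lemma qf_sum: "qf (\<Sum>i\<in>I. x i) \<psi> = (\<Sum>i\<in>I. qf (x i) \<psi>)"
  by (induction I rule: infinite_finite_induct) simp_all

lemma cinner_self_adjoint: "adj x = x \<Longrightarrow> cinner \<psi> (x \<odot> \<psi>) = complex_of_real (qf x \<psi>)"
  by (metis cinner_app cinner_cnj Reals_cnj_iff of_real_Re qf_def)

lemma abs_qf_le: "\<bar>qf x \<psi>\<bar> \<le> norm x * (norm \<psi>)\<^sup>2"
proof -
  have "\<bar>qf x \<psi>\<bar> \<le> norm \<psi> * norm (x \<odot> \<psi>)"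
    unfolding qf_def by (rule order_trans[OF abs_Re_le_cmod cmod_cinner_le])
  also have "\<dots> \<le> norm \<psi> * (norm x * norm \<psi>)" by (intro mult_left_mono norm_app) simp
  finally show ?thesis by (simp add: power2_eq_square mult_ac)
qed

subsection \<open>Existence\<close>

text \<open>The moment conditions of \<open>spectral_measure\<close>, which settle existence and
  uniqueness; the support in the spectrum is derived in
  \<open>moment_measure_AE_spectrum\<close>.\<close>

definition moment_measure :: "real measure \<Rightarrow> 'a bop \<Rightarrow> 'a ell2 \<Rightarrow> bool"
  where "moment_measure M h \<psi> \<longleftrightarrow> sets M = sets borel \<and> finite_measure M \<and>
    (\<forall>k. integrable M (\<lambda>t. t ^ k) \<and> (LINT t|M. t ^ k) = qf (h ^ k) \<psi>)"

lemma moment_measure_poly: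
  assumes M: "moment_measure M h \<psi>"
  shows "integrable M (poly p)" "(LINT t|M. poly p t) = qf (pev p h) \<psi>"
proof -
  \<comment> \<open>The factor \<open>t ^ j\<close> is a generalization that absorbs the shift of
    coefficients in \<open>pCons\<close>.\<close>
  have "integrable M (\<lambda>t. t ^ j * poly p t) \<and> (LINT t|M. t ^ j * poly p t) = qf (h ^ j * pev p h) \<psi>" for j
  proof (induction p arbitrary: j)
    case (pCons a p)
    have 1: "integrable M (\<lambda>t. t ^ j)" "(LINT t|M. t ^ j) = qf (h ^ j) \<psi>"
      using M by (auto simp: moment_measure_def)
    have 2: "integrable M (\<lambda>t. t ^ Suc j * poly p t)" "(LINT t|M. t ^ Suc j * poly p t) = qf (h ^ Suc j * pev p h) \<psi>"
      using pCons.IH[of "Suc j"] by auto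
    have eq: "(\<lambda>t. t ^ j * poly (pCons a p) t) = (\<lambda>t. a * t ^ j + t ^ Suc j * poly p t)"
      by (simp add: algebra_simps)
    have "h ^ j * pev (pCons a p) h = of_real a * h ^ j + h ^ Suc j * pev p h"
      by (simp add: distrib_left of_real_def) (simp add: mult.assoc[symmetric] power_commutes)
    then show ?case unfolding eq using 1 2 by simp
  qed simp
  from this[of 0] show "integrable M (poly p)" "(LINT t|M. poly p t) = qf (pev p h) \<psi>" by simp_all
qed

text \<open>Squares of \<open>g\<close> and of \<open>f = 1 - g\<close> can be pulled out as
  sandwiches acting on \<open>\<psi>\<close>, which reduces everything to the exponents 0 and
  1.\<close>

lemma qf_bernstein_nonneg:
  assumes g: "adj g = g" and pos: "\<And>\<psi>. 0 \<le> qf g \<psi>" and le1: "\<And>\<psi>. qf g \<psi> \<le> (norm \<psi>)\<^sup>2"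
  shows "0 \<le> qf (g ^ k * (1 - g) ^ l) \<psi>"
proof -
  define f where "f = 1 - g"
  have f: "adj f = f" "\<And>\<psi>. 0 \<le> qf f \<psi>" using g le1 by (simp_all add: f_def)
  have fg: "f * g = g * f" by (simp add: f_def algebra_simps)
  then have comm: "g ^ k * f ^ l * g = g * (g ^ k * f ^ l)" "g ^ k * f ^ l * f = f * (g ^ k * f ^ l)" for k l
    by (metis mult.assoc power_commutes power_commuting_commutes)+
  have pos_gf: "0 \<le> qf (g * f) \<psi>" for \<psi>
  proof -
    \<comment> \<open>Multiply \<open>g * f\<close> by \<open>1 = g + f\<close>: the remaining case
      becomes a sum of two sandwiches.\<close>
    have "g * f = g * f * g + f * g * f" by (simp add: f_def algebra_simps)
    then have "qf (g * f) \<psi> = qf (g * f * g) \<psi> + qf (f * g * f) \<psi>" by (metis qf_simps(2))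
    then show ?thesis unfolding qf_sandwich[OF g] qf_sandwich[OF f(1)] using pos f(2) by simp
  qed
  have step_g: "qf (g ^ Suc (Suc k) * f ^ l) \<psi> = qf (g ^ k * f ^ l) (g \<odot> \<psi>)" for k l \<psi>
    unfolding qf_sandwich[OF g, symmetric] by (simp add: mult.assoc comm(1)[unfolded mult.assoc])
  have step_f: "qf (g ^ k * f ^ Suc (Suc l)) \<psi> = qf (g ^ k * f ^ l) (f \<odot> \<psi>)" for k l \<psi>
    unfolding qf_sandwich[OF f(1), symmetric] mult.assoc[of f] comm(2)[symmetric]
    by (simp add: mult.assoc power_commutes)
  have base: "0 \<le> qf (g ^ k * f ^ l) \<psi>" if "k = 0 \<or> k = 1" for k l \<psi>
    using that by (induction l arbitrary: \<psi> rule: induct_nat_012) (auto simp: pos f(2) pos_gf step_f simp del: power_Suc)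
  have "0 \<le> qf (g ^ k * f ^ l) \<psi>"
  proof (induction k arbitrary: \<psi> rule: induct_nat_012)
    case (ge2 k)
    then show ?case by (simp only: step_g)
  qed (rule base, simp)+
  then show ?thesis by (simp add: f_def)
qed

text \<open>The factorial moments of the binomial distribution. Stated over any commutative ring, so
  that it applies to the polynomial variable and hence to operators.\<close>

lemma bernstein_binomial_moment:
  fixes x :: "'b :: comm_ring_1"
  assumes "j \<le> n"
  shows "(\<Sum>k\<le>n. of_nat (k choose j) * (of_nat (n choose k) * (x ^ k * (1 - x) ^ (n - k)))) = of_nat (n choose j) * x ^ j"
proof -
  have "(\<Sum>k\<le>n. of_nat (k choose j) * (of_nat (n choose k) * (x ^ k * (1 - x) ^ (n - k))))
      = (\<Sum>k\<in>{j..n}. of_nat (k choose j) * (of_nat (n choose k) * (x ^ k * (1 - x) ^ (n - k))))"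
    by (rule sum.mono_neutral_right) (auto simp: not_le binomial_eq_0)
  also have "\<dots> = (\<Sum>i\<le>n - j. of_nat ((i + j) choose j) * (of_nat (n choose (i + j)) * (x ^ (i + j) * (1 - x) ^ (n - (i + j)))))"
    by (rule sum.reindex_bij_witness[of _ "\<lambda>i. i + j" "\<lambda>k. k - j"]) (use assms in auto)
  also have "\<dots> = (\<Sum>i\<le>n - j. of_nat (n choose j) * x ^ j * (of_nat ((n - j) choose i) * x ^ i * (1 - x) ^ (n - j - i)))"
  proof (rule sum.cong)
    fix i assume "i \<in> {..n - j}"
    then have "(n choose (i + j)) * ((i + j) choose j) = (n choose j) * ((n - j) choose i)"
      using choose_mult[of j "i + j" n] assms by simp
    then have "of_nat ((i + j) choose j) * (of_nat (n choose (i + j)) :: 'b) = of_nat (n choose j) * of_nat ((n - j) choose i)"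
      by (metis mult.commute of_nat_mult)
    then show "of_nat ((i + j) choose j) * (of_nat (n choose (i + j)) * (x ^ (i + j) * (1 - x) ^ (n - (i + j))))
        = of_nat (n choose j) * x ^ j * (of_nat ((n - j) choose i) * x ^ i * (1 - x) ^ (n - j - i))"
      by (simp add: power_add mult_ac add.commute) (simp add: mult.assoc[symmetric])
  qed simp
  also have "\<dots> = of_nat (n choose j) * x ^ j * (x + (1 - x)) ^ (n - j)"
    by (simp only: sum_distrib_left[symmetric] binomial_ring)
  finally show ?thesis by simp
qed

text \<open>Turns factorial moments into ordinary ones up to an error of order \<open>1 / n\<close>:
  both sides are products of \<open>j\<close> factors of modulus at most 1, compared factor by
  factor.\<close>

lemma binomial_quotient_approx:
  fixes n k j :: nat
  assumes "k \<le> n" "2 * j < n"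
  shows "\<bar>(real k / real n) ^ j - real (k choose j) / real (n choose j)\<bar> \<le> (real j)\<^sup>2 / (real n - real j)"
proof -
  have "real (k choose j) / real (n choose j) = (\<Prod>i<j. (real k - real i) / (real n - real i))"
    by (simp add: binomial_gbinomial gbinomial_prod_rev prod_dividef lessThan_atLeast0)
  moreover have "(real k / real n) ^ j = (\<Prod>i<j. real k / real n)" by simp
  ultimately have "\<bar>(real k / real n) ^ j - real (k choose j) / real (n choose j)\<bar>
      = norm ((\<Prod>i<j. real k / real n) - (\<Prod>i<j. (real k - real i) / (real n - real i)))" by simp
  also have "\<dots> \<le> (\<Sum>i<j. norm (real k / real n - (real k - real i) / (real n - real i)))"
  proof (rule norm_prod_diff)
    show "norm (real k / real n) \<le> 1" using assms by simp
    fix i assume "i \<in> {..<j}"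
    \<comment> \<open>The numerator may be negative when \<open>k < i\<close>; its modulus is then
      at most \<open>i\<close>, and \<open>2 * j < n\<close> still gives the bound.\<close>
    then have "\<bar>real k - real i\<bar> \<le> real n - real i" "0 < real n - real i" using assms by auto
    then show "norm ((real k - real i) / (real n - real i)) \<le> 1" by (simp add: abs_divide)
  qed
  also have "\<dots> \<le> (\<Sum>i<j. real j / (real n - real j))"
  proof (rule sum_mono)
    fix i assume i: "i \<in> {..<j}"
    have n: "0 < real n" "0 < real n - real i" "0 < real n - real j" using assms i by auto
    have "real k / real n - (real k - real i) / (real n - real i) = real i * (real n - real k) / (real n * (real n - real i))"
      using n by (simp add: field_simps)
    then have "norm (real k / real n - (real k - real i) / (real n - real i)) = real i * (real n - real k) / (real n * (real n - real i))"
      using n assms by (simp add: abs_mult)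
    also have "\<dots> \<le> real i * real n / (real n * (real n - real i))"
      using n by (intro divide_right_mono mult_left_mono) auto
    also have "\<dots> = real i / (real n - real i)" using n by simp
    also have "\<dots> \<le> real j / (real n - real j)" using n i by (intro frac_le) auto
    finally show "norm (real k / real n - (real k - real i) / (real n - real i)) \<le> real j / (real n - real j)" .
  qed
  also have "\<dots> = (real j)\<^sup>2 / (real n - real j)" by (simp add: power2_eq_square)
  finally show ?thesis .
qed

text \<open>
  The Hausdorff moment problem: the Bernstein weights of \<open>\<psi>\<close> placed at \<open>k/n\<close> are probability measures
  on the unit interval whose moments converge to \<open>\<langle>\<psi>, g\<^sup>j \<psi>\<rangle>\<close>; Helly's theorem yields a limit.
\<close>

lemma moment_distribution_unit_interval:
  fixes g :: "'a bop"
  assumes g: "adj g = g" and pos: "\<And>\<psi>. 0 \<le> qf g \<psi>" and le1: "\<And>\<psi>. qf g \<psi> \<le> (norm \<psi>)\<^sup>2"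
    and unit: "norm \<psi> = 1"
  obtains M where "real_distribution M" "\<And>j. (LINT t|M. max 0 (min 1 t) ^ j) = qf (g ^ j) \<psi>"
proof -
  define X where "X = [:0, 1 :: real:]"
  have X: "pev X g = g" by (simp add: X_def)
  \<comment> \<open>Extended by zero beyond \<open>n\<close>, the weights sum to the squared norm of
    \<open>\<psi>\<close>, which is 1, so they form a distribution on the naturals.\<close>
  define w where "w n k = (if k \<le> n then real (n choose k) * qf (g ^ k * (1 - g) ^ (n - k)) \<psi> else 0)" for n k
  have w0: "0 \<le> w n k" for n k using qf_bernstein_nonneg[OF g pos le1] by (simp add: w_def)
  have w_moment: "(\<Sum>k\<le>n. real (k choose j) * w n k) = real (n choose j) * qf (g ^ j) \<psi>" if "j \<le> n" for n j
  proof -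
    have "real (n choose j) * qf (g ^ j) \<psi> = qf (pev (of_nat (n choose j) * X ^ j) g) \<psi>"
      by (simp add: X of_nat_poly scaleR_conv_of_real[symmetric])
    also have "\<dots> = qf (pev (\<Sum>k\<le>n. of_nat (k choose j) * (of_nat (n choose k) * (X ^ k * (1 - X) ^ (n - k)))) g) \<psi>"
      by (simp only: bernstein_binomial_moment[OF that])
    also have "\<dots> = (\<Sum>k\<le>n. real (k choose j) * w n k)" unfolding pev_sum qf_sum
      by (rule sum.cong) (simp_all add: X of_nat_poly scaleR_conv_of_real[symmetric] w_def)
    finally show ?thesis ..
  qed
  have w_sum: "(\<Sum>k\<le>n. w n k) = 1" for n using w_moment[of 0 n] by (simp add: unit)
  have w_prob: "(\<integral>\<^sup>+k. ennreal (w n k) \<partial>count_space UNIV) = 1" for n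
  proof -
    have "(\<Sum>k\<le>n. ennreal (w n k)) = 1" by (simp only: sum_ennreal[OF w0] w_sum ennreal_1)
    then show ?thesis by (subst nn_integral_count_space'[of "{..n}"]) (simp_all, simp add: w_def)
  qed
  define D where "D n = embed_pmf (w n)" for n
  have pmf_D: "pmf (D n) k = w n k" for n k unfolding D_def by (rule pmf_embed_pmf[OF w0 w_prob])
  have set_D: "k \<in> set_pmf (D n) \<Longrightarrow> k \<le> n" for n k
    by (auto simp: set_pmf_iff pmf_D w_def split: if_splits)
  define \<mu> where "\<mu> n = distr (measure_pmf (D n)) borel (\<lambda>k. real k / real n)" for n
  have rd: "real_distribution (\<mu> n)" for n
    unfolding \<mu>_def by (rule prob_space.real_distribution_distr) (auto simp: measure_pmf.prob_space_axioms)
  have "tight \<mu>" unfolding tight_def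
  proof (intro conjI allI impI rd)
    fix \<epsilon> :: real assume "\<epsilon> > 0"
    have "measure (\<mu> n) {-1<..1} = 1" for n
    proof -
      have "measure (\<mu> n) {-1<..1} = measure (measure_pmf (D n)) ((\<lambda>k. real k / real n) -` {-1<..1})"
        by (simp add: \<mu>_def measure_distr)
      also have "\<dots> = 1"
      proof (subst measure_pmf.prob_eq_1)
        show "AE k in D n. k \<in> (\<lambda>k. real k / real n) -` {-1<..1}"
        proof (rule AE_pmfI)
          fix k assume "k \<in> set_pmf (D n)"
          then have "k \<le> n" by (rule set_D)
          moreover have "(-1 :: real) < 0" "0 \<le> real k / real n" by simp_all
          then have "-1 < real k / real n" by linarith
          ultimately show "k \<in> (\<lambda>k. real k / real n) -` {-1<..1}" by (cases "n = 0") simp_all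
        qed
      qed simp
      finally show ?thesis .
    qed
    then show "\<exists>a b. a < b \<and> (\<forall>n. 1 - \<epsilon> < measure (\<mu> n) {a<..b})"
      using \<open>\<epsilon> > 0\<close> by (intro exI[of _ "-1"] exI[of _ 1]) simp
  qed
  from tight_imp_convergent_subsubsequence[OF this strict_mono_id]
  obtain r M where r: "strict_mono r" and M: "real_distribution M" and conv: "weak_conv_m (\<mu> \<circ> id \<circ> r) M"
    by blast
  \<comment> \<open>Weak convergence needs bounded test functions; the truncated power agrees with
    \<open>t ^ j\<close> at all atoms of the Bernstein measures.\<close>
  have "(LINT t|M. max 0 (min 1 t) ^ j) = qf (g ^ j) \<psi>" for j
  proof (rule LIMSEQ_unique)
    show "(\<lambda>n. LINT t|(\<mu> \<circ> id \<circ> r) n. max 0 (min 1 t) ^ j) \<longlonglongrightarrow> (LINT t|M. max 0 (min 1 t) ^ j)"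
    proof (rule weak_conv_imp_integral_bdd_continuous_conv[OF _ M conv])
      show "real_distribution ((\<mu> \<circ> id \<circ> r) n)" for n by (simp add: rd)
      show "norm (max 0 (min 1 t) ^ j) \<le> 1" for t :: real by (simp add: norm_power power_le_one)
    qed (intro continuous_intros)
    have int: "(LINT t|\<mu> n. max 0 (min 1 t) ^ j) = (\<Sum>k\<le>n. (real k / real n) ^ j * w n k)" if "n > 0" for n
    proof -
      have "(LINT t|\<mu> n. max 0 (min 1 t) ^ j) = (LINT k|D n. max 0 (min 1 (real k / real n)) ^ j)"
        unfolding \<mu>_def by (rule integral_distr) measurable
      also have "\<dots> = (\<Sum>k\<le>n. max 0 (min 1 (real k / real n)) ^ j * pmf (D n) k)"
        by (rule integral_measure_pmf_real) (auto dest: set_D)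
      also have "\<dots> = (\<Sum>k\<le>n. (real k / real n) ^ j * w n k)"
        using that by (intro sum.cong) (auto simp: pmf_D)
      finally show ?thesis .
    qed
    have close: "\<bar>(LINT t|\<mu> n. max 0 (min 1 t) ^ j) - qf (g ^ j) \<psi>\<bar> \<le> (real j)\<^sup>2 / (real n - real j)" if n: "2 * j < n" for n
    proof -
      have "qf (g ^ j) \<psi> = (\<Sum>k\<le>n. real (k choose j) / real (n choose j) * w n k)"
        using w_moment[of j n] n by (simp add: sum_divide_distrib[symmetric] field_simps)
      then have "(LINT t|\<mu> n. max 0 (min 1 t) ^ j) - qf (g ^ j) \<psi>
          = (\<Sum>k\<le>n. ((real k / real n) ^ j - real (k choose j) / real (n choose j)) * w n k)"
        using n by (simp add: int left_diff_distrib sum_subtractf)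
      also have "\<bar>\<dots>\<bar> \<le> (\<Sum>k\<le>n. (real j)\<^sup>2 / (real n - real j) * w n k)"
        using binomial_quotient_approx[OF _ n] by (intro order_trans[OF sum_abs] sum_mono)
          (simp add: abs_mult w0 mult_right_mono del: times_divide_eq_left)
      also have "\<dots> = (real j)\<^sup>2 / (real n - real j)"
        by (simp only: sum_distrib_left[symmetric] w_sum mult_1_right)
      finally show ?thesis .
    qed
    have "(\<lambda>n. (LINT t|\<mu> n. max 0 (min 1 t) ^ j) - qf (g ^ j) \<psi>) \<longlonglongrightarrow> 0"
    proof (rule Lim_null_comparison)
      show "\<forall>\<^sub>F n in sequentially. norm ((LINT t|\<mu> n. max 0 (min 1 t) ^ j) - qf (g ^ j) \<psi>) \<le> (real j)\<^sup>2 / (real n - real j)"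
        using close by (auto intro!: eventually_sequentiallyI[of "Suc (2 * j)"])
      have "filterlim (\<lambda>n. real n - real j) at_top sequentially"
        using filterlim_tendsto_add_at_top[OF tendsto_const[of "- real j"] filterlim_real_sequentially] by simp
      then show "(\<lambda>n. (real j)\<^sup>2 / (real n - real j)) \<longlonglongrightarrow> 0"
        by (intro tendsto_divide_0[OF tendsto_const] filterlim_at_top_imp_at_infinity)
    qed
    then have "(\<lambda>n. LINT t|\<mu> n. max 0 (min 1 t) ^ j) \<longlonglongrightarrow> qf (g ^ j) \<psi>" by (simp add: LIM_zero_iff)
    from LIMSEQ_subseq_LIMSEQ[OF this r]
    show "(\<lambda>n. LINT t|(\<mu> \<circ> id \<circ> r) n. max 0 (min 1 t) ^ j) \<longlonglongrightarrow> qf (g ^ j) \<psi>" by (simp add: o_def)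
  qed
  with M show ?thesis using that by blast
qed

text \<open>Reduction to a unit vector and to an operator between 0 and 1 by an affine change of
  variable; afterwards the measure is transported back and its mass scaled to the squared norm of
  \<open>\<psi>\<close>.\<close>

lemma moment_measure_exists:
  fixes h :: "'a bop"
  assumes h: "adj h = h" and "a < b"
    and lower: "\<And>\<psi>. a * (norm \<psi>)\<^sup>2 \<le> qf h \<psi>" and upper: "\<And>\<psi>. qf h \<psi> \<le> b * (norm \<psi>)\<^sup>2"
  obtains M where "moment_measure M h \<psi>" "AE t in M. t \<in> {a..b}"
proof -
  define g where "g = (1 / (b - a)) *\<^sub>R (h - of_real a)"
  have qg: "qf g \<psi> = (qf h \<psi> - a * (norm \<psi>)\<^sup>2) / (b - a)" for \<psi> by (simp add: g_def)
  have g: "adj g = g" "\<And>\<psi>. 0 \<le> qf g \<psi>" "\<And>\<psi>. qf g \<psi> \<le> (norm \<psi>)\<^sup>2"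
  proof -
    show "adj g = g" by (simp add: g_def h)
    fix \<psi>
    show "0 \<le> qf g \<psi>" unfolding qg using \<open>a < b\<close> lower[of \<psi>] by (intro divide_nonneg_pos) simp_all
    have "qf h \<psi> - a * (norm \<psi>)\<^sup>2 \<le> (norm \<psi>)\<^sup>2 * (b - a)" using upper[of \<psi>] by (simp add: algebra_simps)
    then show "qf g \<psi> \<le> (norm \<psi>)\<^sup>2" unfolding qg using \<open>a < b\<close> by (simp add: pos_divide_le_eq)
  qed
  have hg: "h = pev [:a, b - a:] g"
  proof -
    have "(b - a) *\<^sub>R g = h - of_real a" using \<open>a < b\<close> by (simp add: g_def)
    moreover have "pev [:a, b - a:] g = of_real a + (b - a) *\<^sub>R g" by (simp add: of_real_def)
    ultimately show ?thesis by simp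
  qed
  \<comment> \<open>For \<open>\<psi> = 0\<close> any unit vector will do, since the density below
    is then zero.\<close>
  obtain \<psi>0 where \<psi>0: "norm \<psi>0 = 1" "\<psi> = norm \<psi> *\<^sub>R \<psi>0"
  proof (cases "\<psi> = 0")
    case True
    then show ?thesis using that[of "delta undefined"] by simp
  next
    case False
    then show ?thesis using that[of "inverse (norm \<psi>) *\<^sub>R \<psi>"] by simp
  qed
  obtain M0 where M0: "real_distribution M0" and mom: "\<And>j. (LINT t|M0. max 0 (min 1 t) ^ j) = qf (g ^ j) \<psi>0"
    using moment_distribution_unit_interval[OF g \<psi>0(1)] by metis
  interpret M0: real_distribution M0 by (rule M0)
  \<comment> \<open>Pushing forward under the truncation puts the measure on the unit interval and
    turns truncated moments into genuine ones.\<close>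
  define c where "c t = max 0 (min 1 t)" for t :: real
  have c [measurable]: "c \<in> borel_measurable borel" unfolding c_def by measurable
  define M1 where "M1 = distr M0 borel c"
  interpret M1: prob_space M1 unfolding M1_def by (rule M0.prob_space_distr) simp
  have c_range: "c t \<in> {0..1}" for t by (simp add: c_def)
  have "moment_measure M1 g \<psi>0" unfolding moment_measure_def
  proof (intro conjI allI)
    show "finite_measure M1" by (rule M1.finite_measure_axioms)
    fix k
    have "integrable M0 (\<lambda>t. c t ^ k)"
    proof (rule M0.integrable_const_bound[where B = 1])
      show "AE t in M0. norm (c t ^ k) \<le> 1"
        using c_range by (intro AE_I2) (simp add: norm_power power_le_one)
    qed simp
    then show "integrable M1 (\<lambda>t. t ^ k)" unfolding M1_def by (subst integrable_distr_eq) simp_all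
    show "(LINT t|M1. t ^ k) = qf (g ^ k) \<psi>0"
      unfolding M1_def by (subst integral_distr) (simp_all add: mom[symmetric] c_def)
  qed (simp add: M1_def)
  note poly1 = moment_measure_poly[OF this]
  have AE1: "AE t in M1. t \<in> {0..1}" unfolding M1_def by (subst AE_distr_iff) (use c_range in auto)
  define l where "l t = a + (b - a) * t" for t :: real
  have [measurable]: "l \<in> borel_measurable borel" unfolding l_def by measurable
  define M2 where "M2 = distr M1 borel l"
  interpret M2: prob_space M2 unfolding M2_def by (rule M1.prob_space_distr) (simp add: M1_def)
  define M where "M = density M2 (\<lambda>_. ennreal ((norm \<psi>)\<^sup>2))"
  have l_pow: "l t ^ k = poly ([:a, b - a:] ^ k) t" for t k by (simp add: l_def mult.commute)
  have int2: "integrable M2 (\<lambda>t. t ^ k)" "(LINT t|M2. t ^ k) = qf (h ^ k) \<psi>0" for k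
  proof -
    show "integrable M2 (\<lambda>t. t ^ k)" unfolding M2_def using poly1(1)[of "[:a, b - a:] ^ k"]
      by (subst integrable_distr_eq) (simp_all add: M1_def l_pow del: poly_power)
    have "(LINT t|M2. t ^ k) = (LINT t|M1. poly ([:a, b - a:] ^ k) t)"
      unfolding M2_def by (subst integral_distr) (simp_all add: M1_def l_pow del: poly_power)
    then show "(LINT t|M2. t ^ k) = qf (h ^ k) \<psi>0" by (simp only: poly1(2) pev_power hg[symmetric])
  qed
  show ?thesis
  proof (rule that[of M])
    show "moment_measure M h \<psi>" unfolding moment_measure_def
    proof (intro conjI allI)
      show "finite_measure M"
        by (rule finite_measureI) (simp add: M_def emeasure_density M2.emeasure_space_1)
      show "integrable M (\<lambda>t. t ^ k)" for k
        unfolding M_def using int2(1) by (subst integrable_density) (auto simp: M2_def)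
      have "(LINT t|M. t ^ k) = (norm \<psi>)\<^sup>2 * qf (h ^ k) \<psi>0" for k
        unfolding M_def by (subst integral_density) (auto simp: int2 M2_def[symmetric], simp add: M2_def)
      then show "(LINT t|M. t ^ k) = qf (h ^ k) \<psi>" for k by (metis \<psi>0(2) qf_scale)
    qed (simp add: M_def M2_def)
    have "AE t in M2. t \<in> {a..b}" unfolding M2_def
    proof (subst AE_distr_iff)
      show "AE t in M1. l t \<in> {a..b}" using AE1
      proof eventually_elim
        case (elim t)
        then have "(b - a) * t \<le> (b - a) * 1" "0 \<le> (b - a) * t"
          using \<open>a < b\<close> by (auto intro: mult_left_mono)
        then show ?case by (simp add: l_def)
      qed
    qed (simp_all add: M1_def)
    then show "AE t in M. t \<in> {a..b}" unfolding M_def by (subst AE_density) auto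
  qed
qed

subsection \<open>Support and uniqueness\<close>

lemma moment_measureD:
  assumes "moment_measure M h \<psi>"
  shows "sets M = sets borel" "finite_measure M" "space M = UNIV" "measure M UNIV = (norm \<psi>)\<^sup>2"
    "f \<in> borel_measurable borel \<Longrightarrow> f \<in> borel_measurable M"
proof -
  show 1: "sets M = sets borel" "finite_measure M" using assms by (auto simp: moment_measure_def)
  then show sp: "space M = UNIV" using sets_eq_imp_space_eq[OF 1(1)] by simp
  have "(LINT t|M. t ^ 0) = qf (h ^ 0) \<psi>" using assms unfolding moment_measure_def by blast
  then show "measure M UNIV = (norm \<psi>)\<^sup>2" by (simp add: sp)
  show "f \<in> borel_measurable borel \<Longrightarrow> f \<in> borel_measurable M"
    using measurable_cong_sets[OF 1(1) refl] by blast
qed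

lemma moment_measure_integrable_bounded:
  fixes f :: "real \<Rightarrow> real"
  assumes M: "moment_measure M h \<psi>" and f: "f \<in> borel_measurable borel" "\<And>t. \<bar>f t\<bar> \<le> B"
  shows "integrable M f"
  using moment_measureD[OF M] f by (intro finite_measure.integrable_const_bound[where B = B]) auto

text \<open>Markov's inequality for the even moments: for \<open>s > norm h\<close> the mass beyond
  \<open>s\<close> is at most \<open>(norm h / s) ^ (2 * k)\<close> times the squared norm of
  \<open>\<psi>\<close>, for every \<open>k\<close>.\<close>

lemma moment_measure_AE_norm:
  assumes M: "moment_measure M h \<psi>"
  shows "AE t in M. \<bar>t\<bar> \<le> norm h"
proof -
  interpret finite_measure M by (rule moment_measureD(2)[OF M])
  note [measurable_cong] = moment_measureD(1)[OF M]
  have "AE t in M. \<bar>t\<bar> < s" if s: "norm h < s" for s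
  proof -
    have "0 < s" using s norm_ge_zero[of h] by linarith
    define S where "S = {t :: real. s \<le> \<bar>t\<bar>}"
    have S: "S \<in> sets M" unfolding S_def moment_measureD(1)[OF M] by measurable
    have le: "measure M S \<le> ((norm h / s)\<^sup>2) ^ k * (norm \<psi>)\<^sup>2" for k
    proof -
      have "s ^ (2 * k) \<le> t ^ (2 * k)" if "t \<in> S" for t
        using that \<open>0 < s\<close> power_mono[of s "\<bar>t\<bar>" "2 * k"] by (simp add: S_def power_even_abs)
      then have "measure M S \<le> measure M {t \<in> space M. s ^ (2 * k) \<le> t ^ (2 * k)}"
        by (intro finite_measure_mono) (auto simp: moment_measureD(3)[OF M])
      also have "\<dots> \<le> (LINT t|M. t ^ (2 * k)) / s ^ (2 * k)" using M \<open>0 < s\<close> unfolding moment_measure_def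
        by (intro integral_Markov_inequality_measure[of _ _ "{}"]) simp_all
      also have "(LINT t|M. t ^ (2 * k)) = qf (h ^ (2 * k)) \<psi>"
        using M unfolding moment_measure_def by blast
      also have "\<dots> \<le> norm (h ^ (2 * k)) * (norm \<psi>)\<^sup>2" using abs_qf_le[of "h ^ (2 * k)" \<psi>] by linarith
      also have "\<dots> \<le> norm h ^ (2 * k) * (norm \<psi>)\<^sup>2" by (intro mult_right_mono norm_power_ineq) simp
      finally show ?thesis
        using \<open>0 < s\<close> by (simp add: power_mult[symmetric] power_divide divide_right_mono)
    qed
    have "norm h / s < 1" using s \<open>0 < s\<close> by simp
    then have "(norm h / s)\<^sup>2 < 1" using \<open>0 < s\<close> by (intro power_less_one_iff[THEN iffD2]) auto
    then have "(\<lambda>k. ((norm h / s)\<^sup>2) ^ k * (norm \<psi>)\<^sup>2) \<longlonglongrightarrow> 0"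
      by (intro tendsto_mult_left_zero LIMSEQ_realpow_zero) auto
    then have "measure M S \<le> 0" by (rule LIMSEQ_le_const) (use le in blast)
    then have "measure M S = 0" by (simp add: measure_le_0_iff)
    then have "S \<in> null_sets M" using S by (auto simp: null_sets_def emeasure_eq_measure)
    then show ?thesis by (rule AE_I') (auto simp: S_def)
  qed
  then have "AE t in M. \<bar>t\<bar> < norm h + 1 / real (Suc n)" for n by simp
  then have "AE t in M. \<forall>n. \<bar>t\<bar> < norm h + 1 / real (Suc n)" by (simp add: AE_all_countable)
  then show ?thesis
  proof eventually_elim
    case (elim t)
    have "(\<lambda>n. norm h + 1 / real (Suc n)) \<longlonglongrightarrow> norm h + 0"
      by (intro tendsto_intros LIMSEQ_Suc[OF lim_1_over_n])
    then show ?case using elim by (intro LIMSEQ_le_const[where a = "\<bar>t\<bar>"]) (auto intro: less_imp_le)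
  qed
qed

lemma continuous_poly_approximation:
  fixes f :: "real \<Rightarrow> real"
  assumes "continuous_on {-K..K} f" "0 < e"
  obtains p where "\<And>t. \<bar>t\<bar> \<le> K \<Longrightarrow> \<bar>f t - poly p t\<bar> < e"
proof -
  obtain g where g: "real_polynomial_function g" "\<And>t. t \<in> {-K..K} \<Longrightarrow> \<bar>f t - g t\<bar> < e"
    using Stone_Weierstrass_real_polynomial_function[OF compact_Icc assms] by blast
  then obtain a n where "g = (\<lambda>t. \<Sum>i\<le>n. a i * t ^ i)" unfolding real_polynomial_function_iff_sum by blast
  then have "g t = poly (\<Sum>i\<le>n. monom (a i) i) t" for t by (simp add: poly_sum poly_monom)
  with g(2) show ?thesis using that by (metis abs_le_iff atLeastAtMost_iff minus_le_iff)
qed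

lemma moment_measure_integral_close:
  fixes f :: "real \<Rightarrow> real"
  assumes M: "moment_measure M h \<psi>" and f: "f \<in> borel_measurable borel" "\<And>t. \<bar>f t\<bar> \<le> B"
    and p: "AE t in M. \<bar>poly p t - f t\<bar> \<le> e"
  shows "\<bar>qf (pev p h) \<psi> - (LINT t|M. f t)\<bar> \<le> e * (norm \<psi>)\<^sup>2"
proof -
  interpret finite_measure M by (rule moment_measureD(2)[OF M])
  note int = moment_measure_integrable_bounded[OF M f] moment_measure_poly[OF M]
  have "qf (pev p h) \<psi> - (LINT t|M. f t) = (LINT t|M. poly p t - f t)"
    using int by (subst Bochner_Integration.integral_diff) simp_all
  also have "\<bar>\<dots>\<bar> \<le> (LINT t|M. \<bar>poly p t - f t\<bar>)" by (rule integral_abs_bound)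
  also have "\<dots> \<le> (LINT t|M. e)"
    using int by (intro integral_mono_AE p integrable_abs Bochner_Integration.integrable_diff) simp_all
  also have "\<dots> = e * (norm \<psi>)\<^sup>2" using moment_measureD(3,4)[OF M] by simp
  finally show ?thesis .
qed

lemma moment_measure_integral_unique:
  fixes f :: "real \<Rightarrow> real"
  assumes M: "moment_measure M h \<psi>" and N: "moment_measure N h \<psi>"
    and f: "continuous_on UNIV f" "\<And>t. \<bar>f t\<bar> \<le> B"
  shows "(LINT t|M. f t) = (LINT t|N. f t)"
proof -
  have close: "\<bar>qf (pev p h) \<psi> - (LINT t|L. f t)\<bar> \<le> e * (norm \<psi>)\<^sup>2"
    if L: "moment_measure L h \<psi>" and p: "\<And>t. \<bar>t\<bar> \<le> norm h \<Longrightarrow> \<bar>f t - poly p t\<bar> < e" for L p e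
  proof (rule moment_measure_integral_close[OF L borel_measurable_continuous_onI[OF f(1)] f(2)])
    show "AE t in L. \<bar>poly p t - f t\<bar> \<le> e" using moment_measure_AE_norm[OF L]
      by eventually_elim (use p in \<open>simp add: abs_minus_commute less_imp_le\<close>)
  qed
  have "\<bar>(LINT t|M. f t) - (LINT t|N. f t)\<bar> \<le> 0"
  proof (rule field_le_epsilon)
    fix d :: real assume "0 < d"
    \<comment> \<open>The summand 1 keeps the denominator positive when
      \<open>\<psi> = 0\<close>.\<close>
    define e where "e = d / (2 * (norm \<psi>)\<^sup>2 + 1)"
    have "0 < e" using \<open>0 < d\<close> by (simp add: e_def add_nonneg_pos)
    obtain p where "\<And>t. \<bar>t\<bar> \<le> norm h \<Longrightarrow> \<bar>f t - poly p t\<bar> < e"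
      using continuous_poly_approximation[OF continuous_on_subset[OF f(1)] \<open>0 < e\<close>, of "norm h"] by auto
    from close[OF M this] close[OF N this]
    have "\<bar>(LINT t|M. f t) - (LINT t|N. f t)\<bar> \<le> e * (2 * (norm \<psi>)\<^sup>2)" by linarith
    also have "\<dots> \<le> e * (2 * (norm \<psi>)\<^sup>2 + 1)" using \<open>0 < e\<close> by (intro mult_left_mono) auto
    also have "\<dots> = d"
    proof -
      have "0 < 2 * (norm \<psi>)\<^sup>2 + 1" by (simp add: add_nonneg_pos)
      then show ?thesis by (simp add: e_def)
    qed
    finally show "\<bar>(LINT t|M. f t) - (LINT t|N. f t)\<bar> \<le> 0 + d" by simp
  qed
  then show ?thesis by simp
qed

text \<open>Integrals of continuous bounded functions agree by Weierstrass approximation. A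
  continuous ramp between \<open>x\<close> and \<open>y\<close> then compares the distribution
  functions at \<open>x\<close> and \<open>y\<close>, and right continuity removes the gap between
  them.\<close>

lemma moment_measure_unique:
  assumes M: "moment_measure M h \<psi>" and N: "moment_measure N h \<psi>"
  shows "M = N"
proof -
  have fbm: "finite_borel_measure L" if "moment_measure L h \<psi>" for L
    using moment_measureD[OF that] by (simp add: finite_borel_measure_def finite_borel_measure_axioms_def)
  have le: "cdf L x \<le> cdf L' y" if L: "moment_measure L h \<psi>" "moment_measure L' h \<psi>" and "x < y" for L L' x y
  proof -
    have cts: "continuous_on UNIV (cts_step x y)"
      by (rule uniformly_continuous_imp_continuous[OF cts_step_uniformly_continuous[OF \<open>x < y\<close>]])
    have bnd: "\<bar>cts_step x y t\<bar> \<le> 1" for t using \<open>x < y\<close> by (auto simp: cts_step_def)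
    note int = moment_measure_integrable_bounded[OF _ borel_measurable_continuous_onI[OF cts] bnd]
    have ind: "integrable L (indicator {..z} :: real \<Rightarrow> real)" "(LINT t|L. indicator {..z} t) = cdf L z"
      if L: "moment_measure L h \<psi>" for L z
      using moment_measureD(1,3)[OF L] finite_measure.emeasure_finite[OF moment_measureD(2)[OF L]]
      by (auto simp: cdf_def less_top[symmetric] simp del: space_borel intro!: integrable_real_indicator)
    have "cdf L x = (LINT t|L. indicator {..x} t)" by (rule ind(2)[OF L(1), symmetric])
    also have "\<dots> \<le> (LINT t|L. cts_step x y t)"
      using \<open>x < y\<close> by (intro integral_mono ind(1)[OF L(1)] int[OF L(1)]) (auto simp: cts_step_def indicator_def)
    also have "\<dots> = (LINT t|L'. cts_step x y t)" by (rule moment_measure_integral_unique[OF L cts bnd])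
    also have "\<dots> \<le> (LINT t|L'. indicator {..y} t)"
      using \<open>x < y\<close> by (intro integral_mono ind(1)[OF L(2)] int[OF L(2)]) (auto simp: cts_step_def indicator_def)
    also have "\<dots> = cdf L' y" by (rule ind(2)[OF L(2)])
    finally show ?thesis .
  qed
  have le': "cdf L x \<le> cdf L' x" if L: "moment_measure L h \<psi>" "moment_measure L' h \<psi>" for L L' x
  proof (rule tendsto_lowerbound)
    show "(cdf L' \<longlongrightarrow> cdf L' x) (at_right x)"
      using finite_borel_measure.cdf_is_right_cont[OF fbm[OF L(2)], of x] by (simp add: continuous_within)
    show "\<forall>\<^sub>F y in at_right x. cdf L x \<le> cdf L' y"
      using le[OF L] by (auto simp: eventually_at_right_field intro: exI[of _ "x + 1"])
  qed simp
  have "cdf M = cdf N" using le'[OF M N] le'[OF N M] by (intro ext antisym) auto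
  then show ?thesis by (rule cdf_unique'[OF fbm[OF M] fbm[OF N]])
qed

text \<open>A bounded inverse gives \<open>(h - \<nu>)\<^sup>2 \<ge> \<kappa>\<^sup>2\<close> in the
  sense of forms, so the integral of \<open>F\<close>, a square times
  \<open>\<kappa>\<^sup>2 - (t - \<nu>)\<^sup>2\<close>, cannot be positive. The bump
  \<open>g\<close> vanishes where the second factor is negative; hence \<open>F\<close> is
  nonnegative and must be zero almost everywhere.\<close>

lemma moment_measure_resolvent_null:
  assumes h: "adj h = h" and M: "moment_measure M h \<psi>"
    and \<nu>: "complex_of_real \<nu> \<notin> op_spectrum (Rep_bop h)"
  shows "\<exists>\<epsilon>>0. AE t in M. \<epsilon> < \<bar>t - \<nu>\<bar>"
proof -
  interpret finite_measure M by (rule moment_measureD(2)[OF M])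
  obtain B :: "'a ell2 \<Rightarrow>\<^sub>L 'a ell2" where B: "\<And>\<phi>. B (Rep_bop h \<phi> - complex_of_real \<nu> *\<^sub>C \<phi>) = \<phi>"
    using \<nu> by (auto simp: op_spectrum_def)
  define y where "y = h - of_real \<nu>"
  have y: "adj y = y" "y = pev [:- \<nu>, 1:] h" by (simp_all add: y_def h of_real_def)
  \<comment> \<open>The summand 1 makes the denominator positive without discussing whether
    \<open>B\<close> is zero.\<close>
  define \<kappa> where "\<kappa> = 1 / (norm B + 1)"
  have "0 < norm B + 1" using norm_ge_zero[of B] by linarith
  then have \<kappa>: "0 < \<kappa>" by (simp add: \<kappa>_def)
  have lower: "\<kappa>\<^sup>2 * (norm \<phi>)\<^sup>2 \<le> (norm (y \<odot> \<phi>))\<^sup>2" for \<phi>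
  proof -
    have "Rep_bop h \<phi> - complex_of_real \<nu> *\<^sub>C \<phi> = y \<odot> \<phi>"
      by (simp add: y_def app.rep_eq[symmetric] of_real_def scaleR_scaleC)
    then have "norm \<phi> \<le> norm B * norm (y \<odot> \<phi>)" using B[of \<phi>] norm_blinfun[of B "y \<odot> \<phi>"] by simp
    also have "\<dots> \<le> (norm B + 1) * norm (y \<odot> \<phi>)" by (intro mult_right_mono) auto
    finally have "\<kappa> * norm \<phi> \<le> norm (y \<odot> \<phi>)"
      using \<open>0 < norm B + 1\<close> by (simp add: \<kappa>_def divide_le_eq mult.commute)
    then have "(\<kappa> * norm \<phi>)\<^sup>2 \<le> (norm (y \<odot> \<phi>))\<^sup>2" using \<kappa> by (intro power_mono) auto
    then show ?thesis by (simp add: power_mult_distrib)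
  qed
  define g where "g t = max 0 (\<kappa> - \<bar>t - \<nu>\<bar>)" for t
  define F where "F t = (g t)\<^sup>2 * (\<kappa>\<^sup>2 - (t - \<nu>)\<^sup>2)" for t
  have g_cont: "continuous_on A g" for A unfolding g_def by (intro continuous_intros)
  have g_range: "0 \<le> g t" "g t \<le> \<kappa>" for t using \<kappa> by (auto simp: g_def)
  have sq: "(t - \<nu>)\<^sup>2 < \<kappa>\<^sup>2 \<longleftrightarrow> \<bar>t - \<nu>\<bar> < \<kappa>" for t
    using \<kappa> abs_square_less_1[of "(t - \<nu>) / \<kappa>"] by (simp add: power_divide abs_divide divide_simps)
  have F0: "0 \<le> F t" for t using sq[of t] by (cases "\<bar>t - \<nu>\<bar> < \<kappa>") (auto simp: F_def g_def)
  have F_le: "\<bar>F t\<bar> \<le> \<kappa>\<^sup>2 * \<kappa>\<^sup>2" for t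
  proof (cases "\<bar>t - \<nu>\<bar> < \<kappa>")
    case True
    then have "F t \<le> \<kappa>\<^sup>2 * \<kappa>\<^sup>2"
      unfolding F_def using sq[of t] g_range by (intro mult_mono power_mono) auto
    then show ?thesis using F0[of t] by simp
  qed (simp add: F_def g_def)
  have F_meas: "F \<in> borel_measurable borel"
    unfolding F_def by (intro borel_measurable_continuous_onI continuous_intros g_cont)
  define D where "D = \<kappa>\<^sup>2 + (norm h + \<bar>\<nu>\<bar>)\<^sup>2"
  have le: "(LINT t|M. F t) \<le> e * ((1 + 2 * \<kappa>) * D * (norm \<psi>)\<^sup>2)" if e: "0 < e" "e < 1" for e
  proof -
    obtain p where p: "\<And>t. \<bar>t\<bar> \<le> norm h \<Longrightarrow> \<bar>g t - poly p t\<bar> < e"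
      using continuous_poly_approximation[OF g_cont e(1)] by blast
    \<comment> \<open>A polynomial version of \<open>F\<close> with \<open>p\<close> on both sides,
      so that its form at \<open>\<psi>\<close> is that of
      \<open>\<kappa>\<^sup>2 - y\<^sup>2\<close> at \<open>pev p h \<odot> \<psi>\<close>.\<close>
    define P where "P = p * ([:\<kappa>\<^sup>2:] - [:- \<nu>, 1:] * [:- \<nu>, 1:]) * p"
    have "AE t in M. \<bar>poly P t - F t\<bar> \<le> e * (1 + 2 * \<kappa>) * D" using moment_measure_AE_norm[OF M]
    proof eventually_elim
      case (elim t)
      have "\<bar>(t - \<nu>)\<^sup>2\<bar> \<le> (norm h + \<bar>\<nu>\<bar>)\<^sup>2" using elim power_mono[of "\<bar>t - \<nu>\<bar>" "norm h + \<bar>\<nu>\<bar>" 2] by simp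
      then have "\<bar>\<kappa>\<^sup>2 - (t - \<nu>)\<^sup>2\<bar> \<le> D" unfolding D_def using zero_le_power2[of \<kappa>] by linarith
      moreover have "\<bar>(poly p t - g t) * (poly p t + g t)\<bar> \<le> e * (1 + 2 * \<kappa>)"
        unfolding abs_mult using p[OF elim] g_range[of t] e by (intro mult_mono) auto
      ultimately have "\<bar>(poly p t - g t) * (poly p t + g t)\<bar> * \<bar>\<kappa>\<^sup>2 - (t - \<nu>)\<^sup>2\<bar> \<le> e * (1 + 2 * \<kappa>) * D"
        using e \<kappa> by (intro mult_mono) auto
      moreover have "poly P t - F t = (poly p t - g t) * (poly p t + g t) * (\<kappa>\<^sup>2 - (t - \<nu>)\<^sup>2)"
        by (simp add: P_def F_def power2_eq_square algebra_simps)
      ultimately show ?case by (simp add: abs_mult)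
    qed
    then have "\<bar>qf (pev P h) \<psi> - (LINT t|M. F t)\<bar> \<le> e * (1 + 2 * \<kappa>) * D * (norm \<psi>)\<^sup>2"
      by (rule moment_measure_integral_close[OF M F_meas F_le])
    moreover have "qf (pev P h) \<psi> \<le> 0"
    proof -
      have "qf (pev P h) \<psi> = qf (of_real (\<kappa>\<^sup>2) - y * y) (pev p h \<odot> \<psi>)"
        unfolding P_def pev_mult pev_diff y(2)[symmetric] qf_sandwich[OF adj_pev[OF h]] by simp
      also have "\<dots> = \<kappa>\<^sup>2 * (norm (pev p h \<odot> \<psi>))\<^sup>2 - (norm (y \<odot> pev p h \<odot> \<psi>))\<^sup>2"
        by (simp add: qf_square[OF y(1)] del: of_real_power)
      finally show ?thesis using lower[of "pev p h \<odot> \<psi>"] by simp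
    qed
    ultimately show ?thesis by (simp add: mult.assoc)
  qed
  have "(LINT t|M. F t) \<le> 0"
  proof (rule tendsto_lowerbound)
    show "((\<lambda>e. e * ((1 + 2 * \<kappa>) * D * (norm \<psi>)\<^sup>2)) \<longlongrightarrow> 0) (at_right 0)"
      by (intro tendsto_mult_left_zero tendsto_ident_at)
    show "\<forall>\<^sub>F e in at_right 0. (LINT t|M. F t) \<le> e * ((1 + 2 * \<kappa>) * D * (norm \<psi>)\<^sup>2)"
      using le by (auto simp: eventually_at_right_field intro: exI[of _ 1])
  qed simp
  then have "(LINT t|M. F t) = 0" using F0 by (intro antisym Bochner_Integration.integral_nonneg) auto
  then have "AE t in M. F t = 0"
    using integral_nonneg_eq_0_iff_AE[OF moment_measure_integrable_bounded[OF M F_meas F_le]] F0 by simp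
  then have "AE t in M. \<kappa> / 2 < \<bar>t - \<nu>\<bar>"
  proof eventually_elim
    case (elim t)
    then have "\<not> \<bar>t - \<nu>\<bar> < \<kappa>" using sq[of t] by (auto simp: F_def g_def)
    then show ?case using \<kappa> by linarith
  qed
  then show ?thesis using \<kappa> by (intro exI[of _ "\<kappa> / 2"]) simp
qed

text \<open>Every resolvent point has a null neighbourhood; Lindelof's theorem reduces their union
  to a countable one.\<close>

lemma moment_measure_AE_spectrum:
  assumes h: "adj h = h" and M: "moment_measure M h \<psi>"
  shows "AE t in M. complex_of_real t \<in> op_spectrum (Rep_bop h)"
proof -
  define \<rho> where "\<rho> = {t. complex_of_real t \<notin> op_spectrum (Rep_bop h)}"
  have "\<forall>\<nu>\<in>\<rho>. \<exists>\<epsilon>>0. AE t in M. \<epsilon> < \<bar>t - \<nu>\<bar>"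
    using moment_measure_resolvent_null[OF h M] by (auto simp: \<rho>_def)
  then obtain \<epsilon> where \<epsilon>: "\<And>\<nu>. \<nu> \<in> \<rho> \<Longrightarrow> 0 < \<epsilon> \<nu>" "\<And>\<nu>. \<nu> \<in> \<rho> \<Longrightarrow> AE t in M. \<epsilon> \<nu> < \<bar>t - \<nu>\<bar>" by metis
  define \<F> where "\<F> = (\<lambda>\<nu>. ball \<nu> (\<epsilon> \<nu>)) ` \<rho>"
  obtain \<F>' where \<F>': "\<F>' \<subseteq> \<F>" "countable \<F>'" "\<Union>\<F>' = \<Union>\<F>" using Lindelof[of \<F>] by (auto simp: \<F>_def)
  have "AE t in M. t \<notin> U" if U: "U \<in> \<F>'" for U
  proof -
    obtain \<nu> where "\<nu> \<in> \<rho>" "U = ball \<nu> (\<epsilon> \<nu>)" using U \<F>'(1) unfolding \<F>_def by blast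
    then show ?thesis
      using \<epsilon>(2)[of \<nu>] by (auto simp: dist_real_def abs_minus_commute elim!: eventually_mono)
  qed
  then have "AE t in M. \<forall>U\<in>\<F>'. t \<notin> U" using \<F>'(2) by (simp add: AE_ball_countable)
  then show ?thesis
  proof eventually_elim
    case (elim t)
    then have "t \<notin> \<Union>\<F>" using \<F>'(3) by blast
    moreover have "t \<in> ball t (\<epsilon> t)" if "t \<in> \<rho>" using \<epsilon>(1)[OF that] by simp
    ultimately have "t \<notin> \<rho>" by (auto simp: \<F>_def)
    then show ?case by (simp add: \<rho>_def)
  qed
qed

lemma spectral_measure_moment_measure:
  assumes h: "adj h = h"
  shows "moment_measure (spectral_measure (Rep_bop h) \<psi>) h \<psi>"
proof -
  have pow: "(blinfun_apply (Rep_bop h) ^^ k) \<psi> = h ^ k \<odot> \<psi>" for k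
    by (induction k) (simp_all add: app.rep_eq[symmetric])
  have iff: "(sets M = sets borel \<and> finite_measure M \<and> (AE t in M. complex_of_real t \<in> op_spectrum (Rep_bop h)) \<and>
      (\<forall>k. integrable M (\<lambda>t. t ^ k) \<and>
        cinner \<psi> ((blinfun_apply (Rep_bop h) ^^ k) \<psi>) = complex_of_real (LINT t|M. t ^ k))) \<longleftrightarrow> moment_measure M h \<psi>" for M
  proof -
    have "cinner \<psi> (h ^ k \<odot> \<psi>) = complex_of_real (qf (h ^ k) \<psi>)" for k
      by (rule cinner_self_adjoint) (simp add: h)
    then show ?thesis
      using moment_measure_AE_spectrum[OF h, of M \<psi>] unfolding pow moment_measure_def of_real_eq_iff by fastforce
  qed
  \<comment> \<open>The summand 1 keeps the interval nondegenerate when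
    \<open>h = 0\<close>.\<close>
  have "- (norm h + 1) * (norm \<phi>)\<^sup>2 \<le> qf h \<phi>" "qf h \<phi> \<le> (norm h + 1) * (norm \<phi>)\<^sup>2" for \<phi>
    using abs_qf_le[of h \<phi>] zero_le_power2[of "norm \<phi>"] unfolding minus_mult_left[symmetric] distrib_right by linarith+
  then obtain M where "moment_measure M h \<psi>"
    using moment_measure_exists[OF h, of "- (norm h + 1)" "norm h + 1" \<psi>] norm_ge_zero[of h] by force
  then have "spectral_measure (Rep_bop h) \<psi> = M"
    unfolding spectral_measure_def iff by (intro the_equality) (auto intro: moment_measure_unique)
  with \<open>moment_measure M h \<psi>\<close> show ?thesis by simp
qed

section \<open>Norm bounds and uniform limits of polynomials of an operator\<close>

lemma norm_pev_le:
  assumes h: "adj h = h" and M: "\<And>\<psi>. \<exists>M. moment_measure M h \<psi> \<and> (AE t in M. \<bar>poly p t\<bar> \<le> c)" and "0 \<le> c"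
  shows "norm (pev p h) \<le> c"
proof (rule norm_bop_bound[OF \<open>0 \<le> c\<close>])
  fix \<psi>
  obtain M where M: "moment_measure M h \<psi>" and AE: "AE t in M. \<bar>poly p t\<bar> \<le> c" using M by blast
  interpret finite_measure M by (rule moment_measureD(2)[OF M])
  \<comment> \<open>The squared norm is itself a form, hence an integral of the square of
    \<open>p\<close>.\<close>
  have "(norm (pev p h \<odot> \<psi>))\<^sup>2 = qf (pev (p * p) h) \<psi>" by (simp add: qf_square[OF adj_pev[OF h]])
  also have "\<dots> = (LINT t|M. poly (p * p) t)" by (rule moment_measure_poly(2)[OF M, symmetric])
  also have "\<dots> \<le> (LINT t|M. c\<^sup>2)"
  proof (rule integral_mono_AE[OF moment_measure_poly(1)[OF M]])
    show "AE t in M. poly (p * p) t \<le> c\<^sup>2"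
      using AE by eventually_elim (metis abs_ge_zero power2_abs power2_eq_square power_mono poly_mult)
  qed simp
  also have "\<dots> = (c * norm \<psi>)\<^sup>2" using moment_measureD(3,4)[OF M] by (simp add: power_mult_distrib)
  finally show "norm (pev p h \<odot> \<psi>) \<le> c * norm \<psi>" using \<open>0 \<le> c\<close> by (auto intro: power2_le_imp_le)
qed

text \<open>Functional calculus for a function that polynomials approximate uniformly on a set
  \<open>S\<close> carrying the measures. \<open>F\<close> may be discontinuous outside
  \<open>S\<close>, which admits both the square root and a step inside a spectral gap.\<close>

lemma pev_uniform_limit:
  fixes F :: "real \<Rightarrow> real"
  assumes h: "adj h = h" and M: "\<And>\<psi>. \<exists>M. moment_measure M h \<psi> \<and> (AE t in M. t \<in> S)"
    and approx: "\<And>n t. t \<in> S \<Longrightarrow> \<bar>poly (p n) t - F t\<bar> \<le> e n" and e: "e \<longlonglongrightarrow> 0" "\<And>n. 0 \<le> e n"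
    and F: "F \<in> borel_measurable borel" "\<And>t. \<bar>F t\<bar> \<le> B"
  obtains x where "adj x = x" "\<And>n. norm (pev (p n) h - x) \<le> e n"
    "\<And>\<psi> M. moment_measure M h \<psi> \<Longrightarrow> AE t in M. t \<in> S \<Longrightarrow> qf x \<psi> = (LINT t|M. F t)"
proof -
  have diff: "norm (pev (p n) h - pev (p m) h) \<le> e n + e m" for n m
  proof -
    have "norm (pev (p n - p m) h) \<le> e n + e m"
    proof (rule norm_pev_le[OF h])
      fix \<psi>
      obtain M where "moment_measure M h \<psi>" "AE t in M. t \<in> S" using M by blast
      then show "\<exists>M. moment_measure M h \<psi> \<and> (AE t in M. \<bar>poly (p n - p m) t\<bar> \<le> e n + e m)"
      proof (intro exI[of _ M] conjI)
        show "AE t in M. \<bar>poly (p n - p m) t\<bar> \<le> e n + e m" using \<open>AE t in M. t \<in> S\<close>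
        proof eventually_elim
          case (elim t)
          then show ?case
            using approx[OF elim, of n] approx[OF elim, of m] unfolding poly_diff by linarith
        qed
      qed
    qed (use e(2) in simp)
    then show ?thesis by simp
  qed
  have "Cauchy (\<lambda>n. pev (p n) h)"
  proof (rule metric_CauchyI)
    fix d :: real assume "0 < d"
    then obtain N where N: "\<And>n. n \<ge> N \<Longrightarrow> e n < d / 2" using LIMSEQ_D[OF e(1), of "d / 2"] e(2) by auto
    have "dist (pev (p n) h) (pev (p m) h) < d" if "n \<ge> N" "m \<ge> N" for n m
      using diff[of n m] N[OF that(1)] N[OF that(2)] unfolding dist_norm by linarith
    then show "\<exists>N. \<forall>n\<ge>N. \<forall>m\<ge>N. dist (pev (p n) h) (pev (p m) h) < d" by blast
  qed
  then obtain x where x: "(\<lambda>n. pev (p n) h) \<longlonglongrightarrow> x" using Cauchy_convergent convergent_def by blast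
  have adj_x: "adj x = x"
    using bounded_linear.tendsto[OF bounded_linear_adj x] x LIMSEQ_unique by (simp add: h)
  have norm_x: "norm (pev (p n) h - x) \<le> e n" for n
  proof (rule LIMSEQ_le)
    show "(\<lambda>m. norm (pev (p n) h - pev (p m) h)) \<longlonglongrightarrow> norm (pev (p n) h - x)" by (intro tendsto_intros x)
    show "(\<lambda>m. e n + e m) \<longlonglongrightarrow> e n" using tendsto_add[OF tendsto_const[of "e n"] e(1)] by simp
  qed (use diff in auto)
  have "qf x \<psi> = (LINT t|M. F t)" if M: "moment_measure M h \<psi>" and AE: "AE t in M. t \<in> S" for \<psi> M
  proof (rule LIMSEQ_unique)
    show "(\<lambda>n. qf (pev (p n) h) \<psi>) \<longlonglongrightarrow> qf x \<psi>"
      unfolding qf_def by (intro tendsto_Re tendsto_cinner tendsto_app x tendsto_const)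
    have "AE t in M. \<bar>poly (p n) t - F t\<bar> \<le> e n" for n using AE by eventually_elim (rule approx)
    then have "\<bar>qf (pev (p n) h) \<psi> - (LINT t|M. F t)\<bar> \<le> e n * (norm \<psi>)\<^sup>2" for n
      by (rule moment_measure_integral_close[OF M F])
    moreover have "(\<lambda>n. e n * (norm \<psi>)\<^sup>2) \<longlonglongrightarrow> 0" by (intro tendsto_mult_left_zero e)
    ultimately have "(\<lambda>n. qf (pev (p n) h) \<psi> - (LINT t|M. F t)) \<longlonglongrightarrow> 0"
      unfolding real_norm_def[symmetric] by (rule Lim_null_comparison[OF always_eventually, rule_format])
    then show "(\<lambda>n. qf (pev (p n) h) \<psi>) \<longlonglongrightarrow> (LINT t|M. F t)" by (simp add: LIM_zero_iff)
  qed
  then show ?thesis using that[OF adj_x norm_x] by blast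
qed

text \<open>Used with \<open>q n\<close> equal to the variable, to square a square root, and with
  \<open>q = p\<close>, to obtain an idempotent.\<close>

lemma pev_limit_square:
  assumes h: "adj h = h" and M: "\<And>\<psi>. \<exists>M. moment_measure M h \<psi> \<and> (AE t in M. t \<in> S)"
    and x: "(\<lambda>n. pev (p n) h) \<longlonglongrightarrow> x" and y: "(\<lambda>n. pev (q n) h) \<longlonglongrightarrow> y"
    and le: "\<And>n t. t \<in> S \<Longrightarrow> \<bar>poly (p n) t * poly (p n) t - poly (q n) t\<bar> \<le> d n"
    and d: "d \<longlonglongrightarrow> 0" "\<And>n. 0 \<le> d n"
  shows "x * x = y"
proof -
  have "norm (pev (p n * p n - q n) h) \<le> d n" for n
  proof (rule norm_pev_le[OF h _ d(2)])
    fix \<psi>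
    obtain M where M: "moment_measure M h \<psi>" "AE t in M. t \<in> S" using M by blast
    have "AE t in M. \<bar>poly (p n * p n - q n) t\<bar> \<le> d n" using M(2) by eventually_elim (use le in simp)
    then show "\<exists>M. moment_measure M h \<psi> \<and> (AE t in M. \<bar>poly (p n * p n - q n) t\<bar> \<le> d n)"
      using M(1) by blast
  qed
  then have "(\<lambda>n. pev (p n) h * pev (p n) h - pev (q n) h) \<longlonglongrightarrow> 0"
    by (intro Lim_null_comparison[OF _ d(1)]) simp
  moreover have "(\<lambda>n. pev (p n) h * pev (p n) h - pev (q n) h) \<longlonglongrightarrow> x * x - y" by (intro tendsto_intros x y)
  ultimately show ?thesis using LIMSEQ_unique by fastforce
qed

section \<open>Trace class operators\<close>

lemma positive_square_root:
  assumes h: "adj h = h" and pos: "\<And>\<psi>. 0 \<le> qf h \<psi>"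
  obtains b where "adj b = b" "\<And>\<psi>. 0 \<le> qf b \<psi>" "b * b = h"
proof -
  define K where "K = norm h + 1"
  have K: "0 < K" "norm h \<le> K" using norm_ge_zero[of h] by (simp_all add: K_def add_nonneg_pos)
  have upper: "qf h \<psi> \<le> K * (norm \<psi>)\<^sup>2" for \<psi>
  proof -
    have "qf h \<psi> \<le> norm h * (norm \<psi>)\<^sup>2" using abs_qf_le[of h \<psi>] by linarith
    also have "\<dots> \<le> K * (norm \<psi>)\<^sup>2" by (intro mult_right_mono K) simp
    finally show ?thesis .
  qed
  have M: "\<exists>M. moment_measure M h \<psi> \<and> (AE t in M. t \<in> {0..K})" for \<psi>
    using moment_measure_exists[OF h K(1) _ upper, of \<psi>] pos by auto
  \<comment> \<open>The truncation makes the root continuous and bounded on the whole line without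
    changing it on \<open>{0..K}\<close>.\<close>
  define F where "F t = sqrt (min \<bar>t\<bar> K)" for t
  have cont: "continuous_on A F" for A unfolding F_def by (intro continuous_intros)
  have "\<exists>p. \<forall>t. \<bar>t\<bar> \<le> K \<longrightarrow> \<bar>F t - poly p t\<bar> < inverse (real (Suc n))" for n
    using continuous_poly_approximation[OF cont, of "inverse (real (Suc n))" K] by (metis inverse_positive_iff_positive of_nat_0_less_iff zero_less_Suc)
  then obtain p where p: "\<And>n t. \<bar>t\<bar> \<le> K \<Longrightarrow> \<bar>F t - poly (p n) t\<bar> < inverse (real (Suc n))" by metis
  define e where "e n = inverse (real (Suc n))" for n
  have e: "e \<longlonglongrightarrow> 0" "\<And>n. 0 \<le> e n" unfolding e_def by (rule LIMSEQ_inverse_real_of_nat) simp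
  have approx: "\<bar>poly (p n) t - F t\<bar> \<le> e n" if "t \<in> {0..K}" for n t
    using p[of t n] that by (simp add: e_def abs_minus_commute)
  have F_bound: "\<bar>F t\<bar> \<le> sqrt K" for t using K by (simp add: F_def)
  obtain b where b: "adj b = b" "\<And>n. norm (pev (p n) h - b) \<le> e n"
    "\<And>\<psi> M. moment_measure M h \<psi> \<Longrightarrow> AE t in M. t \<in> {0..K} \<Longrightarrow> qf b \<psi> = (LINT t|M. F t)"
    using pev_uniform_limit[OF h M approx e borel_measurable_continuous_onI[OF cont] F_bound] by blast
  have lim: "(\<lambda>n. pev (p n) h) \<longlonglongrightarrow> b"
    by (rule LIM_zero_cancel, rule Lim_null_comparison[OF _ e(1)]) (simp add: b)
  have "b * b = h"
  \<comment> \<open>The error bound comes from factoring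
    \<open>(poly (p n) t)\<^sup>2 - (F t)\<^sup>2\<close>.\<close>
  proof (rule pev_limit_square[OF h M lim, of "\<lambda>_. [:0, 1:]" _ "\<lambda>n. e n * (e n + 2 * sqrt K)"])
    show "(\<lambda>n. e n * (e n + 2 * sqrt K)) \<longlonglongrightarrow> 0"
      using tendsto_mult[OF e(1) tendsto_add[OF e(1) tendsto_const[of "2 * sqrt K"]]] by simp
    fix n t
    show "0 \<le> e n * (e n + 2 * sqrt K)" using e(2)[of n] K by simp
    assume t: "t \<in> {0..K}"
    then have "F t * F t = t" by (simp add: F_def min_def)
    then have "poly (p n) t * poly (p n) t - poly [:0, 1:] t = (poly (p n) t - F t) * ((poly (p n) t - F t) + 2 * F t)"
      by (simp add: algebra_simps)
    also have "\<bar>\<dots>\<bar> \<le> e n * (e n + 2 * sqrt K)" unfolding abs_mult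
    proof (rule mult_mono)
      have "\<bar>(poly (p n) t - F t) + 2 * F t\<bar> \<le> \<bar>poly (p n) t - F t\<bar> + 2 * \<bar>F t\<bar>" by linarith
      then show "\<bar>(poly (p n) t - F t) + 2 * F t\<bar> \<le> e n + 2 * sqrt K"
        using approx[OF t, of n] F_bound[of t] by linarith
    qed (use approx[OF t] e(2)[of n] in auto)
    finally show "\<bar>poly (p n) t * poly (p n) t - poly [:0, 1:] t\<bar> \<le> e n * (e n + 2 * sqrt K)" .
  qed simp
  moreover have "0 \<le> qf b \<psi>" for \<psi>
  proof -
    obtain M where "moment_measure M h \<psi>" "AE t in M. t \<in> {0..K}" using M by blast
    moreover have "0 \<le> (LINT t|M. F t)"
      using K by (intro Bochner_Integration.integral_nonneg) (simp add: F_def)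
    ultimately show ?thesis using b(3) by simp
  qed
  ultimately show ?thesis using that b(1) by blast
qed

text \<open>No polar decomposition is needed: \<open>\<langle>\<delta>\<^sub>n, \<bar>c\<bar> \<delta>\<^sub>n\<rangle> \<le> \<parallel>\<bar>c\<bar> \<delta>\<^sub>n\<parallel> = \<parallel>c \<delta>\<^sub>n\<parallel>\<close>.\<close>

lemma trace_class_col_summable:
  assumes "col_summable c"
  shows "trace_class (Rep_bop c)"
proof -
  have qf_c: "qf (adj c * c) \<psi> = (norm (c \<odot> \<psi>))\<^sup>2" for \<psi>
    using cinner_app[of \<psi> "adj c" "c \<odot> \<psi>"] by (simp add: qf_def Re_cinner_self)
  obtain b where b: "adj b = b" "\<And>\<psi>. 0 \<le> qf b \<psi>" "b * b = adj c * c"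
    using positive_square_root[of "adj c * c"] by (auto simp: qf_c)
  have "positive_op (Rep_bop b)" using is_adjoint_Rep_bop[of b] b(1,2) clinear_Rep_bop[of b]
    by (simp add: positive_op_def self_adjoint_def qf_def app.rep_eq)
  moreover have "Rep_bop b o\<^sub>L Rep_bop b = Rep_bop (adj c) o\<^sub>L Rep_bop c"
    using b(3) by (metis times_bop.rep_eq)
  moreover have "(\<lambda>n. Re (cinner (delta n) (Rep_bop b (delta n)))) summable_on UNIV"
  proof (rule summable_on_comparison_test[OF assms[unfolded col_summable_def]])
    fix n
    have "(norm (b \<odot> delta n))\<^sup>2 = (norm (c \<odot> delta n))\<^sup>2" using qf_square[OF b(1)] qf_c b(3) by metis
    then have "norm (b \<odot> delta n) = norm (c \<odot> delta n)" by (simp add: power2_eq_iff_nonneg)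
    then show "Re (cinner (delta n) (Rep_bop b (delta n))) \<le> norm (c \<odot> delta n)"
      using complex_Re_le_cmod[of "ent b n n"] cmod_ent_le_col[of b n n] by (simp add: ent_def app.rep_eq)
    show "0 \<le> Re (cinner (delta n) (Rep_bop b (delta n)))"
      using b(2)[of "delta n"] by (simp add: qf_def app.rep_eq)
  qed
  ultimately show ?thesis unfolding trace_class_def using is_adjoint_Rep_bop clinear_Rep_bop by blast
qed

section \<open>The Fermi projection\<close>

text \<open>The error is the binomial tail on the wrong side of \<open>n / 2\<close>. Each of its
  terms is at most \<open>n choose k\<close> times \<open>w ^ n\<close> with
  \<open>w = sqrt (s * (1 - s))\<close>, the binomial coefficients sum to \<open>2 ^ n\<close>, and
  \<open>4 * w\<^sup>2\<close> equals \<open>1 - 4 * (s - 1 / 2)\<^sup>2\<close>.\<close>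

lemma bernstein_step_error:
  fixes s \<eta> :: real
  assumes s: "0 \<le> s" "s \<le> 1" and \<eta>: "0 \<le> \<eta>" "\<eta> \<le> \<bar>s - 1 / 2\<bar>"
  shows "\<bar>(\<Sum>k | k \<le> n \<and> 2 * k < n. real (n choose k) * (s ^ k * (1 - s) ^ (n - k))) - (if s < 1 / 2 then 1 else 0)\<bar>
    \<le> sqrt (1 - 4 * \<eta>\<^sup>2) ^ n"
proof -
  define w where "w = sqrt (s * (1 - s))"
  have w0: "0 \<le> w" and ww: "w * w = s * (1 - s)" using s by (simp_all add: w_def)
  have "\<eta>\<^sup>2 \<le> (s - 1 / 2)\<^sup>2" using \<eta> power_mono[of \<eta> "\<bar>s - 1 / 2\<bar>" 2] by simp
  then have "(2 * w)\<^sup>2 \<le> 1 - 4 * \<eta>\<^sup>2" using ww by (simp add: power2_eq_square algebra_simps)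
  then have w_le: "2 * w \<le> sqrt (1 - 4 * \<eta>\<^sup>2)" by (rule real_le_rsqrt)
  have part: "(\<Sum>k\<in>J. real (n choose k) * (s ^ k * (1 - s) ^ (n - k))) \<le> sqrt (1 - 4 * \<eta>\<^sup>2) ^ n"
    if J: "J \<subseteq> {..n}" "\<And>k. k \<in> J \<Longrightarrow> s ^ k * (1 - s) ^ (n - k) \<le> w ^ n" for J
  proof -
    have "(\<Sum>k\<in>J. real (n choose k) * (s ^ k * (1 - s) ^ (n - k))) \<le> (\<Sum>k\<in>J. real (n choose k) * w ^ n)"
      by (intro sum_mono mult_left_mono J) simp_all
    also have "\<dots> \<le> (\<Sum>k\<le>n. real (n choose k) * w ^ n)" using J(1) w0 by (intro sum_mono2) auto
    also have "\<dots> = (\<Sum>k\<le>n. real (n choose k)) * w ^ n" by (simp only: sum_distrib_right)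
    also have "(\<Sum>k\<le>n. real (n choose k)) = 2 ^ n"
      by (metis choose_row_sum of_nat_numeral of_nat_power of_nat_sum)
    also have "2 ^ n * w ^ n = (2 * w) ^ n" by (simp add: power_mult_distrib)
    also have "\<dots> \<le> sqrt (1 - 4 * \<eta>\<^sup>2) ^ n" using w0 w_le by (intro power_mono) auto
    finally show ?thesis .
  qed
  \<comment> \<open>The smaller factor carries the larger exponent: factors are paired off, and the
    unpaired ones are at most \<open>w\<close>.\<close>
  have power_le: "a ^ i * b ^ j \<le> w ^ (i + j)" if ab: "0 \<le> a" "a \<le> b" "a * b = w * w" and "j \<le> i" for a b :: real and i j
  proof -
    have "a * a \<le> w * w" unfolding ab(3)[symmetric] using ab by (intro mult_left_mono)
    then have "a \<le> w"
      using w0 ab(1) by (simp add: abs_le_square_iff[symmetric] power2_eq_square[symmetric])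
    have "a ^ i * b ^ j = (a ^ j * a ^ (i - j)) * b ^ j"
      using \<open>j \<le> i\<close> by (simp add: power_add[symmetric])
    also have "\<dots> = (w * w) ^ j * a ^ (i - j)"
      unfolding ab(3)[symmetric] by (simp add: power_mult_distrib)
    also have "\<dots> \<le> (w * w) ^ j * w ^ (i - j)"
      using \<open>a \<le> w\<close> ab(1) by (intro mult_left_mono power_mono) auto
    also have "\<dots> = w ^ (i + j)"
      using \<open>j \<le> i\<close> by (simp add: power_mult_distrib power_add[symmetric] add.commute)
    finally show ?thesis .
  qed
  let ?b = "\<lambda>k. real (n choose k) * (s ^ k * (1 - s) ^ (n - k))"
  let ?J = "{k. k \<le> n \<and> 2 * k < n}"
  have b0: "0 \<le> ?b k" for k using s by simp
  show ?thesis
  proof (cases "s < 1 / 2")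
    case True
    have "(\<Sum>k\<le>n. ?b k) = 1" using binomial_ring[of s "1 - s" n] by (simp add: mult.assoc)
    moreover have "(\<Sum>k\<le>n. ?b k) = (\<Sum>k\<in>?J. ?b k) + (\<Sum>k\<in>{..n} - ?J. ?b k)"
      by (subst sum.subset_diff[of ?J "{..n}"]) auto
    moreover have "(\<Sum>k\<in>{..n} - ?J. ?b k) \<le> sqrt (1 - 4 * \<eta>\<^sup>2) ^ n"
    proof (rule part)
      show "s ^ k * (1 - s) ^ (n - k) \<le> w ^ n" if "k \<in> {..n} - ?J" for k
        using power_le[of s "1 - s" "n - k" k] that s True ww by auto
    qed auto
    moreover have "0 \<le> (\<Sum>k\<in>{..n} - ?J. ?b k)" by (intro sum_nonneg b0)
    ultimately show ?thesis using True by simp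
  next
    case False
    have "(\<Sum>k\<in>?J. ?b k) \<le> sqrt (1 - 4 * \<eta>\<^sup>2) ^ n"
    proof (rule part)
      show "s ^ k * (1 - s) ^ (n - k) \<le> w ^ n" if "k \<in> ?J" for k
        using power_le[of "1 - s" s k "n - k"] that s False ww by (auto simp: mult.commute)
    qed auto
    moreover have "0 \<le> (\<Sum>k\<in>?J. ?b k)" by (intro sum_nonneg b0)
    ultimately show ?thesis using False by simp
  qed
qed

text \<open>The projection is built as a norm limit of polynomials with geometric error. The degree
  bound together with this error is what later yields spatial decay.\<close>

lemma gapped_projection_exists:
  fixes h :: "'a bop"
  assumes h: "adj h = h" and "0 < \<delta>"
    and M: "\<And>\<psi>. moment_measure (SM \<psi>) h \<psi>" and gap: "\<And>\<psi>. AE t in SM \<psi>. \<delta> \<le> \<bar>t - \<mu>\<bar>"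
  obtains p r f where "adj p = p" "p * p = p" "0 < r" "r < 1"
    "\<And>n. degree (f n) \<le> n" "\<And>n. norm (pev (f n) h - p) \<le> r ^ n"
    "\<And>\<psi>. qf p \<psi> = (LINT t|SM \<psi>. indicator {..<\<mu>} t)"
proof -
  \<comment> \<open>\<open>c\<close> exceeds every \<open>\<bar>t - \<mu>\<bar>\<close> on the
    support, so the affine map \<open>l\<close> below sends the support into the unit interval and
    \<open>\<mu>\<close> to 1/2.\<close>
  define c where "c = norm h + \<bar>\<mu>\<bar> + 1"
  have c: "0 < c" using norm_ge_zero[of h] by (simp add: c_def add_nonneg_pos)
  \<comment> \<open>The image under \<open>l\<close> of the gap radius; the minimum keeps
    \<open>\<eta>\<close> at most 1/2, so the root below is taken of a nonnegative number.\<close>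
  define \<eta> where "\<eta> = min \<delta> c / (2 * c)"
  have \<eta>: "0 < \<eta>" "\<eta> \<le> 1 / 2" using c \<open>0 < \<delta>\<close> by (simp_all add: \<eta>_def divide_simps)
  \<comment> \<open>The root is zero for \<open>\<eta> = 1 / 2\<close>; the bound 1/2 keeps
    \<open>r\<close> positive, as its logarithm becomes the decay rate.\<close>
  define r where "r = max (sqrt (1 - 4 * \<eta>\<^sup>2)) (1 / 2)"
  have r: "0 < r" "r < 1" using \<eta> by (auto simp: r_def)
  have "\<eta>\<^sup>2 \<le> (1 / 2)\<^sup>2" using \<eta> by (intro power_mono) auto
  then have r0: "0 \<le> sqrt (1 - 4 * \<eta>\<^sup>2)" by (simp add: power2_eq_square)
  define l where "l = [:1 / 2 - \<mu> / (2 * c), 1 / (2 * c):]"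
  have l: "poly l t = 1 / 2 + (t - \<mu>) / (2 * c)" for t by (simp add: l_def diff_divide_distrib)
  \<comment> \<open>The Bernstein polynomial of the indicator of the points below 1/2, composed with
    \<open>l\<close>.\<close>
  define f where "f n = (\<Sum>k | k \<le> n \<and> 2 * k < n. smult (real (n choose k)) (l ^ k * (1 - l) ^ (n - k)))" for n
  have deg: "degree (f n) \<le> n" for n unfolding f_def
  proof (rule degree_sum_le)
    fix k assume k: "k \<in> {k. k \<le> n \<and> 2 * k < n}"
    have "degree l \<le> 1" "degree (1 - l) \<le> 1" by (simp_all add: l_def one_pCons)
    then have "degree (l ^ k) \<le> k" "degree ((1 - l) ^ (n - k)) \<le> n - k"
      by (metis degree_power_le le_trans mult_le_mono1 mult_1)+
    then have "degree (l ^ k * (1 - l) ^ (n - k)) \<le> k + (n - k)"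
      by (meson add_mono degree_mult_le le_trans)
    then show "degree (smult (real (n choose k)) (l ^ k * (1 - l) ^ (n - k))) \<le> n"
      using k by (intro order_trans[OF degree_smult_le]) simp
  qed simp
  define S where "S = {t. \<bar>t\<bar> \<le> norm h \<and> \<delta> \<le> \<bar>t - \<mu>\<bar>}"
  have AE_S: "AE t in SM \<psi>. t \<in> S" for \<psi>
    using moment_measure_AE_norm[OF M[of \<psi>]] gap[of \<psi>] by eventually_elim (simp add: S_def)
  then have MS: "\<exists>M. moment_measure M h \<psi> \<and> (AE t in M. t \<in> S)" for \<psi> using M by blast
  have approx: "\<bar>poly (f n) t - indicator {..<\<mu>} t\<bar> \<le> r ^ n" if t: "t \<in> S" for n t
  proof -
    have "\<bar>t - \<mu>\<bar> \<le> c" using t by (auto simp: S_def c_def)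
    then have "\<bar>(t - \<mu>) / (2 * c)\<bar> \<le> 1 / 2" using c by (simp add: abs_divide divide_simps)
    then have s: "0 \<le> poly l t" "poly l t \<le> 1" unfolding l by linarith+
    have "min \<delta> c \<le> \<bar>t - \<mu>\<bar>" using t by (auto simp: S_def)
    then have \<eta>': "\<eta> \<le> \<bar>poly l t - 1 / 2\<bar>" using c by (simp add: l \<eta>_def abs_divide divide_right_mono)
    have "poly (f n) t = (\<Sum>k | k \<le> n \<and> 2 * k < n. real (n choose k) * (poly l t ^ k * (1 - poly l t) ^ (n - k)))"
      by (simp add: f_def poly_sum)
    moreover have "indicator {..<\<mu>} t = (if poly l t < 1 / 2 then 1 else 0 :: real)"
      using c by (simp add: l divide_less_0_iff)
    ultimately have "\<bar>poly (f n) t - indicator {..<\<mu>} t\<bar> \<le> sqrt (1 - 4 * \<eta>\<^sup>2) ^ n"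
      using bernstein_step_error[OF s less_imp_le[OF \<eta>(1)] \<eta>', of n] by simp
    also have "\<dots> \<le> r ^ n" using r0 by (intro power_mono) (auto simp: r_def)
    finally show ?thesis .
  qed
  have lim_r: "(\<lambda>n. r ^ n) \<longlonglongrightarrow> 0" using r by (intro LIMSEQ_realpow_zero) auto
  have r_nonneg: "0 \<le> r ^ n" for n using r by simp
  have ind: "(indicator {..<\<mu>} :: real \<Rightarrow> real) \<in> borel_measurable borel" "\<bar>indicator {..<\<mu>} t :: real\<bar> \<le> 1" for t
    by (simp_all add: indicator_def)
  obtain p where p: "adj p = p" "\<And>n. norm (pev (f n) h - p) \<le> r ^ n"
    "\<And>\<psi> M. moment_measure M h \<psi> \<Longrightarrow> AE t in M. t \<in> S \<Longrightarrow> qf p \<psi> = (LINT t|M. indicator {..<\<mu>} t)"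
    using pev_uniform_limit[OF h MS approx lim_r r_nonneg ind] by blast
  have lim: "(\<lambda>n. pev (f n) h) \<longlonglongrightarrow> p"
    by (rule LIM_zero_cancel, rule Lim_null_comparison[OF _ lim_r]) (simp add: p)
  have "p * p = p"
  proof (rule pev_limit_square[OF h MS lim lim, of "\<lambda>n. 2 * r ^ n"])
    fix n t assume t: "t \<in> S"
    define z where "z = poly (f n) t - indicator {..<\<mu>} t"
    have z: "\<bar>z\<bar> \<le> r ^ n" unfolding z_def by (rule approx[OF t])
    have "r ^ n \<le> 1" using r by (simp add: power_le_one)
    have "poly (f n) t * poly (f n) t - poly (f n) t = (2 * indicator {..<\<mu>} t - 1 + z) * z"
      by (cases "t < \<mu>") (simp_all add: z_def algebra_simps)
    also have "\<bar>\<dots>\<bar> \<le> 2 * r ^ n"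
      unfolding abs_mult using z \<open>r ^ n \<le> 1\<close> by (intro mult_mono) (auto simp: indicator_def)
    finally show "\<bar>poly (f n) t * poly (f n) t - poly (f n) t\<bar> \<le> 2 * r ^ n" .
  qed (use tendsto_mult[OF tendsto_const[of 2] lim_r] r_nonneg in auto)
  show ?thesis by (rule that[OF p(1) \<open>p * p = p\<close> r deg p(2)]) (rule p(3)[OF M AE_S])
qed

text \<open>The definite description is resolved by polarization: a complex-linear operator is
  determined by its quadratic form.\<close>

lemma fermi_projection_eqI:
  assumes "adj p = p" "\<And>\<psi>. qf p \<psi> = (LINT t|spectral_measure (Rep_bop h) \<psi>. indicator {..<\<mu>} t)"
  shows "fermi_projection (Rep_bop h) \<mu> = Rep_bop p"
  unfolding fermi_projection_def borel_calculus_def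
proof (rule the_equality)
  have p: "cinner \<psi> (Rep_bop p \<psi>) = complex_of_real (LINT t|spectral_measure (Rep_bop h) \<psi>. indicator {..<\<mu>} t)" for \<psi>
    using cinner_self_adjoint[OF assms(1), of \<psi>] assms(2) by (simp add: app.rep_eq)
  then show "clinear_op (Rep_bop p) \<and> (\<forall>\<psi>. cinner \<psi> (Rep_bop p \<psi>) =
      complex_of_real (LINT t|spectral_measure (Rep_bop h) \<psi>. indicator {..<\<mu>} t))"
    using clinear_Rep_bop by blast
  fix B
  assume B: "clinear_op B \<and> (\<forall>\<psi>. cinner \<psi> (B \<psi>) = complex_of_real (LINT t|spectral_measure (Rep_bop h) \<psi>. indicator {..<\<mu>} t))"
  have "B - Rep_bop p = 0"
  proof (rule clinear_quadratic_zero)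
    show "clinear_op (B - Rep_bop p)" using B clinear_Rep_bop[of p] unfolding clinear_op_def
      by (simp add: blinfun.diff_left linear_diff[OF bounded_linear.linear[OF bounded_linear_scaleC]])
    show "cinner \<psi> ((B - Rep_bop p) \<psi>) = 0" for \<psi>
      using B p by (simp add: blinfun.diff_left cinner_diff_right)
  qed
  then show "B = Rep_bop p" by simp
qed

section \<open>Finite range and exponential decay of the kernel\<close>

lemma ent_eq_0_power:
  assumes range: "\<And>m n. R < dist1 m n \<Longrightarrow> ent h m n = 0" and "0 \<le> R"
  shows "R * real k < dist1 m n \<Longrightarrow> ent (h ^ k) m n = 0"
proof (induction k arbitrary: m n)
  case 0
  then show ?case by (auto simp: ent_one)
next
  case (Suc k)
  have "ent h m j * ent (h ^ k) j n = 0" for j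
  proof (cases "R < dist1 m j")
    case False
    then have "R * real k < dist1 j n"
      using Suc.prems dist1_triangle[of m n j] by (simp add: algebra_simps)
    then show ?thesis using Suc.IH by simp
  qed (simp add: range)
  then have "(\<lambda>j. ent h m j * ent (h ^ k) j n) = (\<lambda>j. 0)" by (rule ext)
  then have "((\<lambda>j :: int \<times> int. 0) has_sum ent (h * h ^ k) m n) UNIV"
    using ent_mult_has_sum[of h m "h ^ k" n] by (simp only:)
  then show ?case using has_sum_unique[OF _ has_sum_0_simp] by fastforce
qed

lemma ent_eq_0_pev:
  assumes range: "\<And>m n. R < dist1 m n \<Longrightarrow> ent h m n = 0" and "0 \<le> R" and "degree f \<le> k" "R * real k < dist1 m n"
  shows "ent (pev f h) m n = 0"
proof -
  have monom: "pev (monom a i) h = a *\<^sub>R h ^ i" for a i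
    by (induction i) (simp_all add: monom_0 monom_Suc of_real_def)
  have "pev f h = (\<Sum>i\<le>degree f. coeff f i *\<^sub>R h ^ i)"
    using pev_sum[of "\<lambda>i. monom (coeff f i) i" "{..degree f}" h] poly_as_sum_of_monoms[of f] by (simp add: monom)
  then have "ent (pev f h) m n = (\<Sum>i\<le>degree f. ent (coeff f i *\<^sub>R h ^ i) m n)"
    by (simp only: linear_sum[OF bounded_linear.linear[OF bounded_linear_ent]])
  also have "\<dots> = 0"
  proof (rule sum.neutral, rule ballI)
    fix i assume "i \<in> {..degree f}"
    then have "R * real i \<le> R * real k" using \<open>0 \<le> R\<close> \<open>degree f \<le> k\<close> by (intro mult_left_mono) auto
    then have "ent (h ^ i) m n = 0" using assms(4) by (intro ent_eq_0_power[OF range \<open>0 \<le> R\<close>]) auto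
    then show "ent (coeff f i *\<^sub>R h ^ i) m n = 0" by simp
  qed
  finally show ?thesis .
qed

text \<open>An approximating polynomial of degree below \<open>dist1 m n / R\<close> has a vanishing
  entry at \<open>m\<close>, \<open>n\<close>, so the entry of \<open>p\<close> there is at most the
  approximation error.\<close>

lemma exponential_decay:
  assumes range: "\<And>m n. R < dist1 m n \<Longrightarrow> ent h m n = 0" and "0 < R"
    and r: "0 < r" "r < 1" and f: "\<And>n. degree (f n) \<le> n" "\<And>n. norm (pev (f n) h - p) \<le> r ^ n"
  shows "\<exists>c>0. \<exists>C\<ge>0. \<forall>m n. cmod (ent p m n) \<le> C * exp (- c * dist1 m n)"
proof (intro exI conjI allI)
  define c where "c = - ln r / R"
  \<comment> \<open>The rate is chosen so that \<open>exp (- c * d)\<close> is \<open>r\<close> to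
    the power \<open>d / R\<close>.\<close>
  show "0 < c" using r \<open>0 < R\<close> divide_neg_pos[of "ln r" R] by (simp add: c_def)
  define C where "C = (norm p + 1) / r\<^sup>2"
  show "0 \<le> C" by (simp add: C_def add_nonneg_nonneg)
  fix m n
  \<comment> \<open>Degree \<open>N - 1\<close> rather than \<open>N\<close> is used, to have a
    strict inequality against the range. This and the rounding cost at most two powers of
    \<open>r\<close>, whence the factor \<open>1 / r\<^sup>2\<close> in \<open>C\<close>; for
    \<open>N = 0\<close> the operator norm takes over.\<close>
  define N where "N = nat \<lfloor>dist1 m n / R\<rfloor>"
  have N: "real N \<le> dist1 m n / R" "dist1 m n / R < real N + 1"
    using \<open>0 < R\<close> by (simp_all add: N_def floor_less_iff[symmetric] of_nat_nat) 
  have ln_r: "ln r < 0" using r by simp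
  have exp_c: "exp (ln r * (dist1 m n / R)) = exp (- c * dist1 m n)" by (simp add: c_def)
  have "cmod (ent p m n) \<le> (norm p + 1) * r powr (real N - 1)"
  proof (cases "N = 0")
    case True
    have "cmod (ent p m n) \<le> (norm p + 1) * 1" using cmod_ent_le[of p m n] by simp
    also have "\<dots> \<le> (norm p + 1) * r powr (real N - 1)"
      using r True by (intro mult_left_mono) (simp_all add: powr_minus_divide add_nonneg_nonneg)
    finally show ?thesis .
  next
    case False
    then have N1: "real (N - 1) = real N - 1" by (simp add: of_nat_diff)
    have "R * (real N - 1) < R * (dist1 m n / R)"
      using N(1) \<open>0 < R\<close> by (intro mult_strict_left_mono) auto
    then have "ent (pev (f (N - 1)) h) m n = 0"
      using \<open>0 < R\<close> N1 by (intro ent_eq_0_pev[OF range _ f(1)]) auto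
    then have "cmod (ent p m n) = cmod (ent (pev (f (N - 1)) h - p) m n)" by simp
    also have "\<dots> \<le> r ^ (N - 1)" by (rule order_trans[OF cmod_ent_le f(2)])
    also have "\<dots> = r powr (real N - 1)" using r N1 by (simp add: powr_realpow[symmetric])
    also have "\<dots> \<le> (norm p + 1) * r powr (real N - 1)" by (simp add: distrib_right)
    finally show ?thesis .
  qed
  also have "\<dots> \<le> (norm p + 1) * (exp (- c * dist1 m n) / r\<^sup>2)"
  proof (intro mult_left_mono)
    have "r powr (real N - 1) \<le> r powr (dist1 m n / R - 2)" using N r by (intro powr_mono') auto
    also have "\<dots> = exp (- c * dist1 m n) / r\<^sup>2"
      using r exp_c by (simp add: powr_diff powr_def[of r "dist1 m n / R"] mult.commute)
    finally show "r powr (real N - 1) \<le> exp (- c * dist1 m n) / r\<^sup>2" .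
  qed (simp add: add_nonneg_nonneg)
  finally show "cmod (ent p m n) \<le> C * exp (- c * dist1 m n)" by (simp add: C_def)
qed

section \<open>Translating the hypotheses, and assembly\<close>

lemma finite_range_dist1:
  assumes "finite_range (Rep_bop h)"
  obtains R where "0 < R" "\<And>m n. R < dist1 m n \<Longrightarrow> ent h m n = 0"
proof -
  obtain R where R: "0 < R" "\<And>m n. R < lattice_dist n m \<Longrightarrow> cinner (delta m) (Rep_bop h (delta n)) = 0"
    using assms unfolding finite_range_def by blast
  \<comment> \<open>Each coordinate difference is at most the Euclidean distance, so the range at
    most doubles.\<close>
  have "dist1 m n \<le> 2 * lattice_dist n m" for m n
  proof -
    have "\<bar>real_of_int (fst n) - real_of_int (fst m)\<bar> \<le> lattice_dist n m"
      "\<bar>real_of_int (snd n) - real_of_int (snd m)\<bar> \<le> lattice_dist n m"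
      by (simp_all add: lattice_dist_def real_sqrt_ge_abs1 real_sqrt_ge_abs2)
    then show ?thesis by (simp add: dist1_def abs_minus_commute)
  qed
  then have "R < lattice_dist n m" if "2 * R < dist1 m n" for m n using that by (smt (verit))
  then have "ent h m n = 0" if "2 * R < dist1 m n" for m n
    using R(2) that by (simp add: ent_def app.rep_eq)
  then show ?thesis using R(1) by (intro that[of "2 * R"]) simp_all
qed

lemma step_like_switch:
  assumes "switch_function \<Lambda>" "\<And>m n. \<bar>q m - q n\<bar> \<le> dist1 m n"
  shows "\<exists>L0. \<forall>L\<ge>L0. step_like q L (\<lambda>n. \<Lambda> (q n))"
proof -
  obtain Ll Lr where L: "Ll < 0" "0 < Lr" "\<And>x. x < Ll \<Longrightarrow> \<Lambda> x = 0" "\<And>x. Lr < x \<Longrightarrow> \<Lambda> x = 1"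
    using assms(1) unfolding switch_function_def by blast
  have "\<Lambda> x \<in> {0..1}" for x using assms(1) unfolding switch_function_def by blast
  then show ?thesis using assms(2) L by (intro exI[of _ "max (- Ll) Lr"]) (auto simp: step_like_def)
qed

theorem mainTheorem5:
  fixes H P C :: "(int \<times> int) ell2 \<Rightarrow>\<^sub>L (int \<times> int) ell2"
    and G :: "real set" and \<mu> :: real
    and \<Lambda>x \<Lambda>y :: "real \<Rightarrow> real"
  assumes "self_adjoint H"
    and "finite_range H"
    and "spectral_gap H G"
    and "\<mu> \<in> G"
    and "switch_function \<Lambda>x"
    and "switch_function \<Lambda>y"
    and "P = fermi_projection H \<mu>"
    and "C = commutator (P o\<^sub>L switch_op_x \<Lambda>x o\<^sub>L P) (P o\<^sub>L switch_op_y \<Lambda>y o\<^sub>L P)"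
  shows "trace_class C \<and> 2 * complex_of_real pi * \<i> * op_trace C \<in> \<int>"
proof -
  define h where "h = Abs_bop H"
  have H: "is_adjoint H H" using assms(1) by (simp add: self_adjoint_def)
  then have Rep_h: "Rep_bop h = H" unfolding h_def by (intro Abs_bop_inverse) auto
  then have h: "adj h = h"
    using is_adjoint_unique[OF is_adjoint_Rep_bop[of h]] H by (metis Rep_bop_inject)
  have G: "open G" "complex_of_real ` G \<inter> op_spectrum H = {}"
    using assms(3) by (auto simp: spectral_gap_def)
  \<comment> \<open>Spectral measures live on the spectrum, so the gap becomes a distance
    \<open>\<delta>\<close> from \<open>\<mu>\<close> that is uniform in the vector.\<close>
  obtain \<delta> where \<delta>: "0 < \<delta>" "ball \<mu> \<delta> \<subseteq> G" using G(1) assms(4) open_contains_ball by blast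
  note M = spectral_measure_moment_measure[OF h]
  have gap: "AE t in spectral_measure (Rep_bop h) \<psi>. \<delta> \<le> \<bar>t - \<mu>\<bar>" for \<psi>
    using moment_measure_AE_spectrum[OF h M]
  proof eventually_elim
    case (elim t)
    then have "t \<notin> G" using G(2) by (auto simp: Rep_h)
    then have "t \<notin> ball \<mu> \<delta>" using \<delta>(2) by blast
    then show ?case by (simp add: dist_real_def abs_minus_commute)
  qed
  obtain p r f where p: "adj p = p" "p * p = p" and r: "0 < r" "r < 1"
    and f: "\<And>n. degree (f n) \<le> n" "\<And>n. norm (pev (f n) h - p) \<le> r ^ n"
    and qf_p: "\<And>\<psi>. qf p \<psi> = (LINT t|spectral_measure (Rep_bop h) \<psi>. indicator {..<\<mu>} t)"
    using gapped_projection_exists[OF h \<delta>(1) M gap] by blast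
  have P: "P = Rep_bop p" using fermi_projection_eqI[OF p(1) qf_p] by (simp add: assms(7) Rep_h)
  obtain R where R: "0 < R" "\<And>m n. R < dist1 m n \<Longrightarrow> ent h m n = 0"
    using finite_range_dist1[of h] assms(2) by (auto simp: Rep_h)
  obtain c D where "0 < c" "0 \<le> D" and decay: "\<And>m n. cmod (ent p m n) \<le> D * exp (- c * dist1 m n)"
    using exponential_decay[OF R(2,1) r f] by blast
  \<comment> \<open>Then \<open>2 * a = c / 2\<close> lies strictly below the decay rate
    \<open>c\<close>, which leaves room for the lattice sum.\<close>
  define a where "a = c / 4"
  have "0 < a" using \<open>0 < c\<close> by (simp add: a_def)
  obtain K where K: "col_bound (2 * a) (\<lambda>_. 0) K p"
    using col_bound_exp_decay[OF _ \<open>0 \<le> D\<close> decay, of "2 * a"] \<open>0 < c\<close> by (auto simp: a_def)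
  define gx gy where "gx n = \<Lambda>x (real_of_int (fst n))" and "gy n = \<Lambda>y (real_of_int (snd n))" for n :: "int \<times> int"
  obtain Lx Ly where "\<And>L. Lx \<le> L \<Longrightarrow> step_like (\<lambda>n. real_of_int (fst n)) L gx"
    "\<And>L. Ly \<le> L \<Longrightarrow> step_like (\<lambda>n. real_of_int (snd n)) L gy"
    using step_like_switch[OF assms(5), of "\<lambda>n. real_of_int (fst n)"]
      step_like_switch[OF assms(6), of "\<lambda>n. real_of_int (snd n)"]
    unfolding gx_def gy_def by (auto simp: dist1_def)
  then have gx: "step_like (\<lambda>n. real_of_int (fst n)) (max Lx Ly) gx"
    and gy: "step_like (\<lambda>n. real_of_int (snd n)) (max Lx Ly) gy"
    by simp_all
  have "switch_op_x \<Lambda>x = Rep_bop (diag gx)" "switch_op_y \<Lambda>y = Rep_bop (diag gy)"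
    unfolding switch_op_x_def switch_op_y_def gx_def[symmetric] gy_def[symmetric]
    using Rep_bop_diag[of gx, OF step_likeD(4)[OF gx]] Rep_bop_diag[of gy, OF step_likeD(4)[OF gy]] by simp_all
  then have C: "C = Rep_bop (p * diag gx * p * (p * diag gy * p) - p * diag gy * p * (p * diag gx * p))"
    by (simp add: assms(8) P commutator_def times_bop.rep_eq minus_bop.rep_eq)
  show ?thesis unfolding C op_trace_Rep_bop
    using trace_class_col_summable[OF col_summable_hall[OF p \<open>0 < a\<close> K gx gy]]
      tr_hall_Ints[OF p \<open>0 < a\<close> K gx gy] by simp
qed

end
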